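(* Let $\Omega\subset\mathbf{R}^d$ be a uniform domain with a locally uniformly Ahlfors regular boundary $\Gamma$, and let $d_H$ be the Hausdorff dimension of $\Gamma$. Let $\delta\ge 0$ and assume that either $\delta\in[0,2-(d-d_H))$ or $\delta>2-(d-d_H)$. Then there is an $r_0>0$ and for each $r\in(0,r_0)$ an $a>0$ such that $$\|d_\Gamma^{\,\delta/2-1}\psi\|_2\le a\,\|d_\Gamma^{\,\delta/2}(\nabla\psi)\|_2$$ for all $\psi\in C_c^1(\Gamma_r)$.
   Context: $d_\Gamma(x)$ is the Euclidean distance from $x$ to the (non-empty) boundary $\Gamma$ of $\Omega$, $\Gamma_r=\{x\in\Omega: d_\Gamma(x)<r\}$, $\|\cdot\|_2$ is the $L_2$-norm, and $C_c^1(\Gamma_r)$ denotes the $C^1$-functions with compact support in $\Gamma_r$. Uniform domain: there is a $\sigma\ge1$ and for each pair of points $x,y\in\Omega$ a rectifiable curve $\gamma:[0,l]\to\Omega$, parametrized by arc length, such that $\gamma(0)=x$, $\gamma(l)=y$, with length $l\le\sigma|x-y|$ and $d_\Gamma(\gamma(t))\ge\sigma^{-1}\min(t,l-t)$ for all $t\in[0,l]$. Locally uniformly Ahlfors regular boundary: for $z\in\Gamma$ and $R>0$ let $A_z=\Gamma\cap\overline{B}(z;R)$, where $\overline B(x;r)$ is the closed ball with centre $x$ and radius $r$. $\Gamma$ is locally uniformly Ahlfors regular if there exist a Borel measure $\mu$ on $\Gamma$, a $C>1$, an $R>0$ and an $s\in(0,d]$ such that $$C^{-1}r^s\le\mu(A_z\cap\overline{B}(x;r))\le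 C\,r^s$$ for all $z\in\Gamma$, all $x\in A_z$ and all $r\in(0,2R]$. (Then necessarily $s=d_H$.) *)

theory Defs
  imports "HOL-Analysis.Analysis"
begin

subsection \<open>Hausdorff measure and Hausdorff dimension\<close>

text \<open>The contribution of a set with diameter $\rho$ to the $s$-dimensional measure is $\rho^s$,
  with the usual conventions $0^0 = 1$ for a nonempty set and $0$ for the empty set. The case $s = 0$
  is separate because \<open>0 powr 0 = 0\<close>. Coverings are by bounded sets because \<^const>\<open>diameter\<close> is
  unspecified on unbounded ones.\<close>

definition hausdorff_gauge :: "real \<Rightarrow> 'a::metric_space set \<Rightarrow> ennreal" where
  "hausdorff_gauge s U =
     (if U = {} then 0 else if s = 0 then 1 else ennreal (diameter U powr s))"

definition hausdorff_premeasure :: "real \<Rightarrow> real \<Rightarrow> 'a::metric_space set \<Rightarrow> ennreal" where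
  "hausdorff_premeasure \<epsilon> s A =
     (INF U \<in> {U :: nat \<Rightarrow> 'a set. A \<subseteq> (\<Union>i. U i) \<and> (\<forall>i. bounded (U i) \<and> diameter (U i) \<le> \<epsilon>)}.
        (\<Sum>i. hausdorff_gauge s (U i)))"

definition hausdorff_measure :: "real \<Rightarrow> 'a::metric_space set \<Rightarrow> ennreal" where
  "hausdorff_measure s A = (SUP \<epsilon> \<in> {0<..}. hausdorff_premeasure \<epsilon> s A)"

text \<open>Real-valued: in a Euclidean space the set below contains every $s$ exceeding the dimension
  of the space, so the infimum is over a nonempty set bounded below.\<close>

definition hausdorff_dim :: "'a::euclidean_space set \<Rightarrow> real" where
  "hausdorff_dim A = Inf {s. 0 \<le> s \<and> hausdorff_measure s A = 0}"


subsection \<open>Uniform domains\<close>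

definition curve_length :: "(real \<Rightarrow> 'a::metric_space) \<Rightarrow> real \<Rightarrow> real \<Rightarrow> ennreal" where
  "curve_length \<gamma> a b =
     (SUP (n, t) \<in> {(n::nat, t :: nat \<Rightarrow> real). mono t \<and> t 0 = a \<and> t n = b}.
        (\<Sum>i<n. ennreal (dist (\<gamma> (t i)) (\<gamma> (t (Suc i))))))"

text \<open>In particular such a curve is rectifiable, of total length \<open>l\<close>.\<close>

definition arc_length_curve :: "(real \<Rightarrow> 'a::metric_space) \<Rightarrow> real \<Rightarrow> bool" where
  "arc_length_curve \<gamma> l \<longleftrightarrow>
     0 \<le> l \<and> continuous_on {0..l} \<gamma> \<and> (\<forall>t\<in>{0..l}. curve_length \<gamma> 0 t = ennreal t)"

definition uniform_domain :: "'a::euclidean_space set \<Rightarrow> bool" where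
  "uniform_domain \<Omega> \<longleftrightarrow>
     open \<Omega> \<and> connected \<Omega> \<and> \<Omega> \<noteq> {} \<and>
     (\<exists>\<sigma>\<ge>1. \<forall>x\<in>\<Omega>. \<forall>y\<in>\<Omega>. \<exists>\<gamma> l.
        arc_length_curve \<gamma> l \<and> \<gamma> ` {0..l} \<subseteq> \<Omega> \<and> \<gamma> 0 = x \<and> \<gamma> l = y \<and>
        l \<le> \<sigma> * dist x y \<and>
        (\<forall>t\<in>{0..l}. infdist (\<gamma> t) (frontier \<Omega>) \<ge> min t (l - t) / \<sigma>))"


subsection \<open>Locally uniformly Ahlfors regular sets\<close>

definition locally_uniformly_Ahlfors_regular :: "'a::euclidean_space set \<Rightarrow> bool" where
  "locally_uniformly_Ahlfors_regular \<Gamma> \<longleftrightarrow>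
     (\<exists>(\<mu> :: 'a measure) C R s.
        sets \<mu> = sets (restrict_space borel \<Gamma>) \<and>
        C > 1 \<and> R > 0 \<and> 0 < s \<and> s \<le> real DIM('a) \<and>
        (\<forall>z\<in>\<Gamma>. \<forall>x\<in>\<Gamma> \<inter> cball z R. \<forall>r\<in>{0<..2 * R}.
           ennreal (r powr s / C) \<le> emeasure \<mu> (\<Gamma> \<inter> cball z R \<inter> cball x r) \<and>
           emeasure \<mu> (\<Gamma> \<inter> cball z R \<inter> cball x r) \<le> ennreal (C * r powr s)))"


subsection \<open>Test functions and norms\<close>

definition boundary_layer :: "'a::euclidean_space set \<Rightarrow> real \<Rightarrow> 'a set" where
  "boundary_layer \<Omega> r = {x\<in>\<Omega>. infdist x (frontier \<Omega>) < r}"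

definition gradient :: "(real^'n \<Rightarrow> complex) \<Rightarrow> real^'n \<Rightarrow> complex^'n" where
  "gradient \<psi> x = (\<chi> i. frechet_derivative \<psi> (at x) (axis i 1))"

text \<open>Functions in $C_c^1(U)$, for \<open>U\<close> open, are identified with their extensions by zero to the
  whole space. They are complex-valued; real functions are the special case with values
  in the reals.\<close>

definition C1_compact_support :: "(real^'n) set \<Rightarrow> (real^'n \<Rightarrow> complex) set" where
  "C1_compact_support U =
     {\<psi>. (\<forall>x. \<psi> differentiable (at x)) \<and> continuous_on UNIV (gradient \<psi>) \<and>
         compact (closure {x. \<psi> x \<noteq> 0}) \<and> closure {x. \<psi> x \<noteq> 0} \<subseteq> U}"

text \<open>The norm of $L_2(\Omega)$, for square-integrable \<open>f\<close>. It is applied below only to functions that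
  are continuous on \<open>\<Omega>\<close> with compact support in \<open>\<Omega>\<close>, which are square-integrable. For
  vector-valued \<open>f\<close> the pointwise norm is the Euclidean one.\<close>

definition L2_norm_on :: "'a::euclidean_space set \<Rightarrow> ('a \<Rightarrow> 'b::real_normed_vector) \<Rightarrow> real" where
  "L2_norm_on \<Omega> f = sqrt (LINT x:\<Omega>|lborel. (norm (f x))\<^sup>2)"

end

theory Submission
  imports Defs
begin

text \<open>Let \<open>d\<close> be the distance to the boundary, \<open>D\<close> the dimension
  of the space and \<open>s\<close> the exponent of the regular measure, which equals the
  Hausdorff dimension of the boundary. Averages of \<open>\<psi>\<close> over a ball of radius
  about \<open>d x\<close> are telescoped along a chain of balls with geometrically varying radii
  that follows a curve of the uniform domain and ends where \<open>\<psi>\<close> vanishes. If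
  \<open>D - 2 + \<delta> > s\<close>, the chain leads away from the boundary, beyond the layer
  that contains the support. If \<open>D - 2 + \<delta> < s\<close>, it leads to boundary points,
  and one averages over them with respect to the regular measure. Each step of the chain is
  controlled by the gradient on a ball, and a weighted Cauchy-Schwarz inequality bounds
  \<open>\<psi>\<^sup>2\<close> by a series of kernels applied to the squared gradient. By Tonelli
  and the regularity of the boundary the \<open>k\<close>-th kernel contributes a multiple of
  \<open>q ^ k\<close> with \<open>q < 1\<close>, in either case because of the strict inequality
  between \<open>D - 2 + \<delta>\<close> and \<open>s\<close>.\<close>

section \<open>Chains of balls\<close>

text \<open>In dimension above 1 an L2 bound on the gradient does not control point values of
  \<open>\<psi>\<close>, so whole balls of comparable size are compared, point by point under a
  similarity. The obstacle is that chains have no bounded length: outward the number of balls grows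
  as the starting point approaches the boundary, inward it depends on how close the support of
  \<open>\<psi>\<close> comes to it, and the constant may depend on neither. Unweighted
  Cauchy-Schwarz would lose the number of balls. The gap between \<open>D - 2 + \<delta>\<close> and
  \<open>s\<close> is therefore halved: one half pays for geometric weights in Cauchy-Schwarz, the
  other half survives as \<open>q ^ k\<close>. Integrals are kept in \<open>ennreal\<close>, so that
  Tonelli requires no integrability; finiteness of the gradient integral enters only at the end,
  where compact support allows the passage to L2 norms.\<close>

lemma closed_in_sets_borel [measurable]:
  fixes A :: "'a::euclidean_space set"
  shows "closed A \<Longrightarrow> A \<in> sets borel"
  by auto

text \<open>The Jacobian is \<open>\<tau> ^ DIM('a)\<close>. It is estimated through a lower bound
  \<open>\<rho>\<close> for \<open>\<tau>\<close>, so that the constant stays the same while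
  \<open>\<tau>\<close> runs between the radii of two neighbouring balls.\<close>

lemma nn_integral_cball_affine_le:
  fixes F :: "'a::euclidean_space \<Rightarrow> ennreal"
  assumes [measurable]: "F \<in> borel_measurable borel" "K \<in> sets borel"
    and \<rho>: "0 < \<rho>" "\<rho> \<le> \<tau>" and sub: "\<And>u. u \<in> cball 0 1 \<Longrightarrow> c + \<tau> *\<^sub>R u \<in> K"
  shows "(\<integral>\<^sup>+u\<in>cball 0 1. F (c + \<tau> *\<^sub>R u) \<partial>lborel)
     \<le> ennreal (\<rho> powr - real DIM('a)) * (\<integral>\<^sup>+y\<in>K. F y \<partial>lborel)"
proof -
  have \<tau>: "\<tau> > 0" using \<rho> by simp
  have "(\<integral>\<^sup>+y\<in>K. F y \<partial>lborel)
      = ennreal (\<tau> ^ DIM('a)) * (\<integral>\<^sup>+u. F (c + \<tau> *\<^sub>R u) * indicator K (c + \<tau> *\<^sub>R u) \<partial>lborel)"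
    using \<tau> by (subst lborel_affine[of \<tau> c])
      (auto simp: nn_integral_density nn_integral_distr nn_integral_cmult[symmetric])
  moreover have "(\<integral>\<^sup>+u\<in>cball 0 1. F (c + \<tau> *\<^sub>R u) \<partial>lborel)
      \<le> (\<integral>\<^sup>+u. F (c + \<tau> *\<^sub>R u) * indicator K (c + \<tau> *\<^sub>R u) \<partial>lborel)"
    using sub by (intro nn_integral_mono) (auto simp: indicator_def)
  moreover have "1 \<le> ennreal (\<rho> powr - real DIM('a)) * ennreal (\<tau> ^ DIM('a))"
  proof -
    have "\<rho> powr real DIM('a) \<le> \<tau> ^ DIM('a)"
      using \<rho> by (simp add: powr_realpow power_mono)
    then have "1 \<le> \<rho> powr - real DIM('a) * \<tau> ^ DIM('a)"
      using \<rho> by (simp add: powr_minus field_simps)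
    then show ?thesis
      by (metis ennreal_le_1 ennreal_1 ennreal_leI ennreal_mult' powr_ge_zero)
  qed
  ultimately show ?thesis
    by (smt (verit, ccfv_threshold) dual_order.trans mult.assoc mult_1 mult_right_mono zero_le)
qed

text \<open>The instance of interest is \<open>f x = norm (\<psi> x)\<close> with \<open>F\<close> the squared norm of the gradient.\<close>

definition sq_upper_gradient :: "('a::euclidean_space \<Rightarrow> real) \<Rightarrow> ('a \<Rightarrow> ennreal) \<Rightarrow> bool" where
  "sq_upper_gradient f F \<longleftrightarrow> f \<in> borel_measurable borel \<and> F \<in> borel_measurable borel \<and>
     (\<forall>p q. ennreal ((f q - f p)\<^sup>2)
        \<le> ennreal ((dist p q)\<^sup>2) * (\<integral>\<^sup>+s\<in>{0..1}. F (p + s *\<^sub>R (q - p)) \<partial>lborel))"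

lemma sq_upper_gradient_measurable:
  assumes "sq_upper_gradient f F"
  shows "f \<in> borel_measurable borel" "F \<in> borel_measurable borel"
  using assms by (auto simp: sq_upper_gradient_def)

text \<open>Pairing the points of the two balls by the similarity \<open>a + \<alpha> u \<mapsto> b + \<beta> u\<close> and following the
  segments gives, at each time, a ball of radius at least \<open>\<rho>\<close> inside \<open>K\<close>.\<close>

lemma ball_difference_le:
  fixes F :: "'a::euclidean_space \<Rightarrow> ennreal"
  assumes fF: "sq_upper_gradient f F"
    and \<rho>: "0 < \<rho>" "\<rho> \<le> \<alpha>" "\<rho> \<le> \<beta>"
    and L: "dist a b + \<bar>\<beta> - \<alpha>\<bar> \<le> L"
    and K: "cball a \<alpha> \<subseteq> K" "cball b \<beta> \<subseteq> K" "convex K" "closed K"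
  shows "(\<integral>\<^sup>+u\<in>cball 0 1. ennreal ((f (b + \<beta> *\<^sub>R u) - f (a + \<alpha> *\<^sub>R u))\<^sup>2) \<partial>lborel)
     \<le> ennreal (L\<^sup>2 * \<rho> powr - real DIM('a)) * (\<integral>\<^sup>+y\<in>K. F y \<partial>lborel)"
proof -
  note [measurable] = sq_upper_gradient_measurable[OF fF]
  have [measurable]: "K \<in> sets borel" using K by auto
  have L0: "L \<ge> 0" using L by (smt (verit) zero_le_dist)
  define P where "P s u = (a + s *\<^sub>R (b - a)) + (\<alpha> + s * (\<beta> - \<alpha>)) *\<^sub>R u" for s and u :: 'a
  have P: "(a + \<alpha> *\<^sub>R u) + s *\<^sub>R ((b + \<beta> *\<^sub>R u) - (a + \<alpha> *\<^sub>R u)) = P s u" for s u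
    by (simp add: P_def algebra_simps)
  have PK: "P s u \<in> K" if "s \<in> {0..1}" "u \<in> cball 0 1" for s u
  proof -
    have 1: "a + \<alpha> *\<^sub>R u \<in> K" "b + \<beta> *\<^sub>R u \<in> K"
      by (rule subsetD[OF K(1)], use that \<rho> in \<open>simp add: dist_norm mult_left_le\<close>)
        (rule subsetD[OF K(2)], use that \<rho> in \<open>simp add: dist_norm mult_left_le\<close>)
    have "P s u = (1 - s) *\<^sub>R (a + \<alpha> *\<^sub>R u) + s *\<^sub>R (b + \<beta> *\<^sub>R u)"
      by (simp add: P_def algebra_simps)
    then show ?thesis using convexD_alt[OF K(3) 1, of s] that by simp
  qed
  have inner: "(\<integral>\<^sup>+u\<in>cball 0 1. F (P s u) \<partial>lborel)
     \<le> ennreal (\<rho> powr - real DIM('a)) * (\<integral>\<^sup>+y\<in>K. F y \<partial>lborel)" if s: "s \<in> {0..1}" for s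
  proof -
    have "\<rho> = (1 - s) * \<rho> + s * \<rho>" by (simp add: algebra_simps)
    also have "\<dots> \<le> (1 - s) * \<alpha> + s * \<beta>"
      using s \<rho> by (intro add_mono mult_left_mono) auto
    finally have "\<rho> \<le> \<alpha> + s * (\<beta> - \<alpha>)" by (simp add: algebra_simps)
    then show ?thesis
      unfolding P_def using PK[OF s] \<rho>
      by (intro nn_integral_cball_affine_le) (auto simp: P_def)
  qed
  have "(\<integral>\<^sup>+u\<in>cball 0 1. ennreal ((f (b + \<beta> *\<^sub>R u) - f (a + \<alpha> *\<^sub>R u))\<^sup>2) \<partial>lborel)
     \<le> (\<integral>\<^sup>+u. (ennreal (L\<^sup>2) * (\<integral>\<^sup>+s\<in>{0..1}. F (P s u) \<partial>lborel)) * indicator (cball 0 1) u \<partial>lborel)"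
  proof (intro nn_integral_mono, goal_cases)
    case (1 u)
    have "dist (a + \<alpha> *\<^sub>R u) (b + \<beta> *\<^sub>R u) \<le> L" if "norm u \<le> 1"
    proof -
      have "dist (a + \<alpha> *\<^sub>R u) (b + \<beta> *\<^sub>R u) = norm ((a - b) + (\<alpha> - \<beta>) *\<^sub>R u)"
        by (simp add: dist_norm algebra_simps)
      also have "\<dots> \<le> dist a b + \<bar>\<alpha> - \<beta>\<bar> * norm u"
        by (metis dist_norm norm_scaleR norm_triangle_ineq)
      also have "\<dots> \<le> dist a b + \<bar>\<alpha> - \<beta>\<bar>"
        using that by (simp add: mult_left_le)
      finally show ?thesis using L by simp
    qed
    moreover have "ennreal ((f (b + \<beta> *\<^sub>R u) - f (a + \<alpha> *\<^sub>R u))\<^sup>2) \<le>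
        ennreal ((dist (a + \<alpha> *\<^sub>R u) (b + \<beta> *\<^sub>R u))\<^sup>2) * (\<integral>\<^sup>+s\<in>{0..1}. F (P s u) \<partial>lborel)"
      using fF unfolding sq_upper_gradient_def P[symmetric] by blast
    ultimately have "ennreal ((f (b + \<beta> *\<^sub>R u) - f (a + \<alpha> *\<^sub>R u))\<^sup>2) \<le>
        ennreal (L\<^sup>2) * (\<integral>\<^sup>+s\<in>{0..1}. F (P s u) \<partial>lborel)" if "norm u \<le> 1"
      using that by (elim order_trans) (intro mult_right_mono ennreal_leI power_mono, auto)
    then show ?case by (cases "norm u \<le> 1") auto
  qed
  also have "\<dots> = ennreal (L\<^sup>2) * (\<integral>\<^sup>+u. (\<integral>\<^sup>+s. F (P s u) * indicator {0..1} s * indicator (cball 0 1) u \<partial>lborel) \<partial>lborel)"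
  proof -
    have "(\<integral>\<^sup>+s. F (P s u) * indicator {0..1} s * indicator (cball 0 1) u \<partial>lborel)
        = (\<integral>\<^sup>+s\<in>{0..1}. F (P s u) \<partial>lborel) * indicator (cball 0 1) u" for u
      unfolding P_def by (rule nn_integral_multc) measurable
    then show ?thesis
      by (simp only: mult.assoc) (rule nn_integral_cmult, unfold P_def, measurable)
  qed
  \<comment> \<open>The order of integration is changed because for a fixed time \<open>s\<close>
    the map \<open>P s\<close> is a dilation, to which the change of variables in
    \<open>inner\<close> applies.\<close>
  also have "(\<integral>\<^sup>+u. (\<integral>\<^sup>+s. F (P s u) * indicator {0..1} s * indicator (cball 0 1) u \<partial>lborel) \<partial>lborel)
     = (\<integral>\<^sup>+s. (\<integral>\<^sup>+u. F (P s u) * indicator {0..1} s * indicator (cball 0 1) u \<partial>lborel) \<partial>lborel)"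
    unfolding P_def by (intro lborel_pair.Fubini') measurable
  also have "\<dots> \<le> (\<integral>\<^sup>+s. (ennreal (\<rho> powr - real DIM('a)) * (\<integral>\<^sup>+y\<in>K. F y \<partial>lborel)) * indicator {0..1::real} s \<partial>lborel)"
  proof (intro nn_integral_mono, goal_cases)
    case (1 s)
    then show ?case using inner[of s] by (cases "s \<in> {0..1}") auto
  qed
  also have "\<dots> = ennreal (\<rho> powr - real DIM('a)) * (\<integral>\<^sup>+y\<in>K. F y \<partial>lborel)"
    by (simp add: nn_integral_cmult)
  finally show ?thesis
    by (simp add: ennreal_mult mult.assoc mult_left_mono)
qed

text \<open>Telescoping down to \<open>a N = 0\<close>, then Cauchy-Schwarz with the factor 1 split
  as \<open>sqrt (q ^ k) * sqrt ((1/q) ^ k)\<close>. The geometric sum is at most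
  \<open>1 / (1 - q)\<close> for every \<open>N\<close>, where equal weights would cost a factor
  \<open>N\<close>.\<close>

lemma sq_le_weighted_sum_differences:
  fixes a :: "nat \<Rightarrow> real"
  assumes q: "0 < q" "q < 1" and "a N = 0"
  shows "(a 0)\<^sup>2 \<le> 1 / (1 - q) * (\<Sum>k<N. (1/q) ^ k * (a (Suc k) - a k)\<^sup>2)"
proof -
  have "(\<Sum>k<N. a (Suc k) - a k) = a N - a 0"
    by (rule sum_lessThan_telescope)
  then have "(a 0)\<^sup>2 = (\<Sum>k<N. sqrt (q ^ k) * (sqrt ((1/q) ^ k) * (a (Suc k) - a k)))\<^sup>2"
    using assms by (simp flip: mult.assoc real_sqrt_mult power_mult_distrib)
  also have "\<dots> \<le> (\<Sum>k<N. (sqrt (q ^ k))\<^sup>2) * (\<Sum>k<N. (sqrt ((1/q) ^ k) * (a (Suc k) - a k))\<^sup>2)"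
    by (rule Cauchy_Schwarz_ineq_sum)
  also have "\<dots> = (\<Sum>k<N. q ^ k) * (\<Sum>k<N. (1/q) ^ k * (a (Suc k) - a k)\<^sup>2)"
    using q by (simp add: power_mult_distrib)
  also have "(\<Sum>k<N. q ^ k) \<le> 1 / (1 - q)"
    using q by (simp add: sum_gp_strict divide_right_mono)
  finally show ?thesis
    using q by (simp add: sum_nonneg mult_right_mono)
qed

text \<open>For each fixed \<open>u\<close> the telescoping inequality is applied to the values of
  \<open>f\<close> at the corresponding points \<open>X k + P k *\<^sub>R u\<close>; integrating
  over \<open>u\<close> afterwards turns each difference into one between neighbouring
  balls.\<close>

lemma ball_chain_le:
  fixes F :: "'a::euclidean_space \<Rightarrow> ennreal"
  assumes fF: "sq_upper_gradient f F" and q: "0 < q" "q < 1"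
    and \<rho>: "\<And>k. k < N \<Longrightarrow> 0 < \<rho> k \<and> \<rho> k \<le> P k \<and> \<rho> k \<le> P (Suc k)"
    and L: "\<And>k. k < N \<Longrightarrow> dist (X k) (X (Suc k)) + \<bar>P (Suc k) - P k\<bar> \<le> L k"
    and K: "\<And>k. k < N \<Longrightarrow> cball (X k) (P k) \<subseteq> K k \<and> cball (X (Suc k)) (P (Suc k)) \<subseteq> K k \<and> convex (K k) \<and> closed (K k)"
    and last: "\<And>u. u \<in> cball 0 1 \<Longrightarrow> f (X N + P N *\<^sub>R u) = 0"
  shows "(\<integral>\<^sup>+u\<in>cball 0 1. ennreal ((f (X 0 + P 0 *\<^sub>R u))\<^sup>2) \<partial>lborel)
    \<le> ennreal (1 / (1 - q)) * (\<Sum>k<N. ennreal ((1/q) ^ k * ((L k)\<^sup>2 * \<rho> k powr - real DIM('a))) * (\<integral>\<^sup>+y\<in>K k. F y \<partial>lborel))"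
proof -
  note [measurable] = sq_upper_gradient_measurable[OF fF]
  define D where "D k u = ennreal ((f (X (Suc k) + P (Suc k) *\<^sub>R u) - f (X k + P k *\<^sub>R u))\<^sup>2)" for k u
  have [measurable]: "D k \<in> borel_measurable borel" for k unfolding D_def by measurable
  have "(\<integral>\<^sup>+u\<in>cball 0 1. ennreal ((f (X 0 + P 0 *\<^sub>R u))\<^sup>2) \<partial>lborel)
    \<le> (\<integral>\<^sup>+u. ennreal (1 / (1 - q)) * (\<Sum>k<N. ennreal ((1/q) ^ k) * (D k u * indicator (cball 0 1) u)) \<partial>lborel)"
  proof (intro nn_integral_mono, goal_cases)
    case (1 u)
    show ?case
    proof (cases "u \<in> cball 0 1")
      case True
      have "ennreal ((f (X 0 + P 0 *\<^sub>R u))\<^sup>2) \<le> ennreal (1 / (1 - q) * (\<Sum>k<N. (1/q) ^ k * (f (X (Suc k) + P (Suc k) *\<^sub>R u) - f (X k + P k *\<^sub>R u))\<^sup>2))"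
        using sq_le_weighted_sum_differences[OF q, of "\<lambda>k. f (X k + P k *\<^sub>R u)" N] last[OF True]
        by (intro ennreal_leI) auto
      also have "\<dots> = ennreal (1 / (1 - q)) * (\<Sum>k<N. ennreal ((1/q) ^ k) * D k u)"
        using q unfolding D_def
        by (subst ennreal_mult') (simp_all add: ennreal_mult'[symmetric] sum_nonneg)
      finally show ?thesis using True by simp
    qed simp
  qed
  also have "\<dots> = ennreal (1 / (1 - q)) * (\<Sum>k<N. ennreal ((1/q) ^ k) * (\<integral>\<^sup>+u\<in>cball 0 1. D k u \<partial>lborel))"
    by (simp add: nn_integral_cmult nn_integral_sum)
  also have "\<dots> \<le> ennreal (1 / (1 - q)) * (\<Sum>k<N. ennreal ((1/q) ^ k) *
      (ennreal ((L k)\<^sup>2 * \<rho> k powr - real DIM('a)) * (\<integral>\<^sup>+y\<in>K k. F y \<partial>lborel)))"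
    unfolding D_def using \<rho> L K
    by (intro mult_left_mono sum_mono ball_difference_le[OF fF]) auto
  also have "\<dots> = ennreal (1 / (1 - q)) * (\<Sum>k<N. ennreal ((1/q) ^ k * ((L k)\<^sup>2 * \<rho> k powr - real DIM('a))) * (\<integral>\<^sup>+y\<in>K k. F y \<partial>lborel))"
    using q by (simp add: ennreal_mult' mult.assoc)
  finally show ?thesis .
qed

text \<open>Cauchy-Schwarz has already been spent pointwise in \<open>x\<close>, so the estimate is
  linear in \<open>F\<close>: integrating each kernel in its first variable is enough, and the
  geometric series does the rest.\<close>

lemma nn_integral_kernel_series_le:
  fixes F W :: "'a::euclidean_space \<Rightarrow> ennreal"
  assumes [measurable]: "F \<in> borel_measurable borel" "W \<in> borel_measurable borel"
    "\<And>k. (\<lambda>(x, y). J k x y) \<in> borel_measurable (borel \<Otimes>\<^sub>M borel)"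
    and le: "\<And>x. x \<in> A \<Longrightarrow> g x \<le> (\<Sum>k. \<integral>\<^sup>+y. F y * J k x y \<partial>lborel)"
    and J: "\<And>k y. (\<integral>\<^sup>+x. J k x y \<partial>lborel) \<le> ennreal (B * q ^ k) * W y"
    and q: "0 \<le> q" "q < 1" and "B \<ge> 0"
  shows "(\<integral>\<^sup>+x\<in>A. g x \<partial>lborel) \<le> ennreal (B / (1 - q)) * (\<integral>\<^sup>+y. F y * W y \<partial>lborel)"
proof -
  have "(\<integral>\<^sup>+x\<in>A. g x \<partial>lborel) \<le> (\<integral>\<^sup>+x. (\<Sum>k. \<integral>\<^sup>+y. F y * J k x y \<partial>lborel) \<partial>lborel)"
    using le by (intro nn_integral_mono) (auto simp: indicator_def)
  also have "\<dots> = (\<Sum>k. \<integral>\<^sup>+x. (\<integral>\<^sup>+y. F y * J k x y \<partial>lborel) \<partial>lborel)"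
    by (intro nn_integral_suminf) measurable
  also have "\<dots> = (\<Sum>k. \<integral>\<^sup>+y. (\<integral>\<^sup>+x. F y * J k x y \<partial>lborel) \<partial>lborel)"
    by (intro suminf_cong lborel_pair.Fubini') measurable
  also have "\<dots> \<le> (\<Sum>k. \<integral>\<^sup>+y. ennreal (B * q ^ k) * (F y * W y) \<partial>lborel)"
  proof (intro suminf_le nn_integral_mono)
    fix k y
    have "(\<integral>\<^sup>+x. F y * J k x y \<partial>lborel) = F y * (\<integral>\<^sup>+x. J k x y \<partial>lborel)"
      by (intro nn_integral_cmult) measurable
    then show "(\<integral>\<^sup>+x. F y * J k x y \<partial>lborel) \<le> ennreal (B * q ^ k) * (F y * W y)"
      using mult_left_mono[OF J[of k y], of "F y"] by (simp add: ac_simps)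
  qed auto
  also have "\<dots> = (\<Sum>k. ennreal (B * q ^ k)) * (\<integral>\<^sup>+y. F y * W y \<partial>lborel)"
    by (simp add: nn_integral_cmult ennreal_suminf_multc)
  also have "(\<Sum>k. ennreal (B * q ^ k)) = ennreal (B / (1 - q))"
  proof -
    have "(\<lambda>k. B * q ^ k) sums (B * (1 / (1 - q)))"
      using q by (intro sums_mult geometric_sums) auto
    then show ?thesis using q \<open>B \<ge> 0\<close>
      by (subst suminf_ennreal_eq[where x="B / (1 - q)"]) auto
  qed
  finally show ?thesis .
qed

section \<open>Distance weights and averages\<close>

text \<open>The absolute value in the constant covers both signs of the exponent; exponents such as
  \<open>\<delta> - 2\<close> may have either.\<close>

lemma powr_le_of_comparable:
  fixes a c t u :: real
  assumes "0 < t" "0 < u" "t \<le> c * u" "u \<le> c * t" "1 \<le> c"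
  shows "t powr a \<le> c powr \<bar>a\<bar> * u powr a"
proof (cases "a \<ge> 0")
  case True
  have "t powr a \<le> (c * u) powr a"
    using assms True by (intro powr_mono2) auto
  then show ?thesis using True assms by (simp add: powr_mult)
next
  case False
  have "t powr a \<le> (u / c) powr a"
    using assms False by (intro powr_mono2') (auto simp: field_simps)
  then show ?thesis using False assms by (simp add: powr_divide powr_minus field_simps)
qed

lemma nn_integral_cball_substitution:
  fixes G :: "'a::euclidean_space \<Rightarrow> ennreal"
  assumes [measurable]: "G \<in> borel_measurable borel" and \<tau>: "0 < \<tau>"
  shows "ennreal (\<tau> powr - real DIM('a)) * (\<integral>\<^sup>+y\<in>cball c \<tau>. G y \<partial>lborel)
     = (\<integral>\<^sup>+u\<in>cball 0 1. G (c + \<tau> *\<^sub>R u) \<partial>lborel)"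
proof -
  have ind: "indicator (cball c \<tau>) (c + \<tau> *\<^sub>R u) = (indicator (cball 0 1) u :: ennreal)" for u
    using \<tau> by (auto simp: indicator_def dist_norm)
  have "(\<integral>\<^sup>+y\<in>cball c \<tau>. G y \<partial>lborel)
      = ennreal (\<tau> ^ DIM('a)) * (\<integral>\<^sup>+u. G (c + \<tau> *\<^sub>R u) * indicator (cball c \<tau>) (c + \<tau> *\<^sub>R u) \<partial>lborel)"
    using \<tau> by (subst lborel_affine[of \<tau> c])
      (auto simp: nn_integral_density nn_integral_distr nn_integral_cmult[symmetric])
  moreover have "ennreal (\<tau> powr - real DIM('a)) * ennreal (\<tau> ^ DIM('a)) = 1"
    using \<tau> by (simp add: powr_minus powr_realpow flip: ennreal_mult)
  ultimately show ?thesis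
    by (simp add: ind flip: mult.assoc)
qed

text \<open>Averaging over balls of radius comparable to the distance loses only a constant, so the Hardy
  inequality has to be proved for the averages only.\<close>

lemma weighted_nn_integral_le_averages:
  fixes g :: "'a::euclidean_space \<Rightarrow> ennreal"
  assumes [measurable]: "g \<in> borel_measurable borel" and "open \<Omega>"
    and \<Gamma>: "\<And>y. y \<in> \<Omega> \<Longrightarrow> 0 < infdist y \<Gamma> \<and> ball y (infdist y \<Gamma>) \<subseteq> \<Omega>"
    and \<kappa>: "0 < \<kappa>" "\<kappa> \<le> 1/2"
  shows "(\<integral>\<^sup>+y\<in>\<Omega>. ennreal (infdist y \<Gamma> powr e) * g y \<partial>lborel)
    \<le> ennreal (2 powr \<bar>e - real DIM('a)\<bar> * 2 ^ DIM('a) / unit_ball_vol (real DIM('a))) *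
       (\<integral>\<^sup>+x\<in>\<Omega>. ennreal (infdist x \<Gamma> powr e) * (\<integral>\<^sup>+u\<in>cball 0 1. g (x + (\<kappa> * infdist x \<Gamma>) *\<^sub>R u) \<partial>lborel) \<partial>lborel)"
    (is "?L \<le> ennreal ?C * ?R")
proof -
  let ?d = "\<lambda>x. infdist x \<Gamma>" and ?D = "real DIM('a)"
  have [measurable]: "\<Omega> \<in> sets borel" using \<open>open \<Omega>\<close> by auto
  have [measurable]: "?d \<in> borel_measurable borel"
    by (intro borel_measurable_continuous_onI continuous_intros)
  define J where "J x y = ennreal (?d x powr e * (\<kappa> * ?d x) powr - ?D)
     * indicator {p. dist (fst p) (snd p) \<le> \<kappa> * ?d (fst p)} (x, y) * indicator \<Omega> x" for x y
  have [measurable]: "{p::'a\<times>'a. dist (fst p) (snd p) \<le> \<kappa> * ?d (fst p)} \<in> sets (borel \<Otimes>\<^sub>M borel)"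
    unfolding borel_prod by (intro borel_closed closed_Collect_le continuous_intros)
  have J_measurable [measurable]: "(\<lambda>(x, y). J x y) \<in> borel_measurable (borel \<Otimes>\<^sub>M borel)"
    unfolding J_def by measurable
  have "?R = (\<integral>\<^sup>+x. (\<integral>\<^sup>+y. g y * J x y \<partial>lborel) \<partial>lborel)"
  proof (intro nn_integral_cong, goal_cases)
    case (1 x)
    show ?case
    proof (cases "x \<in> \<Omega>")
      case True
      then have pos: "0 < \<kappa> * ?d x" using \<Gamma> \<kappa> by auto
      have "(\<integral>\<^sup>+y. g y * J x y \<partial>lborel) = (\<integral>\<^sup>+y. ennreal (?d x powr e) * ennreal ((\<kappa> * ?d x) powr - ?D) *
           (g y * indicator (cball x (\<kappa> * ?d x)) y) \<partial>lborel)"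
        using True by (intro nn_integral_cong) (auto simp: J_def ennreal_mult indicator_def ac_simps)
      also have "\<dots> = ennreal (?d x powr e) * (ennreal ((\<kappa> * ?d x) powr - ?D) *
           (\<integral>\<^sup>+y\<in>cball x (\<kappa> * ?d x). g y \<partial>lborel))"
        by (simp add: nn_integral_cmult mult.assoc)
      also note nn_integral_cball_substitution[OF assms(1) pos]
      finally show ?thesis using True by simp
    qed (simp add: J_def)
  qed
  also have "\<dots> = (\<integral>\<^sup>+y. (\<integral>\<^sup>+x. g y * J x y \<partial>lborel) \<partial>lborel)"
    by (intro lborel_pair.Fubini') measurable
  also have "\<dots> = (\<integral>\<^sup>+y. g y * (\<integral>\<^sup>+x. J x y \<partial>lborel) \<partial>lborel)"
    by (intro nn_integral_cong nn_integral_cmult) measurable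
  finally have R: "?R = (\<integral>\<^sup>+y. g y * (\<integral>\<^sup>+x. J x y \<partial>lborel) \<partial>lborel)" .
  have C: "?C > 0" by simp
  have "?L \<le> (\<integral>\<^sup>+y. ennreal ?C * (g y * (\<integral>\<^sup>+x. J x y \<partial>lborel)) \<partial>lborel)"
  proof (intro nn_integral_mono, goal_cases)
    case (1 y)
    show ?case
    proof (cases "y \<in> \<Omega>")
      case True
      \<comment> \<open>On this ball the distances of \<open>x\<close> and \<open>y\<close> to
        \<open>\<Gamma>\<close> agree up to a factor 2, and the extra factor 1/2 in the radius then
        makes the averaging ball of \<open>x\<close> contain \<open>y\<close>.\<close>
      define \<rho> where "\<rho> = \<kappa> / 2 * ?d y"
      have dy: "?d y > 0" and ball: "ball y (?d y) \<subseteq> \<Omega>" using \<Gamma> True by auto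
      then have \<rho>: "\<rho> > 0" using \<kappa> by (simp add: \<rho>_def)
      have \<rho>': "\<rho> \<le> ?d y / 4" using dy \<kappa> by (simp add: \<rho>_def)
      define c where "c = (1/2) powr \<bar>e - ?D\<bar> * \<kappa> powr - ?D * ?d y powr (e - ?D)"
      have c: "c \<ge> 0" by (simp add: c_def)
      have "ennreal c * indicator (cball y \<rho>) x \<le> J x y" for x
      proof (cases "x \<in> cball y \<rho>")
        case x: True
        have dx: "?d x \<le> 2 * ?d y" "?d y \<le> 2 * ?d x"
          using x \<rho>' infdist_triangle[of x \<Gamma> y] infdist_triangle[of y \<Gamma> x] dy
          by (auto simp: dist_commute)
        have "x \<in> \<Omega>" using x ball \<rho>' dy by (auto simp: subset_eq)
        moreover have "dist x y \<le> \<kappa> * ?d x"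
        proof -
          have "dist x y \<le> \<kappa> / 2 * ?d y" using x by (simp add: \<rho>_def dist_commute)
          also have "\<dots> \<le> \<kappa> / 2 * (2 * ?d x)" using dx \<kappa> by (intro mult_left_mono) auto
          finally show ?thesis by simp
        qed
        moreover have "c \<le> ?d x powr e * (\<kappa> * ?d x) powr - ?D"
        proof -
          have "?d y powr (e - ?D) \<le> 2 powr \<bar>e - ?D\<bar> * ?d x powr (e - ?D)"
            using dx dy by (intro powr_le_of_comparable) auto
          then have "(1/2) powr \<bar>e - ?D\<bar> * ?d y powr (e - ?D) \<le> ?d x powr (e - ?D)"
            by (simp add: powr_divide divide_le_eq mult.commute)
          then have "\<kappa> powr - ?D * ((1/2) powr \<bar>e - ?D\<bar> * ?d y powr (e - ?D)) \<le> \<kappa> powr - ?D * ?d x powr (e - ?D)"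
            by (rule mult_left_mono) simp
          then have "c \<le> \<kappa> powr - ?D * ?d x powr (e - ?D)"
            unfolding c_def by (simp only: ac_simps)
          also have "\<dots> = ?d x powr e * (\<kappa> * ?d x) powr - ?D"
          proof -
            have "(\<kappa> * ?d x) powr - ?D = \<kappa> powr - ?D * ?d x powr - ?D"
              using dx dy \<kappa> by (intro powr_mult)
            moreover have "?d x powr (e - ?D) = ?d x powr e * ?d x powr - ?D"
              by (subst powr_add[symmetric]) simp
            ultimately show ?thesis by (simp only: ac_simps)
          qed
          finally show ?thesis .
        qed
        ultimately show ?thesis using x c by (simp add: J_def ennreal_leI)
      qed simp
      then have "(\<integral>\<^sup>+x. ennreal c * indicator (cball y \<rho>) x \<partial>lborel) \<le> (\<integral>\<^sup>+x. J x y \<partial>lborel)"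
        by (intro nn_integral_mono)
      also have "(\<integral>\<^sup>+x. ennreal c * indicator (cball y \<rho>) x \<partial>lborel) = ennreal (c * (unit_ball_vol ?D * \<rho> ^ DIM('a)))"
        using \<rho> c by (simp add: nn_integral_cmult emeasure_cball ennreal_mult)
      finally have le: "ennreal (c * (unit_ball_vol ?D * \<rho> ^ DIM('a))) \<le> (\<integral>\<^sup>+x. J x y \<partial>lborel)" .
      \<comment> \<open>The powers of \<open>\<kappa>\<close> from the normalisation of the averages
        and from the volume of \<open>cball y \<rho>\<close> cancel, so \<open>?C\<close> does not
        depend on \<open>\<kappa>\<close>.\<close>
      have "?d y powr e = ?C * (c * (unit_ball_vol ?D * \<rho> ^ DIM('a)))"
      proof -
        have \<rho>D: "\<rho> ^ DIM('a) = \<kappa> powr ?D * ?d y powr ?D / 2 ^ DIM('a)"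
          using \<kappa> dy by (simp add: \<rho>_def powr_realpow power_mult_distrib power_divide)
        have "?d y powr (e - ?D) * ?d y powr ?D = ?d y powr e"
          by (subst powr_add[symmetric]) simp
        moreover have "\<kappa> powr - ?D * \<kappa> powr ?D = 1" using \<kappa> by (subst powr_add[symmetric]) simp
        moreover have "(2::real) powr \<bar>e - ?D\<bar> * (1/2) powr \<bar>e - ?D\<bar> = 1"
          by (simp add: powr_divide)
        moreover have "unit_ball_vol ?D / unit_ball_vol ?D = 1" "(2::real) ^ DIM('a) / 2 ^ DIM('a) = 1"
          using less_imp_neq[OF unit_ball_vol_pos[of ?D]] by simp_all
        moreover have arith: "A * B / v * ((A' * k' * x') * (v * (k * x / B)))
            = (A * A') * (k' * k) * (x' * x) * (v / v) * (B / B)" for A A' B v k k' x x' :: real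
          by (cases "v = 0"; cases "B = 0") auto
        moreover have "?C * (c * (unit_ball_vol ?D * \<rho> ^ DIM('a))) =
          (2 powr \<bar>e - ?D\<bar> * (1/2) powr \<bar>e - ?D\<bar>) * (\<kappa> powr - ?D * \<kappa> powr ?D) *
          (?d y powr (e - ?D) * ?d y powr ?D) * (unit_ball_vol ?D / unit_ball_vol ?D) * (2 ^ DIM('a) / 2 ^ DIM('a))"
          unfolding c_def \<rho>D by (rule arith)
        ultimately show ?thesis by (simp only: mult_1_right mult_1)
      qed
      then have "ennreal (?d y powr e) = ennreal (?C * (c * (unit_ball_vol ?D * \<rho> ^ DIM('a))))"
        by (rule arg_cong)
      also have "\<dots> = ennreal ?C * ennreal (c * (unit_ball_vol ?D * \<rho> ^ DIM('a)))"
        by (rule ennreal_mult'[OF less_imp_le[OF C]])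
      also have "\<dots> \<le> ennreal ?C * (\<integral>\<^sup>+x. J x y \<partial>lborel)"
        using le by (intro mult_left_mono) auto
      finally have "ennreal (?d y powr e) * g y \<le> ennreal ?C * (\<integral>\<^sup>+x. J x y \<partial>lborel) * g y"
        by (rule mult_right_mono) simp
      then show ?thesis using True by (simp only: indicator_simps mult_1_right mult_1 ac_simps)
    qed simp
  qed
  also have "\<dots> = ennreal ?C * (\<integral>\<^sup>+y. g y * (\<integral>\<^sup>+x. J x y \<partial>lborel) \<partial>lborel)"
  proof (rule nn_integral_cmult)
    have [measurable]: "(\<lambda>(y, x). J x y) \<in> borel_measurable (borel \<Otimes>\<^sub>M borel)"
      using measurable_pair_swap[OF J_measurable] by simp
    show "(\<lambda>y. g y * (\<integral>\<^sup>+x. J x y \<partial>lborel)) \<in> borel_measurable lborel"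
      by measurable
  qed
  also note R[symmetric]
  finally show ?thesis .
qed

section \<open>Regular measures on the boundary\<close>

text \<open>Taking the centre of the small ball to be \<open>z\<close> itself and \<open>r \<le> R\<close> removes the localization to
  \<open>cball z R\<close>; the measure is extended by zero to all Borel sets of the space.\<close>

definition uniformly_ball_regular :: "'a::euclidean_space measure \<Rightarrow> 'a set \<Rightarrow> real \<Rightarrow> real \<Rightarrow> real \<Rightarrow> bool" where
  "uniformly_ball_regular M \<Gamma> C R s \<longleftrightarrow>
     sets M = sets borel \<and> emeasure M (- \<Gamma>) = 0 \<and> C > 1 \<and> R > 0 \<and> 0 < s \<and>
     (\<forall>z\<in>\<Gamma>. \<forall>r. 0 < r \<and> r \<le> R \<longrightarrow>
        ennreal (r powr s / C) \<le> emeasure M (cball z r) \<and> emeasure M (cball z r) \<le> ennreal (C * r powr s))"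

lemma Ahlfors_regular_imp_uniformly_ball_regular:
  fixes \<Gamma> :: "'a::euclidean_space set"
  assumes "locally_uniformly_Ahlfors_regular \<Gamma>" "closed \<Gamma>"
  obtains M C R s where "uniformly_ball_regular M \<Gamma> C R s" "s \<le> real DIM('a)"
proof -
  obtain \<mu> :: "'a measure" and C R s where \<mu>: "sets \<mu> = sets (restrict_space borel \<Gamma>)"
    and C: "C > 1" "R > 0" "0 < s" "s \<le> real DIM('a)"
    and reg: "\<And>z x r. z \<in> \<Gamma> \<Longrightarrow> x \<in> \<Gamma> \<inter> cball z R \<Longrightarrow> r \<in> {0<..2 * R} \<Longrightarrow>
           ennreal (r powr s / C) \<le> emeasure \<mu> (\<Gamma> \<inter> cball z R \<inter> cball x r) \<and>
           emeasure \<mu> (\<Gamma> \<inter> cball z R \<inter> cball x r) \<le> ennreal (C * r powr s)"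
    using assms(1) unfolding locally_uniformly_Ahlfors_regular_def by blast
  have space: "space \<mu> = \<Gamma>"
    using sets_eq_imp_space_eq[OF \<mu>] by (simp add: space_restrict_space)
  have meas: "(\<lambda>x. x) \<in> measurable \<mu> borel"
    by (subst measurable_cong_sets[OF \<mu> refl]) (rule measurable_restrict_space1, simp)
  define M where "M = distr \<mu> borel (\<lambda>x. x)"
  have M: "emeasure M A = emeasure \<mu> (A \<inter> \<Gamma>)" if "A \<in> sets borel" for A
    using emeasure_distr[OF meas that] by (simp add: M_def space)
  have "uniformly_ball_regular M \<Gamma> C R s"
    unfolding uniformly_ball_regular_def
  proof (intro conjI ballI allI impI)
    show "emeasure M (- \<Gamma>) = 0"
      using M[of "- \<Gamma>"] \<open>closed \<Gamma>\<close> by auto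
    fix z r assume z: "z \<in> \<Gamma>" and r: "0 < r \<and> r \<le> R"
    have "\<Gamma> \<inter> cball z R \<inter> cball z r = cball z r \<inter> \<Gamma>" using r by auto
    then show "ennreal (r powr s / C) \<le> emeasure M (cball z r)" "emeasure M (cball z r) \<le> ennreal (C * r powr s)"
      using reg[OF z, of z r] r C z by (auto simp: M)
  qed (use C in \<open>auto simp: M_def\<close>)
  then show ?thesis using C that by blast
qed

text \<open>An inequality known only at boundary points can be integrated, since
  \<open>- \<Gamma>\<close> is a null set. It is meant for a constant \<open>c\<close> that does not
  depend on \<open>w\<close>: the quantity to be estimated, with \<open>g w\<close> the bound
  obtained from a chain ending at \<open>w\<close>.\<close>

lemma nn_integral_ball_regular_ge:
  assumes reg: "uniformly_ball_regular M \<Gamma> C R s" and "closed \<Gamma>" "z \<in> \<Gamma>" "0 < r" "r \<le> R"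
    and le: "\<And>w. w \<in> \<Gamma> \<Longrightarrow> w \<in> cball z r \<Longrightarrow> c \<le> g w"
  shows "c * ennreal (r powr s / C) \<le> (\<integral>\<^sup>+w. g w \<partial>M)"
proof -
  have sM [measurable_cong]: "sets M = sets borel" using reg by (simp add: uniformly_ball_regular_def)
  have "c * ennreal (r powr s / C) \<le> c * emeasure M (cball z r)"
    using assms by (intro mult_left_mono) (auto simp: uniformly_ball_regular_def)
  also have "\<dots> = (\<integral>\<^sup>+w. c * indicator (cball z r) w \<partial>M)"
    by (simp add: nn_integral_cmult_indicator sM)
  also have "\<dots> \<le> (\<integral>\<^sup>+w. g w \<partial>M)"
  proof (rule nn_integral_mono_AE)
    have "AE w in M. w \<in> \<Gamma>"
      using reg \<open>closed \<Gamma>\<close> by (intro AE_I[of _ _ "- \<Gamma>"]) (auto simp: uniformly_ball_regular_def)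
    then show "AE w in M. c * indicator (cball z r) w \<le> g w"
      by eventually_elim (use le in \<open>auto simp: indicator_def\<close>)
  qed
  finally show ?thesis .
qed

text \<open>No packing argument is needed: on the set the measure of \<open>cball x (2 * \<rho>)\<close> is at least
  \<open>\<rho> powr s / C\<close>, and integrating it over the set in the other order gives the bound.\<close>

lemma emeasure_boundary_neighbourhood_le:
  fixes \<Gamma> :: "'a::euclidean_space set"
  assumes reg: "uniformly_ball_regular M \<Gamma> C R s" and cl: "closed \<Gamma>" and z: "z \<in> \<Gamma>"
    and \<rho>: "0 < \<rho>" "\<rho> \<le> T" "4 * T \<le> R"
  shows "emeasure lborel {x. dist z x \<le> 2 * T \<and> infdist x \<Gamma> \<le> \<rho>}
    \<le> ennreal (unit_ball_vol (real DIM('a)) * 2 ^ DIM('a) * 4 powr s * C\<^sup>2 * \<rho> powr (real DIM('a) - s) * T powr s)"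
proof -
  have sM [measurable_cong]: "sets M = sets borel" and C: "C > 1"
    and lower: "\<And>z r. z \<in> \<Gamma> \<Longrightarrow> 0 < r \<Longrightarrow> r \<le> R \<Longrightarrow> ennreal (r powr s / C) \<le> emeasure M (cball z r)"
    and upper: "\<And>z r. z \<in> \<Gamma> \<Longrightarrow> 0 < r \<Longrightarrow> r \<le> R \<Longrightarrow> emeasure M (cball z r) \<le> ennreal (C * r powr s)"
    using reg by (auto simp: uniformly_ball_regular_def)
  let ?d = "\<lambda>x. infdist x \<Gamma>" and ?D = "real DIM('a)" and ?v = "unit_ball_vol (real DIM('a))"
  define B where "B = cball z (4 * T)"
  \<comment> \<open>Restricting \<open>M\<close> to \<open>B\<close> gives a finite measure, as
    Tonelli requires sigma-finiteness. The radius \<open>4 * T\<close> of \<open>B\<close> is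
    \<open>2 * T\<close> from \<open>z\<close> to a point of the set plus \<open>2 * \<rho>\<close>
    from there to the boundary points counted.\<close>
  define N where "N = density M (indicator B)"
  have [measurable]: "B \<in> sets borel" by (simp add: B_def)
  have B: "emeasure M B \<le> ennreal (C * (4 * T) powr s)"
    unfolding B_def using \<rho> z by (intro upper) auto
  have sN [measurable_cong]: "sets N = sets borel" by (simp add: N_def sM)
  have N: "emeasure N A = emeasure M (A \<inter> B)" if "A \<in> sets borel" for A
    using that sM unfolding N_def by (subst emeasure_density) (auto simp: indicator_inter_arith[symmetric] Int_commute)
  have NU: "emeasure N (space N) \<le> ennreal (C * (4 * T) powr s)"
    using sets_eq_imp_space_eq[OF sN] N[of UNIV] B by simp
  interpret N: finite_measure N
    using NU by (intro finite_measureI) (auto simp: top_unique)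
  interpret NL: pair_sigma_finite N lborel ..
  define E where "E = {x. dist z x \<le> 2 * T \<and> ?d x \<le> \<rho>}"
  have [measurable]: "E \<in> sets borel"
    unfolding E_def by (intro borel_closed closed_Collect_conj closed_Collect_le continuous_intros)
  have [measurable]: "{p::'a\<times>'a. dist (fst p) (snd p) \<le> 2 * \<rho>} \<in> sets (borel \<Otimes>\<^sub>M borel)"
    unfolding borel_prod by (intro borel_closed closed_Collect_le continuous_intros)
  let ?I = "\<lambda>w x. indicator {p::'a\<times>'a. dist (fst p) (snd p) \<le> 2 * \<rho>} (w, x) :: ennreal"
  have "ennreal (\<rho> powr s / C) * emeasure lborel E = (\<integral>\<^sup>+x. ennreal (\<rho> powr s / C) * indicator E x \<partial>lborel)"
    by (simp add: nn_integral_cmult)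
  also have "\<dots> \<le> (\<integral>\<^sup>+x. (\<integral>\<^sup>+w. ?I w x * indicator E x \<partial>N) \<partial>lborel)"
  proof (intro nn_integral_mono, goal_cases)
    case (1 x)
    show ?case
    proof (cases "x \<in> E")
      case True
      obtain y where y: "y \<in> \<Gamma>" "?d x = dist x y"
        using infdist_attains_inf[OF cl, of x] z by auto
      have "cball y \<rho> \<subseteq> cball x (2 * \<rho>) \<inter> B"
      proof
        fix w assume "w \<in> cball y \<rho>"
        then show "w \<in> cball x (2 * \<rho>) \<inter> B"
          using True y \<rho> dist_triangle[of x w y] dist_triangle[of z w x]
          by (auto simp: E_def B_def)
      qed
      then have "emeasure M (cball y \<rho>) \<le> emeasure N (cball x (2 * \<rho>))"
        by (simp add: N) (intro emeasure_mono, auto simp: sM)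
      moreover have "ennreal (\<rho> powr s / C) \<le> emeasure M (cball y \<rho>)"
        using \<rho> y by (intro lower) auto
      moreover have "(\<integral>\<^sup>+w. ?I w x * indicator E x \<partial>N) = (\<integral>\<^sup>+w. indicator (cball x (2 * \<rho>)) w \<partial>N)"
        using True by (intro nn_integral_cong) (auto simp: indicator_def dist_commute)
      ultimately show ?thesis using True by (simp add: sN)
    qed simp
  qed
  also have "\<dots> = (\<integral>\<^sup>+w. (\<integral>\<^sup>+x. ?I w x * indicator E x \<partial>lborel) \<partial>N)"
    by (rule NL.Fubini') measurable
  also have "\<dots> \<le> (\<integral>\<^sup>+w. ennreal (?v * (2 * \<rho>) ^ DIM('a)) \<partial>N)"
  proof (intro nn_integral_mono, goal_cases)
    case (1 w)
    have "(\<integral>\<^sup>+x. ?I w x * indicator E x \<partial>lborel) \<le> (\<integral>\<^sup>+x. indicator (cball w (2 * \<rho>)) x \<partial>lborel)"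
      by (intro nn_integral_mono) (auto simp: indicator_def)
    then show ?case using \<rho> by (simp add: emeasure_cball)
  qed
  also have "\<dots> = ennreal (?v * (2 * \<rho>) ^ DIM('a)) * emeasure N (space N)" by simp
  also have "\<dots> \<le> ennreal (?v * (2 * \<rho>) ^ DIM('a)) * ennreal (C * (4 * T) powr s)"
    using NU by (intro mult_left_mono) auto
  finally have "ennreal (C / \<rho> powr s) * (ennreal (\<rho> powr s / C) * emeasure lborel E)
      \<le> ennreal (C / \<rho> powr s) * (ennreal (?v * (2 * \<rho>) ^ DIM('a)) * ennreal (C * (4 * T) powr s))"
    by (intro mult_left_mono) auto
  also have "ennreal (C / \<rho> powr s) * (ennreal (\<rho> powr s / C) * emeasure lborel E) = emeasure lborel E"
    using C \<rho> by (simp flip: mult.assoc ennreal_mult)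
  also have "ennreal (C / \<rho> powr s) * (ennreal (?v * (2 * \<rho>) ^ DIM('a)) * ennreal (C * (4 * T) powr s))
      = ennreal (C / \<rho> powr s * (?v * (2 * \<rho>) ^ DIM('a) * (C * (4 * T) powr s)))"
    using C \<rho> by (simp flip: ennreal_mult)
  also have "C / \<rho> powr s * (?v * (2 * \<rho>) ^ DIM('a) * (C * (4 * T) powr s))
      = ?v * 2 ^ DIM('a) * 4 powr s * C\<^sup>2 * \<rho> powr (?D - s) * T powr s"
  proof -
    have "(4 * T) powr s = 4 powr s * T powr s" using \<rho> by (simp add: powr_mult)
    moreover have "\<rho> powr (?D - s) = \<rho> ^ DIM('a) / \<rho> powr s" using \<rho> by (simp add: powr_diff powr_realpow)
    ultimately show ?thesis by (simp add: power_mult_distrib power2_eq_square)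
  qed
  finally show ?thesis unfolding E_def .
qed

section \<open>The Hausdorff dimension of the boundary\<close>

lemma hausdorff_measure_eq_0I:
  assumes "\<And>\<epsilon> \<eta>. 0 < \<epsilon> \<Longrightarrow> 0 < \<eta> \<Longrightarrow>
    \<exists>U::nat \<Rightarrow> 'a::metric_space set. A \<subseteq> (\<Union>i. U i) \<and> (\<forall>i. bounded (U i) \<and> diameter (U i) \<le> \<epsilon>) \<and>
      (\<Sum>i. hausdorff_gauge t (U i)) \<le> ennreal \<eta>"
  shows "hausdorff_measure t A = 0"
proof -
  have "hausdorff_premeasure \<epsilon> t A \<le> 0" if "0 < \<epsilon>" for \<epsilon>
  proof (rule ennreal_le_epsilon)
    fix \<eta> :: real assume "0 < \<eta>"
    from assms[OF that this] obtain U where U: "A \<subseteq> (\<Union>i. U i)" "\<forall>i. bounded (U i) \<and> diameter (U i) \<le> \<epsilon>"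
      "(\<Sum>i. hausdorff_gauge t (U i)) \<le> ennreal \<eta>" by blast
    have "hausdorff_premeasure \<epsilon> t A \<le> (\<Sum>i. hausdorff_gauge t (U i))"
      unfolding hausdorff_premeasure_def using U by (intro INF_lower) auto
    then show "hausdorff_premeasure \<epsilon> t A \<le> 0 + ennreal \<eta>" using U by simp
  qed
  then have "hausdorff_measure t A \<le> 0"
    unfolding hausdorff_measure_def by (intro SUP_least) auto
  then show ?thesis by simp
qed

lemma hausdorff_measure_eq_0E:
  assumes "hausdorff_measure t A = 0" "0 < \<epsilon>" "0 < \<eta>"
  obtains U :: "nat \<Rightarrow> 'a::metric_space set" where "A \<subseteq> (\<Union>i. U i)" "\<And>i. bounded (U i)" "\<And>i. diameter (U i) \<le> \<epsilon>"
      "(\<Sum>i. hausdorff_gauge t (U i)) < ennreal \<eta>"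
proof -
  have "hausdorff_premeasure \<epsilon> t A \<le> hausdorff_measure t A"
    unfolding hausdorff_measure_def using assms by (intro SUP_upper) auto
  then have "hausdorff_premeasure \<epsilon> t A < ennreal \<eta>" using assms by simp
  then show ?thesis
    unfolding hausdorff_premeasure_def INF_less_iff using that by blast
qed

lemma uniformly_ball_regularD:
  assumes "uniformly_ball_regular M \<Gamma> C R s"
  shows "sets M = sets borel" "emeasure M (- \<Gamma>) = 0" "C > 1" "R > 0" "0 < s"
    "\<And>z r. z \<in> \<Gamma> \<Longrightarrow> 0 < r \<Longrightarrow> r \<le> R \<Longrightarrow> ennreal (r powr s / C) \<le> emeasure M (cball z r)"
    "\<And>z r. z \<in> \<Gamma> \<Longrightarrow> 0 < r \<Longrightarrow> r \<le> R \<Longrightarrow> emeasure M (cball z r) \<le> ennreal (C * r powr s)"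
proof -
  note d = assms[unfolded uniformly_ball_regular_def]
  from d show "sets M = sets borel" "emeasure M (- \<Gamma>) = 0" "C > 1" "R > 0" "0 < s"
    by simp_all
  fix z r assume "z \<in> \<Gamma>" "0 < r" "r \<le> R"
  with d show "ennreal (r powr s / C) \<le> emeasure M (cball z r)" "emeasure M (cball z r) \<le> ennreal (C * r powr s)"
    by simp_all
qed

text \<open>Regularity bounds only balls of radius at most \<open>R\<close> about boundary points.
  By compactness finitely many of them cover the bounded part of \<open>\<Gamma>\<close>, and off
  \<open>\<Gamma>\<close> there is no mass.\<close>

lemma uniformly_ball_regular_bounded_finite:
  fixes \<Gamma> :: "'a::euclidean_space set"
  assumes reg: "uniformly_ball_regular M \<Gamma> C R s" and cl: "closed \<Gamma>"
  shows "emeasure M (cball a T) < \<infinity>"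
proof -
  note r = uniformly_ball_regularD[OF reg]
  have "compact (\<Gamma> \<inter> cball a T)" using cl by (simp add: closed_Int_compact)
  moreover have "\<Gamma> \<inter> cball a T \<subseteq> (\<Union>z\<in>\<Gamma>. ball z R)" using r(4) by force
  ultimately obtain Z where Z: "Z \<subseteq> \<Gamma>" "finite Z" "\<Gamma> \<inter> cball a T \<subseteq> (\<Union>z\<in>Z. ball z R)"
    by (rule compactE_image[where f="\<lambda>z. ball z R", OF _ open_ball])
  have "emeasure M (cball a T) \<le> emeasure M (- \<Gamma> \<union> (\<Union>z\<in>Z. cball z R))"
    using Z cl by (intro emeasure_mono) (force simp: r(1))+
  also have "\<dots> \<le> emeasure M (- \<Gamma>) + emeasure M (\<Union>z\<in>Z. cball z R)"
    using Z cl by (intro emeasure_subadditive) (auto simp: r(1))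
  also have "emeasure M (\<Union>z\<in>Z. cball z R) \<le> (\<Sum>z\<in>Z. emeasure M (cball z R))"
    using Z by (intro emeasure_subadditive_finite) (auto simp: r(1))
  also have "\<dots> \<le> (\<Sum>z\<in>Z. ennreal (C * R powr s))"
    using Z r(4) by (intro sum_mono r(7)) auto
  finally have "emeasure M (cball a T) \<le> emeasure M (- \<Gamma>) + (\<Sum>z\<in>Z. ennreal (C * R powr s))"
    by (simp add: add_left_mono)
  also have "\<dots> < \<infinity>" by (simp add: r(2) ennreal_mult_less_top of_nat_less_top)
  finally show ?thesis .
qed

text \<open>The Vitali radii \<open>rr z\<close> decay with the weights \<open>c n\<close>, which are summable against the measure of
  the balls about the origin, so an unbounded set is covered in one step.\<close>

lemma hausdorff_measure_eq_0_if_uniformly_ball_regular: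
  fixes \<Gamma> :: "'a::euclidean_space set"
  assumes reg: "uniformly_ball_regular M \<Gamma> C R s" and cl: "closed \<Gamma>" and "s < t"
  shows "hausdorff_measure t \<Gamma> = 0"
proof (rule hausdorff_measure_eq_0I)
  note r = uniformly_ball_regularD[OF reg]
  note [measurable_cong] = r(1)
  fix \<epsilon> \<eta> :: real assume \<epsilon>: "0 < \<epsilon>" and \<eta>: "0 < \<eta>"
  have t: "t > 0" using r(5) \<open>s < t\<close> by simp
  \<comment> \<open>In the final sum \<open>10 powr t\<close> comes from the diameter of the
    fivefold balls, \<open>C\<close> from the lower regularity bound, and 2 from the integral of the
    weight \<open>G\<close>.\<close>
  define \<eta>' where "\<eta>' = \<eta> / (2 * 10 powr t * C)"
  have \<eta>': "\<eta>' > 0" using \<eta> r(3) by (simp add: \<eta>'_def)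
  define m where "m n = enn2real (emeasure M (cball 0 (real n + 2)))" for n
  have m: "emeasure M (cball 0 (real n + 2)) = ennreal (m n)" for n
    using uniformly_ball_regular_bounded_finite[OF reg cl] by (simp add: m_def less_top)
  have m0: "m n \<ge> 0" for n by (simp add: m_def)
  \<comment> \<open>Chosen so that \<open>c n * m n\<close> is at most \<open>(1/2) ^ n\<close>;
    adding 1 keeps the denominator positive when \<open>m n\<close> is 0.\<close>
  define c where "c n = (1/2) ^ n / (1 + m n)" for n
  have c: "c n > 0" for n using m0[of n] by (simp add: c_def add_pos_nonneg)
  define nn where "nn z = nat \<lfloor>norm z\<rfloor>" for z :: 'a
  have nn: "norm z \<le> real (nn z) + 1" for z by (simp add: nn_def)
  \<comment> \<open>The four bounds have separate tasks: the ball about \<open>z\<close> stays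
    inside \<open>cball 0 (real (nn z) + 2)\<close>, regularity applies to it, its fivefold
    enlargement has diameter at most \<open>\<epsilon>\<close>, and the surplus exponent
    \<open>t - s\<close> produces the factor \<open>\<eta>' * c (nn z)\<close>.\<close>
  define rr where "rr z = Min {1, R, \<epsilon> / 10, (\<eta>' * c (nn z)) powr (1 / (t - s))}" for z
  have rr: "0 < rr z" "rr z \<le> 1" "rr z \<le> R" "10 * rr z \<le> \<epsilon>" "rr z \<le> (\<eta>' * c (nn z)) powr (1 / (t - s))" for z
    using \<epsilon> r(4) \<eta>' c[of "nn z"] by (auto simp: rr_def)
  have rr': "rr z powr (t - s) \<le> \<eta>' * c (nn z)" for z
  proof -
    have "rr z powr (t - s) \<le> ((\<eta>' * c (nn z)) powr (1 / (t - s))) powr (t - s)"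
      using rr[of z] \<open>s < t\<close> by (intro powr_mono2) auto
    also have "\<dots> = \<eta>' * c (nn z)"
      using \<eta>' c[of "nn z"] \<open>s < t\<close> by (simp add: powr_powr)
    finally show ?thesis .
  qed
  obtain Z where Z: "countable Z" "Z \<subseteq> \<Gamma>"
     "pairwise (\<lambda>i j. disjnt (cball i (rr i)) (cball j (rr j))) Z"
     "\<Gamma> \<subseteq> (\<Union>i\<in>Z. cball i (5 * rr i))"
  proof (rule Vitali_covering_lemma_cballs[where S=\<Gamma> and K=\<Gamma> and a="\<lambda>z. z" and r=rr and B=1])
    show "\<Gamma> \<subseteq> (\<Union>i\<in>\<Gamma>. cball i (rr i))" using rr(1) by (force intro: less_imp_le)
  qed (use rr in auto)
  define e where "e = to_nat_on Z"
  have e: "inj_on e Z" unfolding e_def using Z(1) by (rule inj_on_to_nat_on)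
  define z where "z i = inv_into Z e i" for i
  have z: "z i \<in> Z" "e (z i) = i" if "i \<in> e ` Z" for i
    unfolding z_def using that by (rule inv_into_into, rule f_inv_into_f)
  \<comment> \<open>The countable set \<open>Z\<close> may be finite: indices not hit by
    \<open>e\<close> receive the empty set, whose gauge and measure are 0.\<close>
  define U where "U i = (if i \<in> e ` Z then cball (z i) (5 * rr (z i)) else {})" for i
  define B where "B i = (if i \<in> e ` Z then cball (z i) (rr (z i)) else {})" for i
  have B_sets: "B i \<in> sets M" for i by (auto simp: B_def r(1))
  have disj: "disjoint_family B"
  proof -
    have "B i \<inter> B j = {}" if "i \<noteq> j" for i j
    proof (cases "i \<in> e ` Z \<and> j \<in> e ` Z")
      case True
      then have "z i \<noteq> z j" using z that by metis
      then show ?thesis using True Z(3) z by (simp add: pairwise_def disjnt_def B_def)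
    qed (auto simp: B_def)
    then show ?thesis by (simp add: disjoint_family_on_def)
  qed
  \<comment> \<open>One function with finite integral that on every selected ball dominates the
    weight of its centre. As the balls are disjoint, the weighted sum of their measures is at most
    the integral of \<open>G\<close>.\<close>
  define G where "G y = (\<Sum>n. ennreal (c n) * indicator (cball 0 (real n + 2)) y)" for y :: 'a
  have [measurable]: "G \<in> borel_measurable M"
    unfolding G_def by measurable
  have GB: "ennreal (c (nn (z i))) * emeasure M (B i) \<le> emeasure (density M G) (B i)" for i
  proof (cases "i \<in> e ` Z")
    case True
    have "ennreal (c (nn (z i))) * emeasure M (B i) = (\<integral>\<^sup>+y. ennreal (c (nn (z i))) * indicator (B i) y \<partial>M)"
      using B_sets by (simp add: nn_integral_cmult_indicator)
    also have "\<dots> \<le> (\<integral>\<^sup>+y. G y * indicator (B i) y \<partial>M)"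
    proof (intro nn_integral_mono, goal_cases)
      case (1 y)
      show ?case
      proof (cases "y \<in> B i")
        case y: True
        have "norm y \<le> real (nn (z i)) + 2"
          using y True nn[of "z i"] rr(2)[of "z i"] norm_triangle_sub[of y "z i"]
          by (auto simp: B_def dist_norm norm_minus_commute)
        then have "ennreal (c (nn (z i))) = ennreal (c (nn (z i))) * indicator (cball 0 (real (nn (z i)) + 2)) y"
          by simp
        also have "\<dots> \<le> G y"
        proof -
          let ?h = "\<lambda>n. ennreal (c n) * indicator (cball 0 (real n + 2)) y"
          have "sum ?h {nn (z i)} \<le> suminf ?h" by (rule sum_le_suminf) auto
          then show ?thesis unfolding G_def by (simp only: sum.insert finite.emptyI empty_iff not_False_eq_True sum.empty add_0_right)
        qed
        finally show ?thesis using y by simp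
      qed simp
    qed
    also have "\<dots> = emeasure (density M G) (B i)"
      using B_sets by (simp add: emeasure_density)
    finally show ?thesis .
  qed (simp add: B_def)
  have gauge: "hausdorff_gauge t (U i) \<le> ennreal (10 powr t * C * \<eta>') * (ennreal (c (nn (z i))) * emeasure M (B i))" for i
  proof (cases "i \<in> e ` Z")
    case True
    have zG: "z i \<in> \<Gamma>" using Z z True by auto
    let ?r = "rr (z i)"
    have "hausdorff_gauge t (U i) = ennreal ((10 * ?r) powr t)"
      using t rr(1)[of "z i"] True by (auto simp: hausdorff_gauge_def U_def)
    also have "(10 * ?r) powr t = 10 powr t * (?r powr (t - s) * ?r powr s)"
      using rr(1)[of "z i"] by (simp add: powr_mult flip: powr_add)
    also have "\<dots> \<le> 10 powr t * ((\<eta>' * c (nn (z i))) * ?r powr s)"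
      using rr'[of "z i"] by (intro mult_left_mono mult_right_mono) auto
    also have "\<dots> = 10 powr t * C * \<eta>' * (c (nn (z i)) * (?r powr s / C))"
      using r(3) by simp
    also have "ennreal \<dots> = ennreal (10 powr t * C * \<eta>') * (ennreal (c (nn (z i))) * ennreal (?r powr s / C))"
      using r(3) \<eta>' c[of "nn (z i)"] by (simp only: ennreal_mult' mult_nonneg_nonneg powr_ge_zero less_imp_le)
    also have "\<dots> \<le> ennreal (10 powr t * C * \<eta>') * (ennreal (c (nn (z i))) * emeasure M (B i))"
      using r(6)[OF zG rr(1,3)] True by (intro mult_left_mono) (auto simp: B_def)
    finally show ?thesis by (simp add: ennreal_leI)
  qed (simp add: U_def hausdorff_gauge_def)
  have "(\<Sum>i. hausdorff_gauge t (U i)) \<le> (\<Sum>i. ennreal (10 powr t * C * \<eta>') * emeasure (density M G) (B i))"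
    using order_trans[OF gauge mult_left_mono[OF GB]] by (intro suminf_le) auto
  also have "\<dots> = ennreal (10 powr t * C * \<eta>') * emeasure (density M G) (\<Union>i. B i)"
    using disj B_sets by (simp add: suminf_emeasure image_subset_iff)
  also have "\<dots> \<le> ennreal (10 powr t * C * \<eta>') * 2"
  proof (intro mult_left_mono)
    have "emeasure (density M G) (\<Union>i. B i) \<le> emeasure (density M G) (space M)"
      using emeasure_space[of "density M G"] by simp
    also have "\<dots> = (\<integral>\<^sup>+y. G y \<partial>M)"
      by (subst emeasure_density) (auto intro!: nn_integral_cong)
    also have "\<dots> = (\<Sum>n. ennreal (c n) * emeasure M (cball 0 (real n + 2)))"
      unfolding G_def by (subst nn_integral_suminf) (auto simp: nn_integral_cmult_indicator r(1))
    also have "\<dots> \<le> (\<Sum>n. ennreal ((1/2) ^ n))"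
    proof (intro suminf_le)
      fix n
      have "c n * m n \<le> (1/2) ^ n"
      proof -
        have "c n * m n = (1/2) ^ n * (m n / (1 + m n))" by (simp add: c_def)
        also have "\<dots> \<le> (1/2) ^ n * 1" using m0[of n] by (intro mult_left_mono) auto
        finally show ?thesis by simp
      qed
      then show "ennreal (c n) * emeasure M (cball 0 (real n + 2)) \<le> ennreal ((1/2) ^ n)"
        unfolding m using c[of n] m0[of n] by (simp flip: ennreal_mult)
    qed auto
    also have "\<dots> = ennreal 2"
      using geometric_sums[of "1/2::real"] by (intro suminf_ennreal_eq) auto
    finally show "emeasure (density M G) (\<Union>i. B i) \<le> 2" by simp
  qed simp
  also have "\<dots> = ennreal (10 powr t * C * \<eta>' * 2)"
    using r(3) \<eta>' by (subst ennreal_mult) auto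
  also have "10 powr t * C * \<eta>' * 2 = \<eta>"
    using r(3) by (simp add: \<eta>'_def)
  finally have "(\<Sum>i. hausdorff_gauge t (U i)) \<le> ennreal \<eta>" .
  moreover have "\<Gamma> \<subseteq> (\<Union>i. U i)"
  proof
    fix y assume "y \<in> \<Gamma>"
    then obtain w where w: "w \<in> Z" "y \<in> cball w (5 * rr w)" using Z(4) by auto
    then have "z (e w) = w" using e by (simp add: z_def)
    then have "y \<in> U (e w)" using w by (simp add: U_def)
    then show "y \<in> (\<Union>i. U i)" by blast
  qed
  moreover have "bounded (U i) \<and> diameter (U i) \<le> \<epsilon>" for i
    using rr(1,4)[of "z i"] \<epsilon> by (auto simp: U_def)
  ultimately show "\<exists>U::nat \<Rightarrow> 'a set. \<Gamma> \<subseteq> (\<Union>i. U i) \<and> (\<forall>i. bounded (U i) \<and> diameter (U i) \<le> \<epsilon>) \<and>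
      (\<Sum>i. hausdorff_gauge t (U i)) \<le> ennreal \<eta>" by blast
qed

text \<open>A covering may contain sets of diameter 0, while regularity speaks of positive radii
  only; letting the radius shrink closes this gap because \<open>s\<close> is positive.\<close>

lemma uniformly_ball_regular_singleton:
  assumes reg: "uniformly_ball_regular M \<Gamma> C R s" and z: "z \<in> \<Gamma>"
  shows "emeasure M (cball z 0) = 0"
proof -
  note r = uniformly_ball_regularD[OF reg]
  have "emeasure M (cball z 0) \<le> 0"
  proof (rule ennreal_le_epsilon)
    fix e :: real assume e: "0 < e"
    define \<rho> where "\<rho> = min R ((e / C) powr (1 / s))"
    have \<rho>: "0 < \<rho>" "\<rho> \<le> R" using e r by (auto simp: \<rho>_def)
    have "\<rho> powr s \<le> ((e / C) powr (1 / s)) powr s"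
      using \<rho> r(5) by (intro powr_mono2) (auto simp: \<rho>_def)
    also have "\<dots> = e / C" using e r by (simp add: powr_powr)
    finally have "C * \<rho> powr s \<le> e" using r(3) by (simp add: field_simps)
    then have le: "ennreal (C * \<rho> powr s) \<le> ennreal e" by (rule ennreal_leI)
    have "emeasure M (cball z 0) \<le> emeasure M (cball z \<rho>)"
      using \<rho> by (intro emeasure_mono) (auto simp: r(1))
    also note r(7)[OF z \<rho>]
    also note le
    finally show "emeasure M (cball z 0) \<le> 0 + ennreal e" by simp
  qed
  then show ?thesis by simp
qed

text \<open>The mass distribution principle: a covering set that meets \<open>\<Gamma>\<close> lies,
  as far as \<open>\<Gamma>\<close> is concerned, in a ball about a boundary point with radius its
  diameter. Its mass is thus bounded by its gauge, and coverings with too small a gauge sum cannot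
  carry the mass of one fixed ball.\<close>

lemma hausdorff_measure_neq_0_if_uniformly_ball_regular:
  fixes \<Gamma> :: "'a::euclidean_space set"
  assumes reg: "uniformly_ball_regular M \<Gamma> C R s" and cl: "closed \<Gamma>" and "\<Gamma> \<noteq> {}" and t: "0 \<le> t" "t < s"
  shows "hausdorff_measure t \<Gamma> \<noteq> 0"
proof
  note r = uniformly_ball_regularD[OF reg]
  assume H: "hausdorff_measure t \<Gamma> = 0"
  \<comment> \<open>Diameters at most 1 let the exponent drop from \<open>s\<close> to
    \<open>t\<close>; diameters at most \<open>R\<close> make regularity applicable.\<close>
  define \<epsilon> where "\<epsilon> = min 1 R"
  \<comment> \<open>\<open>C * \<eta>\<close> is half of the least possible mass of a ball of radius
    \<open>R\<close>, which yields the contradiction.\<close>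
  define \<eta> where "\<eta> = R powr s / C / (2 * C)"
  have "\<epsilon> > 0" "\<eta> > 0" using r(3,4) by (auto simp: \<epsilon>_def \<eta>_def)
  then obtain U where U: "\<Gamma> \<subseteq> (\<Union>i. U i)" "\<And>i::nat. bounded (U i)" "\<And>i. diameter (U i) \<le> \<epsilon>"
      "(\<Sum>i. hausdorff_gauge t (U i)) < ennreal \<eta>"
    using hausdorff_measure_eq_0E[OF H] by metis
  define z where "z i = (SOME w. w \<in> U i \<inter> \<Gamma>)" for i
  have z: "z i \<in> U i" "z i \<in> \<Gamma>" if "U i \<inter> \<Gamma> \<noteq> {}" for i
    using someI_ex[of "\<lambda>w. w \<in> U i \<inter> \<Gamma>"] that by (auto simp: z_def)
  define B where "B i = (if U i \<inter> \<Gamma> = {} then {} else cball (z i) (diameter (U i)))" for i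
  have B_sets: "B i \<in> sets M" for i by (auto simp: B_def r(1))
  have UB: "U i \<inter> \<Gamma> \<subseteq> B i" for i
  proof
    fix y assume y: "y \<in> U i \<inter> \<Gamma>"
    then have "U i \<inter> \<Gamma> \<noteq> {}" by auto
    then show "y \<in> B i"
      using y z(1)[of i] diameter_bounded_bound[OF U(2), of "z i" i y] by (simp add: B_def)
  qed
  have MB: "emeasure M (B i) \<le> ennreal C * hausdorff_gauge t (U i)" for i
  proof (cases "U i \<inter> \<Gamma> = {}")
    case False
    let ?D = "diameter (U i)"
    have D: "0 \<le> ?D" "?D \<le> 1" "?D \<le> R"
      using U(3)[of i] diameter_ge_0[OF U(2)] by (auto simp: \<epsilon>_def)
    have "emeasure M (B i) \<le> ennreal (C * ?D powr s)"
    proof (cases "?D = 0")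
      case True
      then show ?thesis using False uniformly_ball_regular_singleton[OF reg z(2)] by (simp add: B_def)
    next
      case D0: False
      then show ?thesis using D False r(7)[OF z(2), of i ?D] by (simp add: B_def)
    qed
    also have "ennreal (C * ?D powr s) = ennreal C * ennreal (?D powr s)"
      using r(3) by (simp add: ennreal_mult)
    also have "ennreal (?D powr s) \<le> hausdorff_gauge t (U i)"
    proof (cases "t = 0")
      case True
      have "?D powr s \<le> 1" using D r(5) by (simp add: powr_le1)
      then show ?thesis using True False by (auto simp: hausdorff_gauge_def)
    next
      case t0: False
      have "?D powr s \<le> ?D powr t"
        using D t t0 by (intro powr_mono') auto
      then show ?thesis using t0 False by (auto simp: hausdorff_gauge_def ennreal_leI)
    qed
    finally show ?thesis by (simp add: mult_left_mono)
  qed (simp add: B_def)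
  obtain w where w: "w \<in> \<Gamma>" using \<open>\<Gamma> \<noteq> {}\<close> by auto
  have "ennreal (R powr s / C) \<le> emeasure M (cball w R)"
    using w r(4) by (intro r(6)) auto
  also have "\<dots> \<le> emeasure M (- \<Gamma> \<union> (\<Union>i. B i))"
  proof (rule emeasure_mono)
    have "\<Gamma> \<subseteq> (\<Union>i. B i)" using U(1) UB by blast
    then show "cball w R \<subseteq> - \<Gamma> \<union> (\<Union>i. B i)" by blast
    have "- \<Gamma> \<in> sets M" using cl by (auto simp: r(1))
    then show "- \<Gamma> \<union> (\<Union>i. B i) \<in> sets M" using B_sets by (intro sets.Un sets.countable_UN) auto
  qed
  also have "\<dots> \<le> emeasure M (- \<Gamma>) + emeasure M (\<Union>i. B i)"
    using B_sets cl by (intro emeasure_subadditive) (auto simp: r(1))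
  also have "\<dots> = emeasure M (\<Union>i. B i)" by (simp add: r(2))
  also have "\<dots> \<le> (\<Sum>i. emeasure M (B i))"
    using B_sets by (intro emeasure_subadditive_countably) auto
  also have "\<dots> \<le> (\<Sum>i. ennreal C * hausdorff_gauge t (U i))"
    using MB by (intro suminf_le) auto
  also have "\<dots> = ennreal C * (\<Sum>i. hausdorff_gauge t (U i))" by simp
  also have "\<dots> \<le> ennreal C * ennreal \<eta>"
    using U(4) by (intro mult_left_mono) auto
  also have "\<dots> = ennreal (R powr s / C / 2)"
    using r(3) by (simp add: \<eta>_def flip: ennreal_mult)
  finally have "R powr s / C \<le> R powr s / C / 2"
    using r(3) by (subst (asm) ennreal_le_iff) auto
  moreover have "R powr s / C > 0" using r by simp
  ultimately show False by simp
qed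

lemma hausdorff_dim_eq_if_uniformly_ball_regular:
  fixes \<Gamma> :: "'a::euclidean_space set"
  assumes reg: "uniformly_ball_regular M \<Gamma> C R s" and cl: "closed \<Gamma>" and "\<Gamma> \<noteq> {}"
  shows "hausdorff_dim \<Gamma> = s"
proof -
  let ?S = "{t. 0 \<le> t \<and> hausdorff_measure t \<Gamma> = 0}"
  have s: "s > 0" using uniformly_ball_regularD[OF reg] by simp
  have mem: "t \<in> ?S" if "s < t" for t
    using that s hausdorff_measure_eq_0_if_uniformly_ball_regular[OF reg cl] by auto
  have bdd: "bdd_below ?S" by (rule bdd_belowI[of _ 0]) auto
  show ?thesis
  proof (rule antisym)
    show "hausdorff_dim \<Gamma> \<le> s"
      unfolding hausdorff_dim_def by (rule dense_ge, rule cInf_lower[OF mem bdd])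
    show "s \<le> hausdorff_dim \<Gamma>"
      unfolding hausdorff_dim_def
    proof (rule cInf_greatest)
      show "?S \<noteq> {}" using mem[of "s + 1"] by auto
      fix t assume "t \<in> ?S"
      then show "s \<le> t"
        using hausdorff_measure_neq_0_if_uniformly_ball_regular[OF reg cl \<open>\<Gamma> \<noteq> {}\<close>, of t] by force
    qed
  qed
qed

section \<open>Chains of balls along the curves of a uniform domain\<close>

text \<open>A partition of the parameters up to \<open>a\<close>, with \<open>b\<close> appended, is
  a partition up to \<open>b\<close>. Hence the chord adds to the length up to \<open>a\<close> at
  most the difference of the two arc lengths.\<close>

lemma arc_length_curve_dist_le:
  assumes \<gamma>: "arc_length_curve \<gamma> l" and ab: "0 \<le> a" "a \<le> b" "b \<le> l"
  shows "dist (\<gamma> a) (\<gamma> b) \<le> b - a"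
proof -
  have La: "curve_length \<gamma> 0 a = ennreal a" and Lb: "curve_length \<gamma> 0 b = ennreal b"
    using \<gamma> ab by (auto simp: arc_length_curve_def)
  have part: "(\<Sum>i<n. dist (\<gamma> (t i)) (\<gamma> (t (Suc i)))) + dist (\<gamma> a) (\<gamma> b) \<le> b"
    if t: "mono t" "t 0 = 0" "t n = a" for n and t :: "nat \<Rightarrow> real"
  proof -
    \<comment> \<open>Partitions are monotone on all natural numbers, so the sequence has to remain
      at \<open>b\<close> beyond the index \<open>Suc n\<close> as well.\<close>
    define t' where "t' i = (if i \<le> n then t i else b)" for i
    have "mono t'"
    proof (rule monoI)
      fix i j :: nat assume "i \<le> j"
      show "t' i \<le> t' j"
        using monoD[OF t(1) \<open>i \<le> j\<close>] monoD[OF t(1), of i n] t(3) ab \<open>i \<le> j\<close> by (auto simp: t'_def)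
    qed
    moreover have t'0: "t' 0 = 0" "t' (Suc n) = b" using t by (auto simp: t'_def)
    ultimately have "(\<Sum>i<Suc n. ennreal (dist (\<gamma> (t' i)) (\<gamma> (t' (Suc i))))) \<le> curve_length \<gamma> 0 b"
      unfolding curve_length_def
      by (intro SUP_upper2[where i="(Suc n, t')"]) (simp_all del: sum.lessThan_Suc sum_ennreal)
    moreover have "(\<Sum>i<Suc n. ennreal (dist (\<gamma> (t' i)) (\<gamma> (t' (Suc i)))))
        = ennreal (\<Sum>i<Suc n. dist (\<gamma> (t' i)) (\<gamma> (t' (Suc i))))"
      by (rule sum_ennreal) simp
    moreover have "(\<Sum>i<Suc n. dist (\<gamma> (t' i)) (\<gamma> (t' (Suc i))))
        = (\<Sum>i<n. dist (\<gamma> (t i)) (\<gamma> (t (Suc i)))) + dist (\<gamma> a) (\<gamma> b)"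
      using t by (simp add: t'_def)
    ultimately show ?thesis
      unfolding Lb by (simp only: ennreal_le_iff[OF order_trans[OF ab(1,2)]])
  qed
  have "curve_length \<gamma> 0 a \<le> ennreal (b - dist (\<gamma> a) (\<gamma> b))"
    unfolding curve_length_def
  proof (rule SUP_least)
    fix p :: "nat \<times> (nat \<Rightarrow> real)"
    assume "p \<in> {(n, t). mono t \<and> t 0 = 0 \<and> t n = a}"
    then obtain n t where p: "p = (n, t)" and t: "mono t" "t 0 = 0" "t n = a" by auto
    have "(\<Sum>i<n. dist (\<gamma> (t i)) (\<gamma> (t (Suc i)))) \<le> b - dist (\<gamma> a) (\<gamma> b)"
      using part[OF t] by simp
    then show "(case p of (n, t) \<Rightarrow> \<Sum>i<n. ennreal (dist (\<gamma> (t i)) (\<gamma> (t (Suc i))))) \<le> ennreal (b - dist (\<gamma> a) (\<gamma> b))"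
      by (simp add: p ennreal_leI)
  qed
  \<comment> \<open>Ensures that \<open>ennreal\<close> does not cut a negative difference off to 0;
    the partition used has the points 0 and \<open>a\<close> only.\<close>
  moreover have "dist (\<gamma> a) (\<gamma> b) \<le> b"
  proof -
    have "mono (\<lambda>i::nat. if i = 0 then 0 else a)" using ab by (auto intro!: monoI)
    then have "dist (\<gamma> 0) (\<gamma> a) + dist (\<gamma> a) (\<gamma> b) \<le> b"
      using part[of "\<lambda>i::nat. if i = 0 then 0 else a" 1] by simp
    then show ?thesis using zero_le_dist[of "\<gamma> 0" "\<gamma> a"] by linarith
  qed
  ultimately show ?thesis using La ab by (simp add: ennreal_le_iff)
qed

definition uniform_curve :: "'a::euclidean_space set \<Rightarrow> real \<Rightarrow> 'a \<Rightarrow> 'a \<Rightarrow> (real \<Rightarrow> 'a) \<Rightarrow> real \<Rightarrow> bool" where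
  "uniform_curve \<Gamma> \<sigma> x y \<gamma> l \<longleftrightarrow> arc_length_curve \<gamma> l \<and> \<gamma> 0 = x \<and> \<gamma> l = y \<and> l \<le> \<sigma> * dist x y \<and>
     (\<forall>t\<in>{0..l}. min t (l - t) / \<sigma> \<le> infdist (\<gamma> t) \<Gamma>)"

text \<open>The centres are \<open>\<gamma> (\<tau> - infdist x \<Gamma>)\<close>: only the first half of a long curve is used, and the
  chain stops once \<open>\<kappa> * \<tau>\<close> exceeds \<open>r\<close>.\<close>

lemma outward_chain_le:
  fixes F :: "'a::euclidean_space \<Rightarrow> ennreal"
  defines "D \<equiv> real DIM('a)"
  assumes fF: "sq_upper_gradient f F" and q: "0 < q" "q < 1"
    and \<gamma>: "uniform_curve \<Gamma> \<sigma> x y \<gamma> l" and \<sigma>: "1 \<le> \<sigma>" and dx: "0 < infdist x \<Gamma>"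
    and r: "0 < r" and f0: "\<And>p. r \<le> infdist p \<Gamma> \<Longrightarrow> f p = 0"
    and \<kappa>: "\<kappa> = 1 / (12 * \<sigma>)" and l: "4 * r / \<kappa> \<le> dist x y"
  shows "(\<integral>\<^sup>+u\<in>cball 0 1. ennreal ((f (x + (\<kappa> * infdist x \<Gamma>) *\<^sub>R u))\<^sup>2) \<partial>lborel)
    \<le> ennreal (1 / (1 - q)) * (\<Sum>k. let \<tau> = (1 + \<kappa>) ^ k * infdist x \<Gamma> in
        ennreal ((1/q) ^ k * ((2 * \<kappa> * \<tau>)\<^sup>2 * (\<kappa> * \<tau>) powr - D)) *
        (\<integral>\<^sup>+z\<in>{z. \<kappa> * \<tau> \<le> infdist z \<Gamma> \<and> infdist z \<Gamma> \<le> 2 * \<tau> \<and> dist x z \<le> 2 * \<tau> \<and> \<kappa> * \<tau> \<le> r}. F z \<partial>lborel))"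
proof -
  let ?d = "\<lambda>x. infdist x \<Gamma>"
  have arc: "arc_length_curve \<gamma> l" and \<gamma>0: "\<gamma> 0 = x" "\<gamma> l = y"
    and cig: "\<And>t. 0 \<le> t \<Longrightarrow> t \<le> l \<Longrightarrow> min t (l - t) / \<sigma> \<le> ?d (\<gamma> t)"
    using \<gamma> by (auto simp: uniform_curve_def)
  note lip = arc_length_curve_dist_le[OF arc]
  have l0: "0 \<le> l" using arc by (simp add: arc_length_curve_def)
  have lr: "4 * r / \<kappa> \<le> l" using l lip[of 0 l] l0 \<gamma>0 by simp
  have \<kappa>0: "0 < \<kappa>" "\<kappa> \<le> 1/12" using \<sigma> by (auto simp: \<kappa> field_simps)
  define \<tau> where "\<tau> k = (1 + \<kappa>) ^ k * ?d x" for k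
  have \<tau>0: "\<tau> 0 = ?d x" by (simp add: \<tau>_def)
  have \<tau>Suc: "\<tau> (Suc k) = \<tau> k + \<kappa> * \<tau> k" for k by (simp add: \<tau>_def algebra_simps)
  have \<tau>pos: "0 < \<tau> k" for k using \<kappa>0 dx by (simp add: \<tau>_def)
  have \<tau>ge: "?d x \<le> \<tau> k" for k using \<kappa>0 dx by (simp add: \<tau>_def one_le_power)
  have \<tau>mono: "\<tau> i \<le> \<tau> j" if "i \<le> j" for i j
    using that \<kappa>0 dx by (auto simp: \<tau>_def intro!: mult_right_mono power_increasing)
  have ex: "\<exists>n. r \<le> \<kappa> * \<tau> n"
  proof -
    obtain n where "r / (\<kappa> * ?d x) < (1 + \<kappa>) ^ n"
      using real_arch_pow[of "1 + \<kappa>"] \<kappa>0 by auto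
    then have "r \<le> \<kappa> * \<tau> n" using \<kappa>0 dx by (simp add: \<tau>_def field_simps)
    then show ?thesis by blast
  qed
  \<comment> \<open>Being least gives \<open>\<kappa> * \<tau> k < r\<close> for all earlier
    \<open>k\<close>. This keeps the chain in the first half of the curve and later confines the
    kernel to points \<open>y\<close> at distance at most \<open>2 * r / \<kappa>\<close> from the
    boundary.\<close>
  define N where "N = (LEAST n. r \<le> \<kappa> * \<tau> n)"
  have N: "r \<le> \<kappa> * \<tau> N" unfolding N_def using ex by (rule LeastI_ex)
  have below: "\<kappa> * \<tau> k < r" if "k < N" for k
    using not_less_Least[of k "\<lambda>n. r \<le> \<kappa> * \<tau> n"] that by (auto simp: N_def)
  define t where "t k = \<tau> k - ?d x" for k
  have tl: "0 \<le> t k" "t k \<le> l / 2" if "k \<le> N" for k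
  proof -
    show "0 \<le> t k" using \<tau>ge by (simp add: t_def)
    show "t k \<le> l / 2"
    proof (cases k)
      case 0
      then show ?thesis using l0 by (simp add: t_def \<tau>0)
    next
      case (Suc j)
      then have "\<kappa> * \<tau> j < r" using that by (intro below) simp
      then have "\<tau> j < r / \<kappa>" using \<kappa>0 by (simp add: field_simps)
      moreover have "\<kappa> * \<tau> j \<le> 1 * \<tau> j" using \<kappa>0 \<tau>pos[of j] by (intro mult_right_mono) auto
      ultimately have "\<tau> k < 2 * (r / \<kappa>)" using Suc by (simp add: \<tau>Suc)
      then show ?thesis using lr dx by (simp add: t_def)
    qed
  qed
  define X where "X k = \<gamma> (t k)" for k
  have \<kappa>\<sigma>: "\<tau> k / \<sigma> = 12 * (\<kappa> * \<tau> k)" for k using \<sigma> by (simp add: \<kappa>)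
  have xX: "dist x (X k) \<le> t k" if "k \<le> N" for k
    using lip[of 0 "t k"] tl[OF that] l0 by (simp add: X_def \<gamma>0)
  \<comment> \<open>Close to \<open>x\<close> at most half of the distance to
    \<open>\<Gamma>\<close> is lost; farther along, the curve condition takes over. Both give a
    third of \<open>\<tau> k / \<sigma>\<close>, and the 12 in \<open>\<kappa>\<close> makes this 4
    radii: 3 for \<open>K k\<close> and 1 to spare.\<close>
  have dX: "4 * (\<kappa> * \<tau> k) \<le> ?d (X k)" if k: "k \<le> N" for k
  proof (cases "t k \<le> ?d x / 2")
    case True
    have "?d x \<le> ?d (X k) + t k" using infdist_triangle[of x \<Gamma> "X k"] xX[OF k] by simp
    then have "\<tau> k / 3 \<le> ?d (X k)" using True by (simp add: t_def)
    moreover have "\<tau> k / \<sigma> \<le> \<tau> k" using \<sigma> \<tau>pos[of k] by (simp add: divide_le_eq_1 field_simps)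
    ultimately show ?thesis using \<kappa>\<sigma>[of k] by simp
  next
    case False
    then have "\<tau> k \<le> 3 * t k" by (simp add: t_def)
    then have "\<tau> k / \<sigma> \<le> 3 * t k / \<sigma>" using \<sigma> by (intro divide_right_mono) auto
    moreover have "t k / \<sigma> \<le> ?d (X k)"
      using cig[of "t k"] tl[OF k] l0 by (simp add: X_def min_def)
    ultimately show ?thesis using \<kappa>\<sigma>[of k] by simp
  qed
  have XX: "dist (X k) (X (Suc k)) \<le> \<kappa> * \<tau> k" if "k < N" for k
    using lip[of "t k" "t (Suc k)"] tl[of k] tl[of "Suc k"] that \<tau>mono[of k "Suc k"] l0
    by (simp add: X_def t_def \<tau>Suc)
  \<comment> \<open>Three radii suffice: the next centre is at most one radius away, and its ball
    has at most twice the present radius.\<close>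
  define K where "K k = cball (X k) (3 * (\<kappa> * \<tau> k))" for k
  let ?S = "\<lambda>k. {z. \<kappa> * \<tau> k \<le> ?d z \<and> ?d z \<le> 2 * \<tau> k \<and> dist x z \<le> 2 * \<tau> k \<and> \<kappa> * \<tau> k \<le> r}"
  have K: "K k \<subseteq> ?S k" if "k < N" for k
  proof
    fix z assume "z \<in> K k"
    then have z: "dist (X k) z \<le> 3 * (\<kappa> * \<tau> k)" by (simp add: K_def)
    have a: "\<kappa> * \<tau> k \<le> \<tau> k / 12" using mult_right_mono[OF \<kappa>0(2), of "\<tau> k"] \<tau>pos[of k] by simp
    have xz: "dist x z \<le> t k + 3 * (\<kappa> * \<tau> k)"
      using xX[of k] that z dist_triangle[of x z "X k"] by simp
    have "?d (X k) \<le> ?d z + 3 * (\<kappa> * \<tau> k)"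
      using infdist_triangle[of "X k" \<Gamma> z] z by simp
    moreover have "?d z \<le> ?d x + dist x z"
      using infdist_triangle[of z \<Gamma> x] by (simp add: dist_commute)
    ultimately show "z \<in> ?S k"
      using dX[of k] below[OF that] that xz a dx unfolding t_def by simp
  qed
  have "(\<integral>\<^sup>+u\<in>cball 0 1. ennreal ((f (X 0 + (\<kappa> * \<tau> 0) *\<^sub>R u))\<^sup>2) \<partial>lborel)
    \<le> ennreal (1 / (1 - q)) * (\<Sum>k<N. ennreal ((1/q) ^ k * ((2 * \<kappa> * \<tau> k)\<^sup>2 * (\<kappa> * \<tau> k) powr - real DIM('a))) * (\<integral>\<^sup>+z\<in>K k. F z \<partial>lborel))"
  proof (rule ball_chain_le[OF fF q, where P="\<lambda>k. \<kappa> * \<tau> k" and K=K])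
    fix k assume k: "k < N"
    have a: "0 < \<kappa> * \<tau> k" using \<kappa>0 \<tau>pos by simp
    have b: "\<kappa> * (\<kappa> * \<tau> k) \<le> \<kappa> * \<tau> k" "0 < \<kappa> * (\<kappa> * \<tau> k)" using mult_right_mono[of \<kappa> 1 "\<kappa> * \<tau> k"] \<kappa>0 a by auto
    show "0 < \<kappa> * \<tau> k \<and> \<kappa> * \<tau> k \<le> \<kappa> * \<tau> k \<and> \<kappa> * \<tau> k \<le> \<kappa> * \<tau> (Suc k)"
      using a b by (simp add: \<tau>Suc algebra_simps)
    show "dist (X k) (X (Suc k)) + \<bar>\<kappa> * \<tau> (Suc k) - \<kappa> * \<tau> k\<bar> \<le> 2 * \<kappa> * \<tau> k"
      using XX[OF k] a b by (simp add: \<tau>Suc algebra_simps)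
    have "cball (X (Suc k)) (\<kappa> * \<tau> (Suc k)) \<subseteq> K k"
    proof
      fix z assume "z \<in> cball (X (Suc k)) (\<kappa> * \<tau> (Suc k))"
      then have "dist (X (Suc k)) z \<le> \<kappa> * \<tau> k + \<kappa> * (\<kappa> * \<tau> k)" by (simp add: \<tau>Suc algebra_simps)
      then show "z \<in> K k"
        using dist_triangle[of "X k" z "X (Suc k)"] XX[OF k] b by (simp add: K_def)
    qed
    moreover have "cball (X k) (\<kappa> * \<tau> k) \<subseteq> K k" using a by (auto simp: K_def)
    ultimately show "cball (X k) (\<kappa> * \<tau> k) \<subseteq> K k \<and> cball (X (Suc k)) (\<kappa> * \<tau> (Suc k)) \<subseteq> K k \<and> convex (K k) \<and> closed (K k)"
      by (simp add: K_def)
  next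
    fix u :: 'a assume u: "u \<in> cball 0 1"
    have "dist (X N) (X N + (\<kappa> * \<tau> N) *\<^sub>R u) \<le> \<kappa> * \<tau> N"
      using u \<kappa>0 \<tau>pos[of N] by (simp add: dist_norm mult_left_le)
    then have "r \<le> ?d (X N + (\<kappa> * \<tau> N) *\<^sub>R u)"
      using infdist_triangle[of "X N" \<Gamma> "X N + (\<kappa> * \<tau> N) *\<^sub>R u"] dX[of N] N mult_pos_pos[OF \<kappa>0(1) \<tau>pos[of N]] by simp
    then show "f (X N + (\<kappa> * \<tau> N) *\<^sub>R u) = 0" by (rule f0)
  qed
  also have "\<dots> \<le> ennreal (1 / (1 - q)) * (\<Sum>k<N. ennreal ((1/q) ^ k * ((2 * \<kappa> * \<tau> k)\<^sup>2 * (\<kappa> * \<tau> k) powr - D)) * (\<integral>\<^sup>+z\<in>?S k. F z \<partial>lborel))"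
  proof (unfold D_def, intro mult_left_mono sum_mono nn_integral_mono)
    fix k z assume "k \<in> {..<N}"
    then show "indicator (K k) z \<le> (indicator (?S k) z :: ennreal)"
      using K[of k] by (auto simp: indicator_def)
  qed auto
  \<comment> \<open>Passing to the whole series removes \<open>N\<close>, which depends on
    \<open>x\<close>.\<close>
  also have "\<dots> \<le> ennreal (1 / (1 - q)) * (\<Sum>k. ennreal ((1/q) ^ k * ((2 * \<kappa> * \<tau> k)\<^sup>2 * (\<kappa> * \<tau> k) powr - D)) * (\<integral>\<^sup>+z\<in>?S k. F z \<partial>lborel))"
    by (intro mult_left_mono sum_le_suminf) auto
  finally show ?thesis
    by (simp add: Let_def \<tau>_def[symmetric] \<tau>0 X_def t_def \<gamma>0)
qed

text \<open>The curve ends in \<open>\<Omega>\<close>, not at \<open>w\<close>: its endpoint \<open>w'\<close> is chosen after the number of balls, so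
  close to \<open>w\<close> that the difference is invisible at the last scale.\<close>

lemma inward_chain_le:
  fixes F :: "'a::euclidean_space \<Rightarrow> ennreal"
  defines "D \<equiv> real DIM('a)"
  assumes fF: "sq_upper_gradient f F" and q: "0 < q" "q < 1"
    and curves: "\<And>y. y \<in> \<Omega> \<Longrightarrow> \<exists>\<gamma> l. uniform_curve \<Gamma> \<sigma> x y \<gamma> l"
    and \<sigma>: "1 \<le> \<sigma>" and dx: "0 < infdist x \<Gamma>"
    and \<eta>: "0 < \<eta>" and f0: "\<And>p. infdist p \<Gamma> \<le> \<eta> \<Longrightarrow> f p = 0"
    and w: "w \<in> \<Gamma>" "w \<in> closure \<Omega>" "dist x w \<le> 2 * infdist x \<Gamma>"
    and \<kappa>: "\<kappa> = 1 / (12 * \<sigma>)" and \<mu>: "\<mu> = 1 - \<kappa> / (3 * \<sigma>)"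
  shows "(\<integral>\<^sup>+u\<in>cball 0 1. ennreal ((f (x + (\<kappa> * infdist x \<Gamma>) *\<^sub>R u))\<^sup>2) \<partial>lborel)
    \<le> ennreal (1 / (1 - q)) * (\<Sum>k. let \<tau> = \<mu> ^ k * infdist x \<Gamma> in
        ennreal ((1/q) ^ k * ((2 * \<kappa> * \<tau>)\<^sup>2 * (\<kappa> * \<tau> / 2) powr - D)) *
        (\<integral>\<^sup>+z\<in>{z. \<kappa> * \<tau> \<le> infdist z \<Gamma> \<and> infdist z \<Gamma> \<le> 5 * \<sigma> * \<tau> \<and> dist z w \<le> 5 * \<sigma> * \<tau> \<and>
            dist x z \<le> 7 * \<sigma> * infdist x \<Gamma>}. F z \<partial>lborel))"
proof -
  let ?d = "\<lambda>x. infdist x \<Gamma>"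
  have \<kappa>0: "0 < \<kappa>" "\<kappa> \<le> 1/12" using \<sigma> by (auto simp: \<kappa> field_simps)
  have \<kappa>3: "0 < \<kappa> / (3 * \<sigma>)" "\<kappa> / (3 * \<sigma>) \<le> \<kappa>" "\<kappa> / (3 * \<sigma>) \<le> 1/36"
  proof -
    show "0 < \<kappa> / (3 * \<sigma>)" using \<kappa>0 \<sigma> by simp
    have "\<kappa> / (3 * \<sigma>) \<le> \<kappa> / 3" using \<kappa>0 \<sigma> by (intro divide_left_mono) auto
    then show "\<kappa> / (3 * \<sigma>) \<le> \<kappa>" "\<kappa> / (3 * \<sigma>) \<le> 1/36" using \<kappa>0 by auto
  qed
  have \<mu>0: "35/36 \<le> \<mu>" "\<mu> < 1" using \<kappa>3 by (auto simp: \<mu>)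
  define \<tau> where "\<tau> k = \<mu> ^ k * ?d x" for k
  have \<tau>0: "\<tau> 0 = ?d x" by (simp add: \<tau>_def)
  have \<tau>Suc: "\<tau> (Suc k) = \<mu> * \<tau> k" for k by (simp add: \<tau>_def)
  have \<tau>pos: "0 < \<tau> k" for k using \<mu>0 dx by (simp add: \<tau>_def)
  have \<mu>pow: "0 < \<mu> ^ k" "\<mu> ^ k \<le> 1" for k using \<mu>0 by (auto simp: power_le_one)
  have \<tau>le: "\<tau> k \<le> ?d x" for k using \<mu>pow[of k] dx by (simp add: \<tau>_def mult_left_le_one_le)
  have \<tau>mono: "\<tau> j \<le> \<tau> i" if "i \<le> j" for i j
    using that \<mu>0 dx by (auto simp: \<tau>_def intro!: mult_right_mono power_decreasing)
  obtain N where N: "5 * \<sigma> * \<tau> N \<le> \<eta>"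
  proof -
    have "0 < \<eta> / (5 * \<sigma> * ?d x)" using \<eta> \<sigma> dx by simp
    then obtain n where "\<mu> ^ n < \<eta> / (5 * \<sigma> * ?d x)"
      using real_arch_pow_inv[of _ \<mu>] \<mu>0 by auto
    then have "5 * \<sigma> * \<tau> n \<le> \<eta>" using \<sigma> dx by (simp add: \<tau>_def field_simps)
    then show ?thesis by (rule that)
  qed
  \<comment> \<open>The bound \<open>?d x / 2\<close> keeps the length \<open>l\<close> comparable
    to the distance of \<open>x\<close> from \<open>\<Gamma>\<close>; the bound
    \<open>\<tau> N\<close> makes the replacement of \<open>w'\<close> by \<open>w\<close> cost at
    most \<open>\<tau> k\<close> at every scale of the chain.\<close>
  define \<theta> where "\<theta> = min (?d x / 2) (\<tau> N)"
  have \<theta>: "0 < \<theta>" "\<theta> \<le> ?d x / 2" "\<theta> \<le> \<tau> N" using dx \<tau>pos[of N] by (auto simp: \<theta>_def)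
  have \<theta>\<tau>: "\<theta> \<le> \<tau> k" if "k \<le> N" for k using \<tau>mono[OF that] \<theta> by simp
  obtain w' where w': "w' \<in> \<Omega>" "dist w' w < \<theta>"
    using w(2) \<theta>(1) by (auto simp: closure_approachable)
  obtain \<gamma> l where \<gamma>: "uniform_curve \<Gamma> \<sigma> x w' \<gamma> l" using curves[OF w'(1)] by blast
  have arc: "arc_length_curve \<gamma> l" and \<gamma>0: "\<gamma> 0 = x" "\<gamma> l = w'" and l\<sigma>: "l \<le> \<sigma> * dist x w'"
    and cig: "\<And>t. 0 \<le> t \<Longrightarrow> t \<le> l \<Longrightarrow> min t (l - t) / \<sigma> \<le> ?d (\<gamma> t)"
    using \<gamma> by (auto simp: uniform_curve_def)
  note lip = arc_length_curve_dist_le[OF arc]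
  have l0: "0 \<le> l" using arc by (simp add: arc_length_curve_def)
  have xw: "?d x \<le> dist x w" using infdist_le[OF w(1)] .
  have l1: "?d x / 2 \<le> l"
    using lip[of 0 l] l0 xw w'(2) \<theta>(2) dist_triangle[of x w w'] by (simp add: \<gamma>0)
  have l2: "l \<le> 5/2 * \<sigma> * ?d x"
  proof -
    have "dist x w' \<le> 5/2 * ?d x"
      using w(3) w'(2) \<theta>(2) dist_triangle[of x w' w] by (simp add: dist_commute)
    then have "\<sigma> * dist x w' \<le> \<sigma> * (5/2 * ?d x)" using \<sigma> by (intro mult_left_mono) auto
    then show ?thesis using l\<sigma> by simp
  qed
  \<comment> \<open>It is the remaining length that shrinks by the ratio \<open>\<mu>\<close>, so
    the chain starts at \<open>x\<close> and never quite reaches \<open>w'\<close>.\<close>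
  define t where "t k = l - \<mu> ^ k * l" for k
  have tl: "0 \<le> t k" "t k \<le> l" for k
    using \<mu>pow[of k] l0 by (auto simp: t_def mult_left_le_one_le)
  have lt: "\<mu> ^ k * l \<le> 5/2 * (\<sigma> * \<tau> k)" for k
    using mult_left_mono[OF l2, of "\<mu> ^ k"] \<mu>pow[of k] by (simp add: \<tau>_def ac_simps)
  define X where "X k = \<gamma> (t k)" for k
  have \<kappa>\<sigma>: "\<tau> k / \<sigma> = 12 * (\<kappa> * \<tau> k)" for k using \<sigma> by (simp add: \<kappa>)
  have dX: "6 * (\<kappa> * \<tau> k) \<le> ?d (X k)" for k
  proof -
    have "\<tau> k / 2 / \<sigma> \<le> ?d (X k)"
    proof (cases "t k \<le> ?d x / 2")
      case True
      have "dist x (X k) \<le> t k" using lip[of 0 "t k"] tl[of k] by (simp add: X_def \<gamma>0)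
      then have "?d x / 2 \<le> ?d (X k)" using True infdist_triangle[of x \<Gamma> "X k"] by simp
      moreover have "\<tau> k / 2 / \<sigma> \<le> \<tau> k / 2" using \<sigma> \<tau>pos[of k] by (simp add: divide_le_eq_1 field_simps)
      ultimately show ?thesis using \<tau>le[of k] by simp
    next
      case False
      have "\<mu> ^ k * (?d x / 2) \<le> \<mu> ^ k * l" using l1 \<mu>pow[of k] by (intro mult_left_mono) auto
      then have "\<tau> k / 2 \<le> min (t k) (l - t k)"
        using False \<tau>le[of k] by (simp add: t_def \<tau>_def)
      then have "\<tau> k / 2 / \<sigma> \<le> min (t k) (l - t k) / \<sigma>" using \<sigma> by (intro divide_right_mono) auto
      then show ?thesis using cig[of "t k"] tl[of k] by (simp add: X_def)
    qed
    then show ?thesis using \<kappa>\<sigma>[of k] by simp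
  qed
  have Xw: "dist (X k) w \<le> 5/2 * (\<sigma> * \<tau> k) + \<tau> k" if "k \<le> N" for k
  proof -
    have "dist (X k) w' \<le> \<mu> ^ k * l" using lip[of "t k" l] tl[of k] by (simp add: X_def \<gamma>0 t_def)
    then show ?thesis
      using dist_triangle[of "X k" w w'] w'(2) \<theta>\<tau>[OF that] lt[of k] by simp
  qed
  \<comment> \<open>The origin of \<open>\<mu>\<close>: the remaining length is at most
    \<open>5/2 * \<sigma> * \<tau> k\<close>, so the fraction
    \<open>\<kappa> / (3 * \<sigma>)\<close> of it is less than the radius
    \<open>\<kappa> * \<tau> k\<close>.\<close>
  have XX: "dist (X k) (X (Suc k)) \<le> \<kappa> * \<tau> k" for k
  proof -
    have le: "\<mu> ^ Suc k * l \<le> \<mu> ^ k * l" using \<mu>0 l0 by (intro mult_right_mono power_decreasing) auto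
    have "dist (X k) (X (Suc k)) \<le> t (Suc k) - t k"
    proof -
      have "t k \<le> t (Suc k)" using le by (simp add: t_def)
      then show ?thesis unfolding X_def using tl by (intro lip)
    qed
    also have "\<dots> = \<kappa> / (3 * \<sigma>) * (\<mu> ^ k * l)" by (simp add: t_def \<mu> algebra_simps)
    also have "\<dots> \<le> \<kappa> / (3 * \<sigma>) * (5/2 * (\<sigma> * \<tau> k))" using \<kappa>3 lt by (intro mult_left_mono) auto
    also have "\<dots> = 5/6 * (\<kappa> * \<tau> k)" using \<sigma> by simp
    finally show ?thesis using mult_pos_pos[OF \<kappa>0(1) \<tau>pos[of k]] by simp
  qed
  define K where "K k = cball (X k) (3 * (\<kappa> * \<tau> k))" for k
  let ?S = "\<lambda>k. {z. \<kappa> * \<tau> k \<le> ?d z \<and> ?d z \<le> 5 * \<sigma> * \<tau> k \<and> dist z w \<le> 5 * \<sigma> * \<tau> k \<and>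
            dist x z \<le> 7 * \<sigma> * ?d x}"
  have a12: "\<kappa> * \<tau> k \<le> \<tau> k / 12" for k using mult_right_mono[OF \<kappa>0(2), of "\<tau> k"] \<tau>pos[of k] by simp
  have \<tau>\<sigma>: "\<tau> k \<le> \<sigma> * \<tau> k" for k using \<sigma> \<tau>pos[of k] by simp
  have a0: "0 < \<kappa> * \<tau> k" for k using \<kappa>0 \<tau>pos by simp
  have K: "K k \<subseteq> ?S k" if "k < N" for k
  proof
    fix z assume "z \<in> K k"
    then have z: "dist (X k) z \<le> 3 * (\<kappa> * \<tau> k)" by (simp add: K_def)
    have zw: "dist z w \<le> 5 * (\<sigma> * \<tau> k)"
      using z Xw[OF less_imp_le[OF that]] a12[of k] \<tau>\<sigma>[of k] \<tau>pos[of k] dist_triangle[of z w "X k"]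
      unfolding dist_commute[of z "X k"] by linarith
    have "\<sigma> * \<tau> k \<le> \<sigma> * ?d x" "?d x \<le> \<sigma> * ?d x" using \<tau>le \<sigma> dx by (auto intro: mult_left_mono)
    then have "dist x z \<le> 7 * (\<sigma> * ?d x)"
      using zw w(3) dist_triangle[of x z w] by (simp add: dist_commute)
    moreover have "?d (X k) \<le> ?d z + 3 * (\<kappa> * \<tau> k)"
      using infdist_triangle[of "X k" \<Gamma> z] z by simp
    moreover have "?d z \<le> dist z w" using infdist_le[OF w(1)] .
    ultimately show "z \<in> ?S k"
      using dX[of k] zw a0[of k] by simp
  qed
  have "(\<integral>\<^sup>+u\<in>cball 0 1. ennreal ((f (X 0 + (\<kappa> * \<tau> 0) *\<^sub>R u))\<^sup>2) \<partial>lborel)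
    \<le> ennreal (1 / (1 - q)) * (\<Sum>k<N. ennreal ((1/q) ^ k * ((2 * \<kappa> * \<tau> k)\<^sup>2 * (\<kappa> * \<tau> k / 2) powr - real DIM('a))) * (\<integral>\<^sup>+z\<in>K k. F z \<partial>lborel))"
  proof (rule ball_chain_le[OF fF q, where P="\<lambda>k. \<kappa> * \<tau> k" and K=K])
    fix k assume k: "k < N"
    note a = a0[of k]
    have S: "\<kappa> * \<tau> (Suc k) = \<mu> * (\<kappa> * \<tau> k)" by (simp add: \<tau>Suc)
    have b: "\<mu> * (\<kappa> * \<tau> k) \<le> 1 * (\<kappa> * \<tau> k)" "35/36 * (\<kappa> * \<tau> k) \<le> \<mu> * (\<kappa> * \<tau> k)"
      using \<mu>0 a mult_right_mono[of \<mu> 1 "\<kappa> * \<tau> k"] mult_right_mono[of "35/36" \<mu> "\<kappa> * \<tau> k"] by auto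
    show "0 < \<kappa> * \<tau> k / 2 \<and> \<kappa> * \<tau> k / 2 \<le> \<kappa> * \<tau> k \<and> \<kappa> * \<tau> k / 2 \<le> \<kappa> * \<tau> (Suc k)"
      unfolding S using a b by simp
    show "dist (X k) (X (Suc k)) + \<bar>\<kappa> * \<tau> (Suc k) - \<kappa> * \<tau> k\<bar> \<le> 2 * \<kappa> * \<tau> k"
      unfolding S using XX[of k] a b by simp
    have "cball (X (Suc k)) (\<kappa> * \<tau> (Suc k)) \<subseteq> K k"
    proof
      fix z assume "z \<in> cball (X (Suc k)) (\<kappa> * \<tau> (Suc k))"
      then have "dist (X (Suc k)) z \<le> \<kappa> * \<tau> k" using b unfolding S by simp
      then show "z \<in> K k"
        using dist_triangle[of "X k" z "X (Suc k)"] XX[of k] a by (simp add: K_def)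
    qed
    moreover have "cball (X k) (\<kappa> * \<tau> k) \<subseteq> K k" using a by (auto simp: K_def)
    ultimately show "cball (X k) (\<kappa> * \<tau> k) \<subseteq> K k \<and> cball (X (Suc k)) (\<kappa> * \<tau> (Suc k)) \<subseteq> K k \<and> convex (K k) \<and> closed (K k)"
      by (simp add: K_def)
  next
    fix u :: 'a assume u: "u \<in> cball 0 1"
    let ?p = "X N + (\<kappa> * \<tau> N) *\<^sub>R u"
    have "dist (X N) ?p \<le> \<kappa> * \<tau> N"
      using u a0[of N] by (simp add: dist_norm mult_left_le)
    then have "dist ?p w \<le> 5 * (\<sigma> * \<tau> N)"
      using Xw[of N] a12[of N] \<tau>\<sigma>[of N] \<tau>pos[of N] dist_triangle[of ?p w "X N"]
      unfolding dist_commute[of ?p "X N"] by linarith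
    then have "?d ?p \<le> \<eta>" using N infdist_le[OF w(1), of ?p] by simp
    then show "f ?p = 0" by (rule f0)
  qed
  also have "\<dots> \<le> ennreal (1 / (1 - q)) * (\<Sum>k<N. ennreal ((1/q) ^ k * ((2 * \<kappa> * \<tau> k)\<^sup>2 * (\<kappa> * \<tau> k / 2) powr - D)) * (\<integral>\<^sup>+z\<in>?S k. F z \<partial>lborel))"
  proof (unfold D_def, intro mult_left_mono sum_mono nn_integral_mono)
    fix k z assume "k \<in> {..<N}"
    then show "indicator (K k) z \<le> (indicator (?S k) z :: ennreal)"
      using K[of k] by (auto simp: indicator_def)
  qed auto
  also have "\<dots> \<le> ennreal (1 / (1 - q)) * (\<Sum>k. ennreal ((1/q) ^ k * ((2 * \<kappa> * \<tau> k)\<^sup>2 * (\<kappa> * \<tau> k / 2) powr - D)) * (\<integral>\<^sup>+z\<in>?S k. F z \<partial>lborel))"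
    by (intro mult_left_mono sum_le_suminf) auto
  finally show ?thesis
    by (simp add: Let_def \<tau>_def[symmetric] \<tau>0 X_def t_def \<gamma>0)
qed

section \<open>Hardy inequalities for functions with an upper gradient\<close>

lemma power_powr_swap: "0 < x \<Longrightarrow> (x powr a) ^ k = (x ^ k) powr (a::real)"
  by (induction k) (simp_all add: powr_mult)

text \<open>To be used with \<open>t\<close> and \<open>v\<close> the boundary distances of
  \<open>x\<close> and \<open>y\<close>, and \<open>p\<close> the scale factor: the kernel
  coefficient is rewritten in terms of \<open>p\<close> and \<open>v\<close> and so becomes constant
  in the integration over \<open>x\<close>.\<close>

lemma powr_product_le_of_comparable:
  fixes a b c p t v :: real
  assumes "0 < p" "0 < t" "0 < v" "1 \<le> c" and 1: "p * t \<le> c * v" and 2: "v \<le> c * (p * t)"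
  shows "t powr a * (p * t) powr b \<le> c powr (\<bar>a\<bar> + \<bar>b\<bar>) * (p powr - a * v powr (a + b))"
proof -
  have "t powr a \<le> c powr \<bar>a\<bar> * (v / p) powr a"
    using assms by (intro powr_le_of_comparable) (auto simp: field_simps)
  moreover have "(p * t) powr b \<le> c powr \<bar>b\<bar> * v powr b"
    using assms by (intro powr_le_of_comparable) auto
  ultimately have "t powr a * (p * t) powr b \<le> (c powr \<bar>a\<bar> * (v / p) powr a) * (c powr \<bar>b\<bar> * v powr b)"
    by (intro mult_mono) auto
  also have "(v / p) powr a = p powr - a * v powr a"
    using assms by (simp add: powr_divide powr_minus_divide)
  finally show ?thesis by (simp add: powr_add ac_simps)
qed

text \<open>One shape serves the kernels of both cases. This is why the inward kernel states the
  bound \<open>2 * r\<close> on the distance of \<open>x\<close> with a common factor on both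
  sides.\<close>

lemma closed_infdist_kernel_set:
  fixes \<Gamma> :: "'a::euclidean_space set"
  shows "closed {p::'a \<times> 'a. a * infdist (fst p) \<Gamma> \<le> infdist (snd p) \<Gamma> \<and> infdist (snd p) \<Gamma> \<le> b * infdist (fst p) \<Gamma> \<and>
      dist (fst p) (snd p) \<le> c * infdist (fst p) \<Gamma> \<and> a * infdist (fst p) \<Gamma> \<le> e}"
  by (intro closed_Collect_conj closed_Collect_le continuous_intros)

text \<open>For a fixed scale \<open>k\<close> and fixed \<open>y\<close>, the points \<open>x\<close> whose chain sees \<open>y\<close> lie in the part of a ball of
  radius about \<open>infdist y \<Gamma>\<close> within distance \<open>infdist y \<Gamma> / p k\<close> of \<open>\<Gamma>\<close>; its volume makes the sum
  over \<open>k\<close> converge.\<close>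

lemma thin_hardy:
  fixes \<Gamma> \<Omega> :: "'a::euclidean_space set"
  assumes reg: "uniformly_ball_regular M \<Gamma> C R s" and cl: "closed \<Gamma>" and "\<Gamma> \<noteq> {}" and "open \<Omega>"
    and \<Omega>: "\<And>y. y \<in> \<Omega> \<Longrightarrow> 0 < infdist y \<Gamma> \<and> ball y (infdist y \<Gamma>) \<subseteq> \<Omega>"
    and \<sigma>: "1 \<le> \<sigma>" and \<rho>0: "0 < \<rho>0"
    and far: "\<And>x. x \<in> \<Omega> \<Longrightarrow> \<exists>y \<gamma> l. uniform_curve \<Gamma> \<sigma> x y \<gamma> l \<and> \<rho>0 \<le> dist x y"
    and thin: "s < real DIM('a) - 2 + \<delta>"
  shows "\<exists>r0>0. \<exists>A\<ge>0. \<forall>r f F. 0 < r \<and> r < r0 \<and> sq_upper_gradient f F \<and> (\<forall>p. r \<le> infdist p \<Gamma> \<longrightarrow> f p = 0) \<longrightarrow>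
     (\<integral>\<^sup>+x\<in>\<Omega>. ennreal (infdist x \<Gamma> powr (\<delta> - 2)) * ennreal ((f x)\<^sup>2) \<partial>lborel)
       \<le> ennreal A * (\<integral>\<^sup>+y. F y * ennreal (infdist y \<Gamma> powr \<delta>) \<partial>lborel)"
proof -
  let ?d = "\<lambda>x. infdist x \<Gamma>"
  define D where "D = real DIM('a)"
  define \<kappa> where "\<kappa> = 1 / (12 * \<sigma>)"
  define c where "c = 1 / \<kappa>"
  define \<epsilon> where "\<epsilon> = (D - 2 + \<delta> - s) / 2"
  define q where "q = (1 + \<kappa>) powr - \<epsilon>"
  have \<kappa>: "0 < \<kappa>" "\<kappa> \<le> 1/12" using \<sigma> by (auto simp: \<kappa>_def field_simps)
  have c: "12 \<le> c" "\<kappa> * c = 1" using \<kappa> by (auto simp: c_def field_simps)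
  have \<epsilon>: "0 < \<epsilon>" using thin by (simp add: \<epsilon>_def D_def)
  have q: "0 < q" "q < 1"
    using \<kappa> \<epsilon> powr_less_mono[of "- \<epsilon>" 0 "1 + \<kappa>"] by (auto simp: q_def)
  have C: "C > 1" and R: "R > 0" using uniformly_ball_regularD[OF reg] by auto
  \<comment> \<open>The first bound makes \<open>4 * T\<close> at most \<open>R\<close> in the
    volume estimate, given that \<open>v\<close> is at most \<open>2 * r / \<kappa>\<close>; the
    second makes the curves supplied by \<open>far\<close> long enough for the outward
    chain.\<close>
  define r0 where "r0 = min (\<kappa>\<^sup>2 * R / 16) (\<rho>0 * \<kappa> / 4)"
  have r0: "r0 > 0" using \<kappa> R \<rho>0 by (simp add: r0_def)
  define V where "V = unit_ball_vol D * 2 ^ DIM('a) * 4 powr s * C\<^sup>2"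
  have V: "V \<ge> 0" using C by (simp add: V_def D_def)
  define B0 where "B0 = 1 / (1 - q) * (4 * \<kappa>\<^sup>2 * \<kappa> powr - D)"
  have B0: "B0 \<ge> 0" using q by (simp add: B0_def)
  define B1 where "B1 = B0 * c powr (\<bar>\<delta> - 2\<bar> + \<bar>2 - D\<bar>)"
  have B1: "B1 \<ge> 0" using B0 by (simp add: B1_def)
  define B where "B = B1 * (V * (\<kappa> powr - D * 2 powr s))"
  have B: "B \<ge> 0" using B1 V by (simp add: B_def)
  define E where "E = 2 powr \<bar>\<delta> - 2 - D\<bar> * 2 ^ DIM('a) / unit_ball_vol D"
  have E: "E \<ge> 0" by (simp add: E_def D_def)
  define A where "A = E * (B / (1 - q))"
  have "(\<integral>\<^sup>+x\<in>\<Omega>. ennreal (?d x powr (\<delta> - 2)) * ennreal ((f x)\<^sup>2) \<partial>lborel)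
       \<le> ennreal A * (\<integral>\<^sup>+y. F y * ennreal (?d y powr \<delta>) \<partial>lborel)"
    if r: "0 < r" "r < r0" and fF: "sq_upper_gradient f F" and f0: "\<forall>p. r \<le> ?d p \<longrightarrow> f p = 0" for r f F
  proof -
    note [measurable] = sq_upper_gradient_measurable[OF fF]
    have [measurable]: "?d \<in> borel_measurable borel"
      by (intro borel_measurable_continuous_onI continuous_intros)
    define p where "p k = (1 + \<kappa>) ^ k" for k :: nat
    have p: "1 \<le> p k" for k using \<kappa> by (simp add: p_def one_le_power)
    have p0: "0 < p k" for k using p[of k] by simp
    have qp: "q ^ k = p k powr - \<epsilon>" "(1 / q) ^ k = p k powr \<epsilon>" for k
    proof -
      show "q ^ k = p k powr - \<epsilon>" unfolding q_def p_def using \<kappa> by (intro power_powr_swap) auto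
      then have "1 / q ^ k = p k powr \<epsilon>" by (simp add: powr_minus_divide)
      then show "(1 / q) ^ k = p k powr \<epsilon>" by (simp add: power_one_over)
    qed
    define H where "H x = (\<integral>\<^sup>+u\<in>cball 0 1. ennreal ((f (x + (\<kappa> * ?d x) *\<^sub>R u))\<^sup>2) \<partial>lborel)" for x
    define a where "a k t = B0 * (p k powr \<epsilon> * (t powr (\<delta> - 2) * (p k * t) powr (2 - D)))" for k t
    define S where "S k = {z::'a \<times> 'a. \<kappa> * p k * ?d (fst z) \<le> ?d (snd z) \<and> ?d (snd z) \<le> 2 * p k * ?d (fst z) \<and>
       dist (fst z) (snd z) \<le> 2 * p k * ?d (fst z) \<and> \<kappa> * p k * ?d (fst z) \<le> r}" for k
    have S [measurable]: "S k \<in> sets (borel \<Otimes>\<^sub>M borel)" for k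
      unfolding S_def borel_prod by (intro borel_closed closed_infdist_kernel_set)
    define J where "J k x y = ennreal (a k (?d x)) * indicator (S k) (x, y) * indicator {0<..} (?d x)" for k x y
    have J_meas [measurable]: "(\<lambda>(x, y). J k x y) \<in> borel_measurable (borel \<Otimes>\<^sub>M borel)" for k
      unfolding J_def a_def by measurable
    have kernel: "ennreal (?d x powr (\<delta> - 2)) * H x \<le> (\<Sum>k. \<integral>\<^sup>+y. F y * J k x y \<partial>lborel)" if x: "x \<in> \<Omega>" for x
    proof -
      have dx: "0 < ?d x" using \<Omega>[OF x] by simp
      obtain y \<gamma> l where \<gamma>: "uniform_curve \<Gamma> \<sigma> x y \<gamma> l" "\<rho>0 \<le> dist x y" using far[OF x] by blast
      have "4 * r / \<kappa> \<le> \<rho>0" using r \<kappa> by (simp add: r0_def field_simps)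
      then have "4 * r / \<kappa> \<le> dist x y" using \<gamma>(2) by simp
      from outward_chain_le[OF fF q \<gamma>(1) \<sigma> dx r(1) f0[rule_format] \<kappa>_def this]
      have H: "H x \<le> ennreal (1 / (1 - q)) * (\<Sum>k. ennreal ((1/q) ^ k * ((2 * \<kappa> * (p k * ?d x))\<^sup>2 * (\<kappa> * (p k * ?d x)) powr - D)) *
        (\<integral>\<^sup>+z. F z * indicator (S k) (x, z) \<partial>lborel))"
        unfolding H_def by (simp add: Let_def p_def[symmetric] D_def S_def indicator_def mult.assoc)
      have coeff: "?d x powr (\<delta> - 2) * (1 / (1 - q) * ((1/q) ^ k * ((2 * \<kappa> * (p k * ?d x))\<^sup>2 * (\<kappa> * (p k * ?d x)) powr - D))) = a k (?d x)" for k
      proof -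
        have "(p k * ?d x) powr (2 - D) = (p k * ?d x)\<^sup>2 * (p k * ?d x) powr - D"
          using dx p0[of k] by (simp add: powr_diff powr_minus divide_inverse powr_numeral)
        moreover have "(\<kappa> * (p k * ?d x)) powr - D = \<kappa> powr - D * (p k * ?d x) powr - D"
          by (rule powr_mult)
        ultimately show ?thesis by (simp add: a_def B0_def qp power_mult_distrib)
      qed
      have "ennreal (?d x powr (\<delta> - 2)) * H x \<le> ennreal (?d x powr (\<delta> - 2)) *
         (ennreal (1 / (1 - q)) * (\<Sum>k. ennreal ((1/q) ^ k * ((2 * \<kappa> * (p k * ?d x))\<^sup>2 * (\<kappa> * (p k * ?d x)) powr - D)) *
        (\<integral>\<^sup>+z. F z * indicator (S k) (x, z) \<partial>lborel)))"
        using H by (rule mult_left_mono) simp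
      also have "\<dots> = (\<Sum>k. ennreal (a k (?d x)) * (\<integral>\<^sup>+z. F z * indicator (S k) (x, z) \<partial>lborel))"
        unfolding coeff[symmetric] ennreal_suminf_cmult[symmetric]
        using q by (subst ennreal_mult'', simp)+ (simp add: mult.assoc)
      also have "\<dots> = (\<Sum>k. \<integral>\<^sup>+y. F y * J k x y \<partial>lborel)"
        using dx by (subst nn_integral_cmult[symmetric]) (auto simp: J_def ac_simps)
      finally show ?thesis .
    qed
    have J_le: "(\<integral>\<^sup>+x. J k x y \<partial>lborel) \<le> ennreal (B * q ^ k) * ennreal (?d y powr \<delta>)" for k y
    proof (cases "0 < ?d y \<and> ?d y \<le> 2 * r / \<kappa>")
      case False
      have "J k x y = 0" for x
      proof -
        have False if "(x, y) \<in> S k" "0 < ?d x"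
        proof -
          have 1: "\<kappa> * (p k * ?d x) \<le> ?d y" "?d y \<le> 2 * (p k * ?d x)" "\<kappa> * (p k * ?d x) \<le> r"
            using that by (auto simp: S_def mult.assoc)
          have "0 < \<kappa> * (p k * ?d x)" using \<kappa> p0 that by simp
          moreover have "p k * ?d x \<le> r / \<kappa>" using 1(3) \<kappa> by (simp add: field_simps)
          ultimately show False using 1 False by simp
        qed
        then show ?thesis by (auto simp: J_def indicator_def)
      qed
      then show ?thesis by simp
    next
      case True
      define v where "v = ?d y"
      have v: "0 < v" "v \<le> 2 * r / \<kappa>" using True by (auto simp: v_def)
      obtain z where z: "z \<in> \<Gamma>" "v = dist y z"
        using infdist_attains_inf[OF cl \<open>\<Gamma> \<noteq> {}\<close>, of y] by (auto simp: v_def)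
      \<comment> \<open>If the kernel does not vanish at \<open>x\<close>, its lower bound for
        \<open>v\<close> puts \<open>x\<close> within \<open>\<rho>\<close> of
        \<open>\<Gamma>\<close>, and \<open>x\<close> has distance at most \<open>T\<close> from
        \<open>y\<close>, hence at most \<open>2 * T\<close> from the nearest boundary point
        \<open>z\<close> of \<open>y\<close>.\<close>
      define \<rho> where "\<rho> = v / (\<kappa> * p k)"
      define T where "T = 2 * v / \<kappa>"
      have \<rho>: "0 < \<rho>" using v \<kappa> p0[of k] by (simp add: \<rho>_def)
      have "\<kappa> * 1 \<le> \<kappa> * p k" using \<kappa> p[of k] by (intro mult_left_mono) auto
      then have "\<rho> \<le> v / \<kappa>" unfolding \<rho>_def using v \<kappa> by (intro divide_left_mono) auto
      then have \<rho>T: "\<rho> \<le> T" using v \<kappa> by (simp add: T_def field_simps)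
      have TR: "4 * T \<le> R"
      proof -
        have "v * \<kappa> \<le> 2 * r" using v \<kappa> by (simp add: field_simps)
        also have "\<dots> \<le> \<kappa>\<^sup>2 * R / 8" using r by (simp add: r0_def)
        finally have "v \<le> \<kappa> * R / 8" using \<kappa> by (simp add: power2_eq_square field_simps)
        then show ?thesis using \<kappa> by (simp add: T_def field_simps)
      qed
      have vT: "v \<le> T / 24"
      proof -
        have "\<kappa> * v \<le> 1/12 * v" using \<kappa> v by (intro mult_right_mono) auto
        then show ?thesis using \<kappa> by (simp add: T_def field_simps)
      qed
      define b where "b = B1 * (p k powr \<epsilon> * (p k powr (2 - \<delta>) * v powr (\<delta> - D)))"
      have b: "b \<ge> 0" using B1 by (simp add: b_def)
      let ?N = "{x. dist z x \<le> 2 * T \<and> ?d x \<le> \<rho>}"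
      have "J k x y \<le> ennreal b * indicator ?N x" for x
      proof (cases "(x, y) \<in> S k \<and> 0 < ?d x")
        case xy: True
        then have 1: "\<kappa> * (p k * ?d x) \<le> v" "v \<le> 2 * (p k * ?d x)" "dist x y \<le> 2 * (p k * ?d x)"
          by (auto simp: S_def v_def mult.assoc)
        have pd: "p k * ?d x \<le> c * v" using 1(1) \<kappa> by (simp add: c_def field_simps)
        have 2: "v \<le> c * (p k * ?d x)"
        proof -
          have "2 * (p k * ?d x) \<le> c * (p k * ?d x)" using c p0[of k] xy by (intro mult_right_mono) auto
          then show ?thesis using 1(2) by simp
        qed
        have "a k (?d x) \<le> B0 * (p k powr \<epsilon> * (c powr (\<bar>\<delta> - 2\<bar> + \<bar>2 - D\<bar>) * (p k powr - (\<delta> - 2) * v powr ((\<delta> - 2) + (2 - D)))))"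
          unfolding a_def using xy p0 v c pd 2 B0
          by (intro mult_left_mono powr_product_le_of_comparable) auto
        also have "\<dots> = b" by (simp add: b_def B1_def)
        finally have ab: "a k (?d x) \<le> b" .
        have "?d x \<le> \<rho>" using 1(1) \<kappa> p0[of k] by (simp add: \<rho>_def field_simps)
        moreover have "dist z x \<le> 2 * T"
        proof -
          have "dist x y \<le> T" using 1(3) pd by (simp add: T_def c_def)
          moreover have "dist z x \<le> dist y z + dist x y"
            using dist_triangle[of z x y] by (simp add: dist_commute)
          ultimately show ?thesis using z(2) vT v(1) by linarith
        qed
        ultimately show ?thesis using ab by (simp add: J_def ennreal_leI indicator_def)
      qed (auto simp: J_def)
      then have "(\<integral>\<^sup>+x. J k x y \<partial>lborel) \<le> (\<integral>\<^sup>+x. ennreal b * indicator ?N x \<partial>lborel)"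
        by (intro nn_integral_mono)
      also have "\<dots> = ennreal b * emeasure lborel ?N"
      proof (rule nn_integral_cmult_indicator)
        have "?N \<in> sets borel"
          by (intro borel_closed closed_Collect_conj closed_Collect_le continuous_intros)
        then show "?N \<in> sets lborel" by simp
      qed
      also have "\<dots> \<le> ennreal b * ennreal (V * \<rho> powr (D - s) * T powr s)"
        using emeasure_boundary_neighbourhood_le[OF reg cl z(1) \<rho> \<rho>T TR]
        by (intro mult_left_mono) (auto simp: V_def D_def)
      also have "\<dots> = ennreal (b * (V * \<rho> powr (D - s) * T powr s))"
        using b V by (simp add: ennreal_mult)
      also have "b * (V * \<rho> powr (D - s) * T powr s) = B * q ^ k * v powr \<delta>"
      proof -
        have "\<rho> powr (D - s) = v powr (D - s) * \<kappa> powr (s - D) * p k powr (s - D)"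
        proof -
          have "\<kappa> powr (s - D) = 1 / \<kappa> powr (D - s)" "p k powr (s - D) = 1 / p k powr (D - s)"
            using powr_minus_divide[of \<kappa> "D - s"] powr_minus_divide[of "p k" "D - s"] by simp_all
          then show ?thesis by (simp add: \<rho>_def powr_divide powr_mult)
        qed
        moreover have "T powr s = 2 powr s * v powr s * \<kappa> powr - s"
          using v \<kappa> by (simp add: T_def powr_divide powr_mult powr_minus_divide)
        moreover have "v powr (D - s) * v powr s * v powr (\<delta> - D) = v powr \<delta>"
          by (simp only: powr_add[symmetric]) simp
        moreover have "\<kappa> powr (s - D) * \<kappa> powr - s = \<kappa> powr - D"
          by (simp only: powr_add[symmetric]) simp
        \<comment> \<open>The exponent \<open>2 - \<delta>\<close> comes from expressing
          \<open>?d x\<close> through \<open>v\<close>, and \<open>s - D\<close> from the volume of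
          the thin neighbourhood. Their sum is minus twice \<open>\<epsilon>\<close>, of which the
          Cauchy-Schwarz weight takes back one.\<close>
        moreover have "p k powr \<epsilon> * p k powr (2 - \<delta>) * p k powr (s - D) = q ^ k"
        proof -
          have "p k powr \<epsilon> * p k powr (2 - \<delta>) * p k powr (s - D) = p k powr (\<epsilon> + (2 - \<delta>) + (s - D))"
            by (simp only: powr_add)
          also have "\<epsilon> + (2 - \<delta>) + (s - D) = - \<epsilon>" by (simp add: \<epsilon>_def field_simps)
          finally show ?thesis by (simp only: qp)
        qed
        moreover have "b * (V * (v powr (D - s) * \<kappa> powr (s - D) * p k powr (s - D)) * (2 powr s * v powr s * \<kappa> powr - s))
          = B1 * (V * ((\<kappa> powr (s - D) * \<kappa> powr - s) * 2 powr s)) * (p k powr \<epsilon> * p k powr (2 - \<delta>) * p k powr (s - D)) *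
            (v powr (D - s) * v powr s * v powr (\<delta> - D))"
          by (simp only: b_def ac_simps)
        ultimately show ?thesis by (simp only: B_def)
      qed
      also have "ennreal (B * q ^ k * v powr \<delta>) = ennreal (B * q ^ k) * ennreal (?d y powr \<delta>)"
        using B q by (simp add: ennreal_mult v_def)
      finally show ?thesis .
    qed
    have "(\<integral>\<^sup>+x\<in>\<Omega>. ennreal (?d x powr (\<delta> - 2)) * ennreal ((f x)\<^sup>2) \<partial>lborel)
       \<le> ennreal E * (\<integral>\<^sup>+x\<in>\<Omega>. ennreal (?d x powr (\<delta> - 2)) * H x \<partial>lborel)"
      unfolding H_def E_def D_def using \<kappa>
      by (intro weighted_nn_integral_le_averages \<open>open \<Omega>\<close> \<Omega>) auto
    also have "\<dots> \<le> ennreal E * (ennreal (B / (1 - q)) * (\<integral>\<^sup>+y. F y * ennreal (?d y powr \<delta>) \<partial>lborel))"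
      by (intro mult_left_mono nn_integral_kernel_series_le[where J=J] J_meas kernel J_le B less_imp_le[OF q(1)] q(2)) auto
    also have "\<dots> = ennreal A * (\<integral>\<^sup>+y. F y * ennreal (?d y powr \<delta>) \<partial>lborel)"
      by (simp only: A_def ennreal_mult'[OF E] mult.assoc)
    finally show ?thesis .
  qed
  moreover have "A \<ge> 0" using E B q by (simp add: A_def)
  ultimately show ?thesis using r0 by blast
qed

text \<open>For the exchange of the average over endpoints, taken with the whole of
  \<open>M\<close>, with the Lebesgue integral.\<close>

lemma uniformly_ball_regular_sigma_finite:
  fixes \<Gamma> :: "'a::euclidean_space set"
  assumes reg: "uniformly_ball_regular M \<Gamma> C R s" and cl: "closed \<Gamma>"
  shows "sigma_finite_measure M"
proof
  note r = uniformly_ball_regularD[OF reg]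
  have sp: "space M = UNIV" using sets_eq_imp_space_eq[OF r(1)] by simp
  show "\<exists>A. countable A \<and> A \<subseteq> sets M \<and> \<Union>A = space M \<and> (\<forall>a\<in>A. emeasure M a \<noteq> \<infinity>)"
  proof (intro exI[of _ "range (\<lambda>n. cball 0 (real n))"] conjI ballI)
    have "\<exists>n. x \<in> cball 0 (real n)" for x :: 'a
      using real_arch_simple[of "norm x"] by auto
    then show "\<Union> (range (\<lambda>n. cball 0 (real n))) = space M" unfolding sp by blast
    fix a assume "a \<in> range (\<lambda>n. cball (0::'a) (real n))"
    then show "emeasure M a \<noteq> \<infinity>"
      using uniformly_ball_regular_bounded_finite[OF reg cl] by (metis (no_types) imageE less_irrefl)
  qed (auto simp: r(1))
qed

text \<open>Here the chain is averaged over its endpoint \<open>w\<close> with respect to \<open>M\<close>, which gains the factor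
  \<open>p k powr s\<close> at scale \<open>k\<close>.\<close>

lemma thick_hardy:
  fixes \<Gamma> \<Omega> :: "'a::euclidean_space set"
  assumes reg: "uniformly_ball_regular M \<Gamma> C R s" and cl: "closed \<Gamma>" and "\<Gamma> \<noteq> {}" and "open \<Omega>"
    and \<Omega>: "\<And>y. y \<in> \<Omega> \<Longrightarrow> 0 < infdist y \<Gamma> \<and> ball y (infdist y \<Gamma>) \<subseteq> \<Omega>"
    and \<sigma>: "1 \<le> \<sigma>" and \<Gamma>\<Omega>: "\<Gamma> \<subseteq> closure \<Omega>"
    and curves: "\<And>x y. x \<in> \<Omega> \<Longrightarrow> y \<in> \<Omega> \<Longrightarrow> \<exists>\<gamma> l. uniform_curve \<Gamma> \<sigma> x y \<gamma> l"
    and thick: "real DIM('a) - 2 + \<delta> < s"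
  shows "\<exists>r0>0. \<exists>A\<ge>0. \<forall>r f F. 0 < r \<and> r < r0 \<and> sq_upper_gradient f F \<and> (\<forall>p. r \<le> infdist p \<Gamma> \<longrightarrow> f p = 0) \<and>
     (\<exists>\<eta>>0. \<forall>p. infdist p \<Gamma> \<le> \<eta> \<longrightarrow> f p = 0) \<longrightarrow>
     (\<integral>\<^sup>+x\<in>\<Omega>. ennreal (infdist x \<Gamma> powr (\<delta> - 2)) * ennreal ((f x)\<^sup>2) \<partial>lborel)
       \<le> ennreal A * (\<integral>\<^sup>+y. F y * ennreal (infdist y \<Gamma> powr \<delta>) \<partial>lborel)"
proof -
  let ?d = "\<lambda>x. infdist x \<Gamma>"
  note regD = uniformly_ball_regularD[OF reg]
  have sM [measurable_cong]: "sets M = sets borel" by (rule regD(1))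
  interpret M: sigma_finite_measure M by (rule uniformly_ball_regular_sigma_finite[OF reg cl])
  interpret Mlborel: pair_sigma_finite M lborel ..
  define D where "D = real DIM('a)"
  define \<kappa> where "\<kappa> = 1 / (12 * \<sigma>)"
  define \<mu> where "\<mu> = 1 - \<kappa> / (3 * \<sigma>)"
  define c where "c = 12 * \<sigma>"
  define \<epsilon> where "\<epsilon> = (s - (D - 2 + \<delta>)) / 2"
  define q where "q = \<mu> powr \<epsilon>"
  have \<kappa>: "0 < \<kappa>" "\<kappa> \<le> 1/12" using \<sigma> by (auto simp: \<kappa>_def field_simps)
  have \<mu>: "0 < \<mu>" "\<mu> < 1"
  proof -
    have "\<kappa> / (3 * \<sigma>) \<le> \<kappa> / 3" using \<kappa> \<sigma> by (intro divide_left_mono) auto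
    moreover have "0 < \<kappa> / (3 * \<sigma>)" using \<kappa> \<sigma> by simp
    ultimately show "0 < \<mu>" "\<mu> < 1" using \<kappa> by (auto simp: \<mu>_def)
  qed
  have c: "12 \<le> c" "\<kappa> * c = 1" "c = 1 / \<kappa>" using \<sigma> by (auto simp: c_def \<kappa>_def)
  have \<epsilon>: "0 < \<epsilon>" using thick by (simp add: \<epsilon>_def D_def)
  have q: "0 < q" "q < 1"
    using \<mu> \<epsilon> powr_less_mono2[of \<epsilon> \<mu> 1] by (auto simp: q_def)
  have C: "C > 1" and R: "R > 0" using regD by auto
  \<comment> \<open>Only points \<open>x\<close> at distance \<open>t < 2 * r\<close> contribute,
    and for them the boundary balls of radius \<open>10 * \<sigma> * t\<close> must still be
    regular.\<close>
  define r0 where "r0 = R / (20 * \<sigma>)"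
  have r0: "r0 > 0" using \<sigma> R by (simp add: r0_def)
  \<comment> \<open>One factor \<open>C\<close> stems from dividing by the mass of the ball of
    endpoints, the other from the mass of those endpoints that see a given point; the latter ball
    has radius \<open>10 * \<sigma> * (p k * t)\<close>.\<close>
  define B0 where "B0 = C\<^sup>2 * (1 / (1 - q)) * (4 * \<kappa>\<^sup>2 * (\<kappa> / 2) powr - D) * (10 * \<sigma>) powr s"
  have B0: "B0 \<ge> 0" using q by (simp add: B0_def)
  define B1 where "B1 = B0 * c powr (\<bar>\<delta> - 2 - s\<bar> + \<bar>2 - D + s\<bar>)"
  have B1: "B1 \<ge> 0" using B0 by (simp add: B1_def)
  define V where "V = unit_ball_vol D * (7 * \<sigma> / \<kappa>) powr D"
  have V: "V \<ge> 0" by (simp add: V_def D_def)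
  define B where "B = B1 * V"
  have B: "B \<ge> 0" using B1 V by (simp add: B_def)
  define E where "E = 2 powr \<bar>\<delta> - 2 - D\<bar> * 2 ^ DIM('a) / unit_ball_vol D"
  have E: "E \<ge> 0" by (simp add: E_def D_def)
  define A where "A = E * (B / (1 - q))"
  have "(\<integral>\<^sup>+x\<in>\<Omega>. ennreal (?d x powr (\<delta> - 2)) * ennreal ((f x)\<^sup>2) \<partial>lborel)
       \<le> ennreal A * (\<integral>\<^sup>+y. F y * ennreal (?d y powr \<delta>) \<partial>lborel)"
    if r: "0 < r" "r < r0" and fF: "sq_upper_gradient f F" and f0: "\<forall>p. r \<le> ?d p \<longrightarrow> f p = 0"
      and f\<eta>: "\<exists>\<eta>>0. \<forall>p. ?d p \<le> \<eta> \<longrightarrow> f p = 0" for r f F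
  proof -
    note [measurable] = sq_upper_gradient_measurable[OF fF]
    obtain \<eta> where \<eta>: "0 < \<eta>" "\<And>p. ?d p \<le> \<eta> \<Longrightarrow> f p = 0" using f\<eta> by blast
    have [measurable]: "?d \<in> borel_measurable borel"
      by (intro borel_measurable_continuous_onI continuous_intros)
    define p where "p k = \<mu> ^ k" for k :: nat
    have p0: "0 < p k" for k using \<mu> by (simp add: p_def)
    have p1: "p k \<le> 1" for k using \<mu> by (simp add: p_def power_le_one)
    have qp: "q ^ k = p k powr \<epsilon>" "(1 / q) ^ k = p k powr - \<epsilon>" for k
    proof -
      show "q ^ k = p k powr \<epsilon>" unfolding q_def p_def using \<mu> by (intro power_powr_swap) auto
      then have "1 / q ^ k = p k powr - \<epsilon>" by (simp add: powr_minus_divide)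
      then show "(1 / q) ^ k = p k powr - \<epsilon>" by (simp add: power_one_over)
    qed
    define H where "H x = (\<integral>\<^sup>+u\<in>cball 0 1. ennreal ((f (x + (\<kappa> * ?d x) *\<^sub>R u))\<^sup>2) \<partial>lborel)" for x
    define a where "a k t = B0 * (p k powr - \<epsilon> * (t powr (\<delta> - 2 - s) * (p k * t) powr (2 - D + s)))" for k t
    define S where "S k = {z::'a \<times> 'a. \<kappa> * p k * ?d (fst z) \<le> ?d (snd z) \<and> ?d (snd z) \<le> 5 * \<sigma> * p k * ?d (fst z) \<and>
       dist (fst z) (snd z) \<le> 7 * \<sigma> * ?d (fst z) \<and> \<kappa> * p k * ?d (fst z) \<le> \<kappa> * p k * (2 * r)}" for k
    have S [measurable]: "S k \<in> sets (borel \<Otimes>\<^sub>M borel)" for k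
      unfolding S_def borel_prod by (intro borel_closed closed_infdist_kernel_set)
    define J where "J k x y = ennreal (a k (?d x)) * indicator (S k) (x, y) * indicator {0<..} (?d x)" for k x y
    have J_meas [measurable]: "(\<lambda>(x, y). J k x y) \<in> borel_measurable (borel \<Otimes>\<^sub>M borel)" for k
      unfolding J_def a_def by measurable
    have kernel: "ennreal (?d x powr (\<delta> - 2)) * H x \<le> (\<Sum>k. \<integral>\<^sup>+y. F y * J k x y \<partial>lborel)" if x: "x \<in> \<Omega>" for x
    proof (cases "?d x < 2 * r")
      case False
      \<comment> \<open>The averaging ball of such an \<open>x\<close> lies entirely at distance at
        least \<open>r\<close> from the boundary, where \<open>f\<close> vanishes.\<close>
      have "f (x + (\<kappa> * ?d x) *\<^sub>R u) = 0" if "u \<in> cball 0 1" for u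
      proof -
        have dx: "0 < ?d x" using \<Omega>[OF x] by simp
        have "dist x (x + (\<kappa> * ?d x) *\<^sub>R u) \<le> \<kappa> * ?d x"
          using that \<kappa> dx by (simp add: dist_norm mult_left_le)
        also have "\<dots> \<le> 1/12 * ?d x" using \<kappa> dx by (intro mult_right_mono) auto
        finally have "r \<le> ?d (x + (\<kappa> * ?d x) *\<^sub>R u)"
          using infdist_triangle[of x \<Gamma> "x + (\<kappa> * ?d x) *\<^sub>R u"] False dx by simp
        then show ?thesis using f0 by blast
      qed
      then have "H x = integral\<^sup>N lborel (\<lambda>u::'a. 0)"
        unfolding H_def by (intro nn_integral_cong) (auto simp: indicator_def)
      then show ?thesis by simp
    next
      case near: True
      define t where "t = ?d x"
      have t: "0 < t" "t < 2 * r" using \<Omega>[OF x] near by (auto simp: t_def)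
      have "20 * \<sigma> * r \<le> R" using r \<sigma> by (simp add: r0_def field_simps)
      moreover have "10 * \<sigma> * t \<le> 10 * \<sigma> * (2 * r)" using t \<sigma> by (intro mult_left_mono) auto
      ultimately have t10: "10 * \<sigma> * t \<le> R" by simp
      moreover have "1 * t \<le> 10 * \<sigma> * t" using \<sigma> t by (intro mult_right_mono) auto
      ultimately have tR: "t \<le> R" by simp
      obtain z0 where z0: "z0 \<in> \<Gamma>" "t = dist x z0"
        using infdist_attains_inf[OF cl \<open>\<Gamma> \<noteq> {}\<close>, of x] by (auto simp: t_def)
      define b where "b k = (1/q) ^ k * ((2 * \<kappa> * (p k * t))\<^sup>2 * (\<kappa> * (p k * t) / 2) powr - D)" for k
      have b: "b k \<ge> 0" for k using q by (simp add: b_def)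
      define I where "I k w z = (indicator {y. dist y w \<le> 5 * \<sigma> * (p k * t)} z :: ennreal)" for k and w z :: 'a
      have I_meas [measurable]: "(\<lambda>(w, z). I k w z) \<in> borel_measurable (borel \<Otimes>\<^sub>M borel)" for k
      proof -
        have [measurable]: "{z::'a\<times>'a. dist (snd z) (fst z) \<le> 5 * \<sigma> * (p k * t)} \<in> sets (borel \<Otimes>\<^sub>M borel)"
          unfolding borel_prod by (intro borel_closed closed_Collect_le continuous_intros)
        have "(\<lambda>(w, z). I k w z) = indicator {z::'a\<times>'a. dist (snd z) (fst z) \<le> 5 * \<sigma> * (p k * t)}"
          by (auto simp: I_def indicator_def fun_eq_iff)
        then show ?thesis by simp
      qed
      \<comment> \<open>\<open>H x\<close> does not depend on the endpoint \<open>w\<close>. All of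
        \<open>cball z0 t\<close> is within \<open>2 * t\<close> of \<open>x\<close>, as the inward
        chain demands, and has mass at least \<open>t powr s / C\<close>.\<close>
      have "H x * ennreal (t powr s / C) \<le>
          (\<integral>\<^sup>+w. ennreal (1 / (1 - q)) * (\<Sum>k. ennreal (b k) * (\<integral>\<^sup>+z. F z * indicator (S k) (x, z) * I k w z \<partial>lborel)) \<partial>M)"
      proof (rule nn_integral_ball_regular_ge[OF reg cl z0(1) t(1) tR])
        fix w assume w: "w \<in> \<Gamma>" "w \<in> cball z0 t"
        have xw: "dist x w \<le> 2 * ?d x" using w z0 dist_triangle[of x w z0] by (simp add: t_def[symmetric])
        have dx: "0 < ?d x" using t by (simp add: t_def)
        from inward_chain_le[OF fF q curves[OF x] \<sigma> dx \<eta> w(1) _ xw \<kappa>_def \<mu>_def] w(1) \<Gamma>\<Omega>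
        have "H x \<le> ennreal (1 / (1 - q)) * (\<Sum>k. ennreal (b k) *
          (\<integral>\<^sup>+z\<in>{z. \<kappa> * (p k * t) \<le> ?d z \<and> ?d z \<le> 5 * \<sigma> * (p k * t) \<and> dist z w \<le> 5 * \<sigma> * (p k * t) \<and> dist x z \<le> 7 * \<sigma> * t}. F z \<partial>lborel))"
          unfolding H_def by (auto simp add: Let_def p_def[symmetric] D_def b_def t_def)
        also have "\<dots> \<le> ennreal (1 / (1 - q)) * (\<Sum>k. ennreal (b k) * (\<integral>\<^sup>+z. F z * indicator (S k) (x, z) * I k w z \<partial>lborel))"
        proof (intro mult_left_mono suminf_le nn_integral_mono)
          fix k z
          have "\<kappa> * p k * t \<le> \<kappa> * p k * (2 * r)" using \<kappa> p0[of k] t by (intro mult_left_mono) auto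
          then show "F z * indicator {z. \<kappa> * (p k * t) \<le> ?d z \<and> ?d z \<le> 5 * \<sigma> * (p k * t) \<and> dist z w \<le> 5 * \<sigma> * (p k * t) \<and> dist x z \<le> 7 * \<sigma> * t} z
            \<le> F z * indicator (S k) (x, z) * I k w z"
            by (simp add: S_def I_def t_def mult.assoc indicator_def)
        qed auto
        finally show "H x \<le> \<dots>" .
      qed
      also have "\<dots> = ennreal (1 / (1 - q)) * (\<Sum>k. ennreal (b k) * (\<integral>\<^sup>+w. (\<integral>\<^sup>+z. F z * indicator (S k) (x, z) * I k w z \<partial>lborel) \<partial>M))"
        by (simp add: nn_integral_cmult nn_integral_suminf)
      also have "\<dots> \<le> ennreal (1 / (1 - q)) * (\<Sum>k. ennreal (b k) * (ennreal (C * (10 * \<sigma> * (p k * t)) powr s) * (\<integral>\<^sup>+z. F z * indicator (S k) (x, z) \<partial>lborel)))"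
      proof (intro mult_left_mono suminf_le)
        fix k
        have "(\<integral>\<^sup>+w. (\<integral>\<^sup>+z. F z * indicator (S k) (x, z) * I k w z \<partial>lborel) \<partial>M)
          = (\<integral>\<^sup>+z. (\<integral>\<^sup>+w. F z * indicator (S k) (x, z) * I k w z \<partial>M) \<partial>lborel)"
          by (rule Mlborel.Fubini'[symmetric]) measurable
        also have "\<dots> \<le> (\<integral>\<^sup>+z. ennreal (C * (10 * \<sigma> * (p k * t)) powr s) * (F z * indicator (S k) (x, z)) \<partial>lborel)"
        proof (intro nn_integral_mono)
          fix z
          \<comment> \<open>Regularity concerns balls about boundary points only, so
            \<open>z\<close> is replaced by its nearest boundary point \<open>z'\<close>, which
            doubles the radius.\<close>
          have "(\<integral>\<^sup>+w. I k w z \<partial>M) \<le> ennreal (C * (10 * \<sigma> * (p k * t)) powr s)" if "(x, z) \<in> S k"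
          proof -
            have dz: "?d z \<le> 5 * \<sigma> * (p k * t)" using that by (simp add: S_def t_def mult.assoc)
            obtain z' where z': "z' \<in> \<Gamma>" "?d z = dist z z'"
              using infdist_attains_inf[OF cl \<open>\<Gamma> \<noteq> {}\<close>, of z] by auto
            have "(\<integral>\<^sup>+w. I k w z \<partial>M) \<le> (\<integral>\<^sup>+w. indicator (cball z' (10 * \<sigma> * (p k * t))) w \<partial>M)"
            proof (intro nn_integral_mono)
              fix w
              show "I k w z \<le> indicator (cball z' (10 * \<sigma> * (p k * t))) w"
                using dz z' dist_triangle[of z' w z] by (auto simp: I_def indicator_def dist_commute)
            qed
            also have "\<dots> = emeasure M (cball z' (10 * \<sigma> * (p k * t)))" by (simp add: sM)
            also have "\<dots> \<le> ennreal (C * (10 * \<sigma> * (p k * t)) powr s)"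
            proof (rule regD(7)[OF z'(1)])
              show "0 < 10 * \<sigma> * (p k * t)" using \<sigma> p0 t by simp
              have "10 * \<sigma> * (p k * t) \<le> 10 * \<sigma> * (1 * t)"
                using \<sigma> p1[of k] t by (intro mult_left_mono mult_right_mono) auto
              then show "10 * \<sigma> * (p k * t) \<le> R" using t10 by simp
            qed
            finally show ?thesis .
          qed
          moreover have "(\<integral>\<^sup>+w. F z * indicator (S k) (x, z) * I k w z \<partial>M) = F z * indicator (S k) (x, z) * (\<integral>\<^sup>+w. I k w z \<partial>M)"
            by (rule nn_integral_cmult) measurable
          ultimately show "(\<integral>\<^sup>+w. F z * indicator (S k) (x, z) * I k w z \<partial>M)
             \<le> ennreal (C * (10 * \<sigma> * (p k * t)) powr s) * (F z * indicator (S k) (x, z))"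
            by (cases "(x, z) \<in> S k") (auto simp: mult.commute intro: mult_left_mono)
        qed
        also have "\<dots> = ennreal (C * (10 * \<sigma> * (p k * t)) powr s) * (\<integral>\<^sup>+z. F z * indicator (S k) (x, z) \<partial>lborel)"
          by (rule nn_integral_cmult) measurable
        finally show "(\<integral>\<^sup>+w. (\<integral>\<^sup>+z. F z * indicator (S k) (x, z) * I k w z \<partial>lborel) \<partial>M) \<le> \<dots>" .
      qed auto
      finally have *: "H x * ennreal (t powr s / C) \<le> \<dots>" .
      have coeff: "C * t powr - s * t powr (\<delta> - 2) * (1 / (1 - q) * (b k * (C * (10 * \<sigma> * (p k * t)) powr s))) = a k t" for k
      proof -
        have "(p k * t) powr (2 - D + s) = (p k * t)\<^sup>2 * (p k * t) powr - D * (p k * t) powr s"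
          using t p0[of k] powr_add[of "p k * t" "2 - D" s] by (simp add: powr_diff powr_minus_divide powr_numeral)
        moreover have "(\<kappa> * (p k * t) / 2) powr - D = (\<kappa> / 2) powr - D * (p k * t) powr - D"
          using t p0[of k] \<kappa> powr_mult[of "\<kappa> / 2" "p k * t" "- D"] by simp
        moreover have "(10 * \<sigma> * (p k * t)) powr s = (10 * \<sigma>) powr s * (p k * t) powr s"
          by (rule powr_mult)
        moreover have "t powr (\<delta> - 2 - s) = t powr - s * t powr (\<delta> - 2)"
          by (simp only: powr_add[symmetric]) simp
        ultimately show ?thesis
          by (simp add: a_def B0_def b_def qp power_mult_distrib power2_eq_square)
      qed
      have one: "ennreal (C * t powr - s) * ennreal (t powr s / C) = 1"
        using C t by (simp add: powr_minus flip: ennreal_mult)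
      have "ennreal (C * t powr - s * t powr (\<delta> - 2)) = ennreal (C * t powr - s) * ennreal (t powr (\<delta> - 2))"
        using C by (intro ennreal_mult') auto
      then have "ennreal (C * t powr - s * t powr (\<delta> - 2)) * (H x * ennreal (t powr s / C))
          = (ennreal (C * t powr - s) * ennreal (t powr s / C)) * (ennreal (t powr (\<delta> - 2)) * H x)"
        by (simp only: ac_simps)
      then have "ennreal (t powr (\<delta> - 2)) * H x = ennreal (C * t powr - s * t powr (\<delta> - 2)) * (H x * ennreal (t powr s / C))"
        by (simp only: one mult_1)
      also have "\<dots> \<le> ennreal (C * t powr - s * t powr (\<delta> - 2)) *
         (ennreal (1 / (1 - q)) * (\<Sum>k. ennreal (b k) * (ennreal (C * (10 * \<sigma> * (p k * t)) powr s) * (\<integral>\<^sup>+z. F z * indicator (S k) (x, z) \<partial>lborel))))"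
        using * by (rule mult_left_mono) simp
      also have "\<dots> = (\<Sum>k. ennreal (a k t) * (\<integral>\<^sup>+z. F z * indicator (S k) (x, z) \<partial>lborel))"
      proof -
        have "ennreal (a k t) = ennreal (C * t powr - s * t powr (\<delta> - 2)) * (ennreal (1 / (1 - q)) * (ennreal (b k) * ennreal (C * (10 * \<sigma> * (p k * t)) powr s)))" for k
          unfolding coeff[symmetric] using C q b[of k] by (simp flip: ennreal_mult)
        then show ?thesis
          by (simp add: mult.assoc flip: ennreal_suminf_cmult)
      qed
      also have "\<dots> = (\<Sum>k. \<integral>\<^sup>+y. F y * J k x y \<partial>lborel)"
        using t unfolding t_def by (subst nn_integral_cmult[symmetric]) (auto simp: J_def ac_simps)
      finally show ?thesis by (simp only: t_def)
    qed
    have J_le: "(\<integral>\<^sup>+x. J k x y \<partial>lborel) \<le> ennreal (B * q ^ k) * ennreal (?d y powr \<delta>)" for k y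
    proof (cases "0 < ?d y")
      case False
      have "J k x y = 0" for x
      proof -
        have False if "(x, y) \<in> S k" "0 < ?d x"
        proof -
          have "0 < \<kappa> * p k * ?d x" using \<kappa> p0 that by simp
          then show False using that False by (simp add: S_def)
        qed
        then show ?thesis by (auto simp: J_def indicator_def)
      qed
      then show ?thesis by simp
    next
      case True
      define v where "v = ?d y"
      have v: "0 < v" using True by (simp add: v_def)
      \<comment> \<open>The kernel bounds \<open>?d x\<close> by \<open>v / (\<kappa> * p k)\<close>
        and the distance from \<open>x\<close> to \<open>y\<close> by \<open>7 * \<sigma>\<close>
        times that. The volume of this large ball is affordable because averaging over endpoints has
        put \<open>s\<close> into the exponents.\<close>
      define \<rho> where "\<rho> = 7 * \<sigma> / \<kappa> * (v / p k)"
      have \<rho>: "0 < \<rho>" using v \<kappa> p0[of k] \<sigma> by (simp add: \<rho>_def)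
      define b where "b = B1 * (p k powr - \<epsilon> * (p k powr - (\<delta> - 2 - s) * v powr (\<delta> - D)))"
      have b: "b \<ge> 0" using B1 by (simp add: b_def)
      have "J k x y \<le> ennreal b * indicator (cball y \<rho>) x" for x
      proof (cases "(x, y) \<in> S k \<and> 0 < ?d x")
        case xy: True
        then have 1: "\<kappa> * (p k * ?d x) \<le> v" "v \<le> 5 * \<sigma> * (p k * ?d x)" "dist x y \<le> 7 * \<sigma> * ?d x"
          by (auto simp: S_def v_def mult.assoc)
        have pd: "p k * ?d x \<le> c * v" using 1(1) \<kappa> by (simp add: c(3) field_simps)
        have 2: "v \<le> c * (p k * ?d x)"
        proof -
          have "5 * \<sigma> * (p k * ?d x) \<le> c * (p k * ?d x)"
            unfolding c_def using \<sigma> p0[of k] xy by (intro mult_right_mono) auto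
          then show ?thesis using 1(2) by simp
        qed
        have "a k (?d x) \<le> B0 * (p k powr - \<epsilon> * (c powr (\<bar>\<delta> - 2 - s\<bar> + \<bar>2 - D + s\<bar>) * (p k powr - (\<delta> - 2 - s) * v powr ((\<delta> - 2 - s) + (2 - D + s)))))"
          unfolding a_def using xy p0 v c pd 2 B0
          by (intro mult_left_mono powr_product_le_of_comparable) auto
        also have "\<dots> = b" by (simp add: b_def B1_def)
        finally have ab: "a k (?d x) \<le> b" .
        have "?d x \<le> 1 / \<kappa> * (v / p k)" using 1(1) \<kappa> p0[of k] by (simp add: field_simps)
        then have "7 * \<sigma> * ?d x \<le> 7 * \<sigma> * (1 / \<kappa> * (v / p k))" using \<sigma> by (intro mult_left_mono) auto
        then have "dist x y \<le> \<rho>" using 1(3) by (simp add: \<rho>_def)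
        then show ?thesis using ab by (simp add: J_def ennreal_leI indicator_def dist_commute)
      qed (auto simp: J_def)
      then have "(\<integral>\<^sup>+x. J k x y \<partial>lborel) \<le> (\<integral>\<^sup>+x. ennreal b * indicator (cball y \<rho>) x \<partial>lborel)"
        by (intro nn_integral_mono)
      also have "\<dots> = ennreal b * ennreal (unit_ball_vol D * \<rho> ^ DIM('a))"
        using \<rho> by (simp add: nn_integral_cmult_indicator emeasure_cball D_def)
      also have "\<dots> = ennreal (b * (unit_ball_vol D * \<rho> powr D))"
        using b \<rho> by (simp add: ennreal_mult D_def powr_realpow)
      also have "b * (unit_ball_vol D * \<rho> powr D) = B * q ^ k * v powr \<delta>"
      proof -
        have "\<rho> powr D = (7 * \<sigma> / \<kappa>) powr D * (v powr D * p k powr - D)"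
          using v \<kappa> \<sigma> p0[of k] unfolding \<rho>_def by (subst powr_mult) (auto simp: powr_divide powr_minus_divide)
        moreover have "v powr D * v powr (\<delta> - D) = v powr \<delta>"
          by (simp only: powr_add[symmetric]) simp
        \<comment> \<open>Since \<open>p k \<le> 1\<close>, positive exponents are gains here. Those
          from \<open>?d x\<close> and from the volume add up to twice \<open>\<epsilon>\<close>,
          and the Cauchy-Schwarz weight takes one back.\<close>
        moreover have "p k powr - \<epsilon> * p k powr - (\<delta> - 2 - s) * p k powr - D = q ^ k"
        proof -
          have "p k powr - \<epsilon> * p k powr - (\<delta> - 2 - s) * p k powr - D = p k powr (- \<epsilon> + - (\<delta> - 2 - s) + - D)"
            by (simp only: powr_add)
          also have "- \<epsilon> + - (\<delta> - 2 - s) + - D = \<epsilon>" by (simp add: \<epsilon>_def field_simps)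
          finally show ?thesis by (simp only: qp)
        qed
        moreover have "b * (unit_ball_vol D * ((7 * \<sigma> / \<kappa>) powr D * (v powr D * p k powr - D)))
          = B1 * (unit_ball_vol D * (7 * \<sigma> / \<kappa>) powr D) * (p k powr - \<epsilon> * p k powr - (\<delta> - 2 - s) * p k powr - D) *
            (v powr D * v powr (\<delta> - D))"
          by (simp only: b_def ac_simps)
        ultimately show ?thesis by (simp only: B_def V_def)
      qed
      also have "ennreal (B * q ^ k * v powr \<delta>) = ennreal (B * q ^ k) * ennreal (?d y powr \<delta>)"
        using B q by (simp add: ennreal_mult v_def)
      finally show ?thesis .
    qed
    have "(\<integral>\<^sup>+x\<in>\<Omega>. ennreal (?d x powr (\<delta> - 2)) * ennreal ((f x)\<^sup>2) \<partial>lborel)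
       \<le> ennreal E * (\<integral>\<^sup>+x\<in>\<Omega>. ennreal (?d x powr (\<delta> - 2)) * H x \<partial>lborel)"
      unfolding H_def E_def D_def using \<kappa>
      by (intro weighted_nn_integral_le_averages \<open>open \<Omega>\<close> \<Omega>) auto
    also have "\<dots> \<le> ennreal E * (ennreal (B / (1 - q)) * (\<integral>\<^sup>+y. F y * ennreal (?d y powr \<delta>) \<partial>lborel))"
      by (intro mult_left_mono nn_integral_kernel_series_le[where J=J] J_meas kernel J_le B less_imp_le[OF q(1)] q(2)) auto
    also have "\<dots> = ennreal A * (\<integral>\<^sup>+y. F y * ennreal (?d y powr \<delta>) \<partial>lborel)"
      by (simp only: A_def ennreal_mult'[OF E] mult.assoc)
    finally show ?thesis .
  qed
  moreover have "A \<ge> 0" using E B q by (simp add: A_def)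
  ultimately show ?thesis using r0 by blast
qed

section \<open>Compactly supported functions on a domain\<close>

lemma norm_frechet_derivative_le_gradient:
  fixes \<psi> :: "real^'n \<Rightarrow> complex"
  assumes "\<psi> differentiable (at x)"
  shows "norm (frechet_derivative \<psi> (at x) v) \<le> norm (gradient \<psi> x) * norm v"
proof -
  let ?D = "frechet_derivative \<psi> (at x)"
  have lin: "linear ?D" using assms by (rule linear_frechet_derivative)
  have "v = (\<Sum>i\<in>UNIV. (v $ i) *\<^sub>R axis i 1)"
    using basis_expansion[of v] by (simp add: scalar_mult_eq_scaleR)
  then have "?D v = (\<Sum>i\<in>UNIV. (v $ i) *\<^sub>R ?D (axis i 1))"
    using linear_sum[OF lin, of "\<lambda>i. (v $ i) *\<^sub>R axis i 1" UNIV] by (simp add: linear_scale[OF lin])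
  then have "norm (?D v) \<le> (\<Sum>i\<in>UNIV. \<bar>v $ i\<bar> * \<bar>norm (?D (axis i 1))\<bar>)"
    using norm_sum[of "\<lambda>i. (v $ i) *\<^sub>R ?D (axis i 1)" UNIV] by simp
  also have "\<dots> \<le> L2_set (\<lambda>i. v $ i) UNIV * L2_set (\<lambda>i. norm (?D (axis i 1))) UNIV"
    by (rule L2_set_mult_ineq)
  also have "\<dots> = norm (gradient \<psi> x) * norm v"
    by (simp add: norm_vec_def gradient_def L2_set_def)
  finally show ?thesis .
qed

text \<open>Integrate the square of the deviation of \<open>h\<close> from its mean, which is its
  integral because the interval has length 1.\<close>

lemma integral_square_le:
  fixes h :: "real \<Rightarrow> real"
  assumes "continuous_on {0..1} h"
  shows "(integral {0..1} h)\<^sup>2 \<le> integral {0..1} (\<lambda>s. (h s)\<^sup>2)"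
proof -
  define I where "I = integral {0..1} h"
  have h: "h integrable_on {0..1}" using assms by (rule integrable_continuous_interval)
  have h2: "(\<lambda>s. (h s)\<^sup>2) integrable_on {0..1}"
    using assms by (intro integrable_continuous_interval continuous_intros)
  have "((\<lambda>s. (h s)\<^sup>2 - 2 * I * h s + I\<^sup>2) has_integral
      (integral {0..1} (\<lambda>s. (h s)\<^sup>2) - 2 * I * I + I\<^sup>2)) {0..1}"
    using has_integral_const_real[of "I\<^sup>2" 0 1] h h2 unfolding I_def
    by (intro has_integral_add has_integral_diff has_integral_mult_right integrable_integral) auto
  moreover have "0 \<le> (h s)\<^sup>2 - 2 * I * h s + I\<^sup>2" for s
    using zero_le_power2[of "h s - I"] by (simp add: power2_diff ac_simps)
  ultimately have "0 \<le> integral {0..1} (\<lambda>s. (h s)\<^sup>2) - 2 * I * I + I\<^sup>2"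
    by (rule has_integral_nonneg)
  then show ?thesis by (simp add: I_def power2_eq_square)
qed

lemma norm_diff_sq_le_integral_gradient:
  fixes \<psi> :: "real^'n \<Rightarrow> complex"
  assumes d: "\<And>x. \<psi> differentiable (at x)" and cont: "continuous_on UNIV (gradient \<psi>)"
  shows "(norm (\<psi> q - \<psi> p))\<^sup>2 \<le> (dist p q)\<^sup>2 * integral {0..1} (\<lambda>s. (norm (gradient \<psi> (p + s *\<^sub>R (q - p))))\<^sup>2)"
proof -
  let ?c = "\<lambda>s. p + s *\<^sub>R (q - p)"
  define h where "h s = norm (gradient \<psi> (?c s))" for s
  have h: "continuous_on A h" for A
    unfolding h_def by (intro continuous_intros continuous_on_compose2[OF cont]) auto
  have vec: "((\<lambda>s. \<psi> (?c s)) has_vector_derivative frechet_derivative \<psi> (at (?c s)) (q - p)) (at s within {0..1})" for s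
  proof -
    have "(\<psi> has_derivative frechet_derivative \<psi> (at (?c s))) (at (?c s))"
      using d by (simp add: frechet_derivative_works)
    moreover have "(?c has_derivative (\<lambda>t. t *\<^sub>R (q - p))) (at s within {0..1})"
      by (auto intro!: derivative_eq_intros)
    ultimately have "((\<lambda>s. \<psi> (?c s)) has_derivative (\<lambda>t. frechet_derivative \<psi> (at (?c s)) (t *\<^sub>R (q - p)))) (at s within {0..1})"
      by (rule has_derivative_compose[rotated])
    moreover have "frechet_derivative \<psi> (at (?c s)) (t *\<^sub>R (q - p)) = t *\<^sub>R frechet_derivative \<psi> (at (?c s)) (q - p)" for t
      using linear_frechet_derivative[OF d] by (rule linear_scale)
    ultimately show ?thesis unfolding has_vector_derivative_def by simp
  qed
  have ftc: "((\<lambda>s. frechet_derivative \<psi> (at (?c s)) (q - p)) has_integral (\<psi> q - \<psi> p)) {0..1}"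
    using fundamental_theorem_of_calculus[of 0 1, OF _ vec] by simp
  have "norm (\<psi> q - \<psi> p) \<le> integral {0..1} (\<lambda>s. h s * dist p q)"
    unfolding integral_unique[OF ftc, symmetric]
  proof (rule integral_norm_bound_integral)
    show "(\<lambda>s. h s * dist p q) integrable_on {0..1}"
      by (intro integrable_continuous_interval continuous_intros h)
    show "norm (frechet_derivative \<psi> (at (?c s)) (q - p)) \<le> h s * dist p q" for s
      unfolding h_def dist_norm norm_minus_commute[of p q] by (rule norm_frechet_derivative_le_gradient[OF d])
  qed (use ftc in blast)
  also have "\<dots> = dist p q * integral {0..1} h" by simp
  finally have "(norm (\<psi> q - \<psi> p))\<^sup>2 \<le> (dist p q * integral {0..1} h)\<^sup>2"
    by (rule power_mono) simp
  also have "\<dots> \<le> (dist p q)\<^sup>2 * integral {0..1} (\<lambda>s. (h s)\<^sup>2)"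
    unfolding power_mult_distrib by (intro mult_left_mono integral_square_le h) simp
  finally show ?thesis by (simp add: h_def)
qed

text \<open>The modulus of \<open>\<psi>\<close> may fail to be differentiable at zeros of
  \<open>\<psi>\<close>, but its differences are dominated by those of \<open>\<psi>\<close>; this
  makes a condition on differences the suitable one.\<close>

lemma sq_upper_gradient_norm_gradient:
  fixes \<psi> :: "real^'n \<Rightarrow> complex"
  assumes d: "\<And>x. \<psi> differentiable (at x)" and cont: "continuous_on UNIV (gradient \<psi>)"
  shows "sq_upper_gradient (\<lambda>x. norm (\<psi> x)) (\<lambda>x. ennreal ((norm (gradient \<psi> x))\<^sup>2))"
  unfolding sq_upper_gradient_def
proof (intro conjI allI)
  have "continuous_on UNIV \<psi>"
    using d by (simp add: continuous_on_eq_continuous_at differentiable_imp_continuous_within)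
  then show "(\<lambda>x. norm (\<psi> x)) \<in> borel_measurable borel"
    by (intro borel_measurable_continuous_onI continuous_intros)
  show "(\<lambda>x. ennreal ((norm (gradient \<psi> x))\<^sup>2)) \<in> borel_measurable borel"
    by (intro measurable_compose[OF _ measurable_ennreal] borel_measurable_continuous_onI continuous_intros cont)
  fix p q
  let ?h = "\<lambda>s. (norm (gradient \<psi> (p + s *\<^sub>R (q - p))))\<^sup>2"
  have "continuous_on {0..1} ?h"
    by (intro continuous_intros continuous_on_compose2[OF cont]) auto
  then have "(?h has_integral integral {0..1} ?h) {0..1}"
    by (intro integrable_integral integrable_continuous_interval)
  then have "integral\<^sup>N lborel (\<lambda>s. ennreal (indicator {0..1} s * ?h s)) = ennreal (integral {0..1} ?h)"
    by (intro nn_integral_has_integral_lebesgue) auto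
  then have I: "(\<integral>\<^sup>+s\<in>{0..1}. ennreal (?h s) \<partial>lborel) = ennreal (integral {0..1} ?h)"
    by (simp add: ennreal_mult' ennreal_indicator mult.commute)
  have "(norm (\<psi> q) - norm (\<psi> p))\<^sup>2 \<le> (norm (\<psi> q - \<psi> p))\<^sup>2"
    using norm_triangle_ineq3[of "\<psi> q" "\<psi> p"] by (simp add: abs_le_square_iff[symmetric])
  also note norm_diff_sq_le_integral_gradient[OF assms]
  finally have "ennreal ((norm (\<psi> q) - norm (\<psi> p))\<^sup>2) \<le> ennreal ((dist p q)\<^sup>2 * integral {0..1} ?h)"
    by (rule ennreal_leI)
  then show "ennreal ((norm (\<psi> q) - norm (\<psi> p))\<^sup>2) \<le> ennreal ((dist p q)\<^sup>2) * (\<integral>\<^sup>+s\<in>{0..1}. ennreal (?h s) \<partial>lborel)"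
    unfolding I by (simp add: ennreal_mult')
qed

section \<open>Supports, distances to the frontier and L2 norms\<close>

lemma gradient_eq_0_outside_support:
  fixes \<psi> :: "real^'n \<Rightarrow> complex"
  assumes "x \<notin> closure {x. \<psi> x \<noteq> 0}"
  shows "gradient \<psi> x = 0"
proof -
  have "(\<psi> has_derivative (\<lambda>_. 0)) (at x)"
  proof (rule has_derivative_transform_within_open[of "\<lambda>_. 0"])
    show "open (- closure {x. \<psi> x \<noteq> 0})" by (rule open_Compl[OF closed_closure])
    show "0 = \<psi> y" if "y \<in> - closure {x. \<psi> x \<noteq> 0}" for y
      using that closure_subset[of "{x. \<psi> x \<noteq> 0}"] by auto
  qed (use assms in auto)
  then have "frechet_derivative \<psi> (at x) = (\<lambda>_. 0)"
    using frechet_derivative_at by metis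
  then show ?thesis by (simp add: gradient_def vec_eq_iff)
qed

text \<open>A ball is connected, so one that meets both \<open>S\<close> and its complement meets
  the frontier, at a distance smaller than the infimum.\<close>

lemma ball_infdist_frontier_subset:
  fixes S :: "'a::euclidean_space set"
  assumes "open S" "x \<in> S" "frontier S \<noteq> {}"
  shows "0 < infdist x (frontier S)" "ball x (infdist x (frontier S)) \<subseteq> S"
proof -
  have "x \<notin> frontier S" using assms by (auto simp: frontier_def interior_open)
  then show pos: "0 < infdist x (frontier S)"
    using assms(3) in_closed_iff_infdist_zero[OF frontier_closed, of S x] infdist_nonneg[of x "frontier S"] by force
  show "ball x (infdist x (frontier S)) \<subseteq> S"
  proof (rule ccontr)
    let ?B = "ball x (infdist x (frontier S))"
    assume "\<not> ?B \<subseteq> S"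
    then have "?B - S \<noteq> {}" by blast
    moreover have "x \<in> ?B" using pos by simp
    then have "?B \<inter> S \<noteq> {}" using assms(2) by blast
    ultimately have "?B \<inter> frontier S \<noteq> {}"
      using connected_Int_frontier[OF connected_ball] by blast
    then obtain w where w: "w \<in> frontier S" "dist x w < infdist x (frontier S)" by auto
    then show False using infdist_le[OF w(1), of x] by simp
  qed
qed

text \<open>No integrability is assumed: if the integral on the right is infinite, both sides are 0.
  Inequalities between extended integrals therefore pass to norms only once the larger side is known
  to be finite.\<close>

lemma L2_norm_on_eq_nn_integral:
  fixes \<Omega> :: "(real^'n) set" and g :: "real^'n \<Rightarrow> 'b::real_normed_vector"
  assumes [measurable]: "\<Omega> \<in> sets borel" "d \<in> borel_measurable borel" "(\<lambda>x. norm (g x)) \<in> borel_measurable borel"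
    and d: "\<And>x. x \<in> \<Omega> \<Longrightarrow> 0 < d x"
  shows "L2_norm_on \<Omega> (\<lambda>x. d x powr (e / 2) *\<^sub>R g x) =
    sqrt (enn2real (\<integral>\<^sup>+x\<in>\<Omega>. ennreal (d x powr e) * ennreal ((norm (g x))\<^sup>2) \<partial>lborel))"
proof -
  have eq: "indicator \<Omega> x *\<^sub>R (norm (d x powr (e / 2) *\<^sub>R g x))\<^sup>2 = indicator \<Omega> x * (d x powr e * (norm (g x))\<^sup>2)" for x
  proof (cases "x \<in> \<Omega>")
    case True
    have "(d x powr (e / 2))\<^sup>2 = d x powr e"
      using d[OF True] by (simp add: power2_eq_square flip: powr_add)
    then show ?thesis by (simp add: power_mult_distrib)
  qed simp
  have "(LINT x:\<Omega>|lborel. (norm (d x powr (e / 2) *\<^sub>R g x))\<^sup>2)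
    = enn2real (\<integral>\<^sup>+x. ennreal (indicator \<Omega> x * (d x powr e * (norm (g x))\<^sup>2)) \<partial>lborel)"
    unfolding set_lebesgue_integral_def eq by (rule integral_eq_nn_integral) auto
  also have "(\<integral>\<^sup>+x. ennreal (indicator \<Omega> x * (d x powr e * (norm (g x))\<^sup>2)) \<partial>lborel)
    = (\<integral>\<^sup>+x\<in>\<Omega>. ennreal (d x powr e) * ennreal ((norm (g x))\<^sup>2) \<partial>lborel)"
    by (intro nn_integral_cong) (auto simp: indicator_def ennreal_mult)
  finally show ?thesis by (simp add: L2_norm_on_def)
qed

lemma C1_compact_support_hardy:
  fixes \<Omega> :: "(real^'n) set" and \<psi> :: "real^'n \<Rightarrow> complex"
  assumes "open \<Omega>" "frontier \<Omega> \<noteq> {}" "0 \<le> \<delta>" "0 \<le> A"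
    and \<psi>: "\<psi> \<in> C1_compact_support (boundary_layer \<Omega> r)"
    and hardy: "(\<integral>\<^sup>+x\<in>\<Omega>. ennreal (infdist x (frontier \<Omega>) powr (\<delta> - 2)) * ennreal ((norm (\<psi> x))\<^sup>2) \<partial>lborel)
       \<le> ennreal A * (\<integral>\<^sup>+x. ennreal ((norm (gradient \<psi> x))\<^sup>2) * ennreal (infdist x (frontier \<Omega>) powr \<delta>) \<partial>lborel)"
  shows "L2_norm_on \<Omega> (\<lambda>x. infdist x (frontier \<Omega>) powr (\<delta>/2 - 1) *\<^sub>R \<psi> x)
           \<le> sqrt A * L2_norm_on \<Omega> (\<lambda>x. infdist x (frontier \<Omega>) powr (\<delta>/2) *\<^sub>R gradient \<psi> x)"
proof -
  let ?d = "\<lambda>x. infdist x (frontier \<Omega>)"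
  let ?K = "closure {x. \<psi> x \<noteq> 0}"
  have d\<psi>: "\<And>x. \<psi> differentiable (at x)" and cont: "continuous_on UNIV (gradient \<psi>)"
    and K: "compact ?K" and K_sub: "?K \<subseteq> boundary_layer \<Omega> r"
    using \<psi> by (auto simp: C1_compact_support_def)
  note ug = sq_upper_gradient_norm_gradient[OF d\<psi> cont]
  have meas [measurable]: "\<Omega> \<in> sets borel" "?d \<in> borel_measurable borel" "(\<lambda>x. norm (gradient \<psi> x)) \<in> borel_measurable borel"
    "(\<lambda>x. norm (\<psi> x)) \<in> borel_measurable borel"
    using \<open>open \<Omega>\<close> sq_upper_gradient_measurable[OF ug]
    by (auto intro!: borel_measurable_continuous_onI continuous_intros cont)
  have dpos: "0 < ?d x" if "x \<in> \<Omega>" for x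
    using ball_infdist_frontier_subset[OF assms(1) that assms(2)] by simp
  let ?G = "\<lambda>x. ennreal (?d x powr \<delta>) * ennreal ((norm (gradient \<psi> x))\<^sup>2)"
  define I where "I = (\<integral>\<^sup>+x\<in>\<Omega>. ?G x \<partial>lborel)"
  have G0: "?G x = 0" if "x \<notin> ?K" for x
    using gradient_eq_0_outside_support[OF that] by simp
  have "(\<integral>\<^sup>+x. ennreal ((norm (gradient \<psi> x))\<^sup>2) * ennreal (?d x powr \<delta>) \<partial>lborel) = I"
    unfolding I_def
  proof (intro nn_integral_cong)
    fix x
    have "x \<in> \<Omega>" if "x \<in> ?K" using that K_sub by (auto simp: boundary_layer_def)
    then show "ennreal ((norm (gradient \<psi> x))\<^sup>2) * ennreal (?d x powr \<delta>) = ?G x * indicator \<Omega> x"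
      using G0[of x] by (cases "x \<in> ?K") (auto simp: mult.commute)
  qed
  with hardy have le: "(\<integral>\<^sup>+x\<in>\<Omega>. ennreal (?d x powr (\<delta> - 2)) * ennreal ((norm (\<psi> x))\<^sup>2) \<partial>lborel) \<le> ennreal A * I"
    by simp
  \<comment> \<open>\<open>enn2real\<close> is monotone only below infinity. On the compact support
    the gradient is bounded, and so is the weight, because its exponent \<open>\<delta>\<close> is
    not negative.\<close>
  have fin: "I < \<infinity>"
  proof -
    have "continuous_on ?K (\<lambda>x. norm (gradient \<psi> x))"
      using cont by (intro continuous_intros continuous_on_subset[OF cont]) auto
    then have "compact ((\<lambda>x. norm (gradient \<psi> x)) ` ?K)"
      using K by (rule compact_continuous_image)
    then obtain b where "\<forall>y\<in>(\<lambda>x. norm (gradient \<psi> x)) ` ?K. norm y \<le> b"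
      using compact_imp_bounded bounded_iff by metis
    then have b: "\<And>x. x \<in> ?K \<Longrightarrow> norm (gradient \<psi> x) \<le> b" by simp
    have "I \<le> (\<integral>\<^sup>+x. ennreal (r powr \<delta> * b\<^sup>2) * indicator ?K x \<partial>lborel)"
      unfolding I_def
    proof (intro nn_integral_mono)
      fix x
      show "?G x * indicator \<Omega> x \<le> ennreal (r powr \<delta> * b\<^sup>2) * indicator ?K x"
      proof (cases "x \<in> ?K")
        case True
        then have x: "x \<in> \<Omega>" "?d x < r" using K_sub by (auto simp: boundary_layer_def)
        have "?d x powr \<delta> * (norm (gradient \<psi> x))\<^sup>2 \<le> r powr \<delta> * b\<^sup>2"
          using x \<open>0 \<le> \<delta>\<close> b[OF True] by (intro mult_mono powr_mono2 power_mono) (auto simp: infdist_nonneg)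
        then have "ennreal (?d x powr \<delta> * (norm (gradient \<psi> x))\<^sup>2) \<le> ennreal (r powr \<delta> * b\<^sup>2)"
          by (rule ennreal_leI)
        then show ?thesis using True x by (simp add: ennreal_mult)
      qed (simp add: G0)
    qed
    also have "\<dots> = ennreal (r powr \<delta> * b\<^sup>2) * emeasure lborel ?K"
      by (rule nn_integral_cmult_indicator) auto
    also have "\<dots> < \<infinity>"
      using emeasure_compact_finite[OF K] by (simp add: ennreal_mult_less_top)
    finally show ?thesis .
  qed
  have "L2_norm_on \<Omega> (\<lambda>x. ?d x powr (\<delta>/2 - 1) *\<^sub>R \<psi> x)
    = sqrt (enn2real (\<integral>\<^sup>+x\<in>\<Omega>. ennreal (?d x powr (\<delta> - 2)) * ennreal ((norm (\<psi> x))\<^sup>2) \<partial>lborel))"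
    using L2_norm_on_eq_nn_integral[of \<Omega> ?d \<psi> "\<delta> - 2", OF meas(1,2,4) dpos] by (simp add: diff_divide_distrib)
  also have "\<dots> \<le> sqrt (enn2real (ennreal A * I))"
    using le fin by (intro real_sqrt_le_mono enn2real_mono) (auto simp: ennreal_mult_less_top)
  also have "\<dots> = sqrt A * sqrt (enn2real I)"
    using \<open>0 \<le> A\<close> by (simp add: enn2real_mult real_sqrt_mult)
  also have "sqrt (enn2real I) = L2_norm_on \<Omega> (\<lambda>x. ?d x powr (\<delta>/2) *\<^sub>R gradient \<psi> x)"
    unfolding I_def by (rule L2_norm_on_eq_nn_integral[OF meas(1,2,3) dpos, symmetric])
  finally show ?thesis .
qed

lemma C1_compact_support_vanishes:
  fixes \<Omega> :: "(real^'n) set"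
  assumes \<psi>: "\<psi> \<in> C1_compact_support (boundary_layer \<Omega> r)"
    and pos: "\<And>x. x \<in> \<Omega> \<Longrightarrow> 0 < infdist x (frontier \<Omega>)"
  shows "r \<le> infdist x (frontier \<Omega>) \<Longrightarrow> \<psi> x = 0"
    and "\<exists>\<eta>>0. \<forall>x. infdist x (frontier \<Omega>) \<le> \<eta> \<longrightarrow> \<psi> x = 0"
proof -
  let ?d = "\<lambda>x. infdist x (frontier \<Omega>)"
  let ?K = "closure {x. \<psi> x \<noteq> 0}"
  have K: "compact ?K" "?K \<subseteq> boundary_layer \<Omega> r"
    using \<psi> by (auto simp: C1_compact_support_def)
  have outside: "\<psi> x = 0" if "x \<notin> ?K" for x
    using that closure_subset[of "{x. \<psi> x \<noteq> 0}"] by auto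
  show "r \<le> ?d x \<Longrightarrow> \<psi> x = 0"
    using outside[of x] K(2) by (force simp: boundary_layer_def)
  show "\<exists>\<eta>>0. \<forall>x. ?d x \<le> \<eta> \<longrightarrow> \<psi> x = 0"
  proof (cases "?K = {}")
    case True
    then have "\<psi> x = 0" for x using outside[of x] by blast
    then show ?thesis by (intro exI[of _ 1]) simp
  next
    case False
    have "continuous_on ?K ?d" by (intro continuous_intros)
    then obtain z where z: "z \<in> ?K" "\<And>x. x \<in> ?K \<Longrightarrow> ?d z \<le> ?d x"
      using continuous_attains_inf[OF K(1) False] by blast
    have "0 < ?d z" using z(1) K(2) pos by (auto simp: boundary_layer_def)
    \<comment> \<open>Half of the least distance, because the claim includes the points at distance
      exactly \<open>\<eta>\<close>.\<close>
    moreover have "\<psi> x = 0" if "?d x \<le> ?d z / 2" for x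
    proof (rule outside)
      show "x \<notin> ?K" using z(2)[of x] that \<open>0 < ?d z\<close> by linarith
    qed
    ultimately show ?thesis by (intro exI[of _ "?d z / 2"]) simp
  qed
qed

theorem theorem3p1:
  fixes \<Omega> :: "(real^'n) set" and \<delta> :: real
  assumes "uniform_domain \<Omega>"
    and "frontier \<Omega> \<noteq> {}"
    and "locally_uniformly_Ahlfors_regular (frontier \<Omega>)"
    and "\<delta> \<ge> 0"
    and "\<delta> \<in> {0..<2 - (real CARD('n) - hausdorff_dim (frontier \<Omega>))}
         \<or> \<delta> > 2 - (real CARD('n) - hausdorff_dim (frontier \<Omega>))"
  shows "\<exists>r0>0. \<forall>r\<in>{0<..<r0}. \<exists>a>0. \<forall>\<psi>\<in>C1_compact_support (boundary_layer \<Omega> r).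
           L2_norm_on \<Omega> (\<lambda>x. infdist x (frontier \<Omega>) powr (\<delta>/2 - 1) *\<^sub>R \<psi> x)
           \<le> a * L2_norm_on \<Omega> (\<lambda>x. infdist x (frontier \<Omega>) powr (\<delta>/2) *\<^sub>R gradient \<psi> x)"
proof -
  let ?\<Gamma> = "frontier \<Omega>"
  have cl: "closed ?\<Gamma>" by (rule frontier_closed)
  obtain M C R s where reg: "uniformly_ball_regular M ?\<Gamma> C R s"
    using Ahlfors_regular_imp_uniformly_ball_regular[OF assms(3) cl] by blast
  have s: "hausdorff_dim ?\<Gamma> = s"
    by (rule hausdorff_dim_eq_if_uniformly_ball_regular[OF reg cl assms(2)])
  have \<Omega>: "open \<Omega>" "\<Omega> \<noteq> {}" using assms(1) by (auto simp: uniform_domain_def)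
  obtain \<sigma> where \<sigma>: "1 \<le> \<sigma>" and ex: "\<forall>x\<in>\<Omega>. \<forall>y\<in>\<Omega>. \<exists>\<gamma> l.
        arc_length_curve \<gamma> l \<and> \<gamma> ` {0..l} \<subseteq> \<Omega> \<and> \<gamma> 0 = x \<and> \<gamma> l = y \<and>
        l \<le> \<sigma> * dist x y \<and> (\<forall>t\<in>{0..l}. infdist (\<gamma> t) ?\<Gamma> \<ge> min t (l - t) / \<sigma>)"
    using assms(1) unfolding uniform_domain_def by (elim conjE exE) (rule that)
  have curves: "\<exists>\<gamma> l. uniform_curve ?\<Gamma> \<sigma> x y \<gamma> l" if xy: "x \<in> \<Omega>" "y \<in> \<Omega>" for x y
  proof -
    obtain \<gamma> l where "arc_length_curve \<gamma> l" "\<gamma> 0 = x" "\<gamma> l = y" "l \<le> \<sigma> * dist x y"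
        "\<forall>t\<in>{0..l}. infdist (\<gamma> t) ?\<Gamma> \<ge> min t (l - t) / \<sigma>"
      using bspec[OF bspec[OF ex xy(1)] xy(2)] by (elim exE conjE) (rule that)
    then show ?thesis unfolding uniform_curve_def by (intro exI conjI)
  qed
  have balls: "0 < infdist y ?\<Gamma> \<and> ball y (infdist y ?\<Gamma>) \<subseteq> \<Omega>" if "y \<in> \<Omega>" for y
    using ball_infdist_frontier_subset[OF \<Omega>(1) that assms(2)] by blast
  obtain a where a: "a \<in> \<Omega>" using \<Omega>(2) by blast
  \<comment> \<open>Every point is at least half of \<open>dist a b\<close> away from
    \<open>a\<close> or from \<open>b\<close>; this provides curves of a fixed minimal extent for
    the outward chains, whatever the shape of the domain.\<close>
  have "\<Omega> \<noteq> {a}" using \<Omega>(1) not_open_singleton[of a] by metis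
  then obtain b where ab: "a \<in> \<Omega>" "b \<in> \<Omega>" "a \<noteq> b" using a by blast
  have far: "\<exists>y \<gamma> l. uniform_curve ?\<Gamma> \<sigma> x y \<gamma> l \<and> dist a b / 2 \<le> dist x y" if "x \<in> \<Omega>" for x
  proof -
    have "dist a b / 2 \<le> dist x a \<or> dist a b / 2 \<le> dist x b"
      using dist_triangle[of a b x] unfolding dist_commute[of a x] by linarith
    then show ?thesis using curves[OF that ab(1)] curves[OF that ab(2)] by blast
  qed
  \<comment> \<open>Both cases are brought to the weaker form in which \<open>f\<close> also
    vanishes near the boundary; compact support supplies this for \<open>\<psi>\<close>.\<close>
  have "\<exists>r0>0. \<exists>A\<ge>0. \<forall>r f F. 0 < r \<and> r < r0 \<and> sq_upper_gradient f F \<and> (\<forall>p. r \<le> infdist p ?\<Gamma> \<longrightarrow> f p = 0) \<and>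
     (\<exists>\<eta>>0. \<forall>p. infdist p ?\<Gamma> \<le> \<eta> \<longrightarrow> f p = 0) \<longrightarrow>
     (\<integral>\<^sup>+x\<in>\<Omega>. ennreal (infdist x ?\<Gamma> powr (\<delta> - 2)) * ennreal ((f x)\<^sup>2) \<partial>lborel)
       \<le> ennreal A * (\<integral>\<^sup>+y. F y * ennreal (infdist y ?\<Gamma> powr \<delta>) \<partial>lborel)"
    using assms(5)
  proof
    assume "\<delta> \<in> {0..<2 - (real CARD('n) - hausdorff_dim ?\<Gamma>)}"
    then have "real DIM(real^'n) - 2 + \<delta> < s" by (simp add: s)
    show ?thesis
      by (rule thick_hardy[OF reg cl assms(2) \<Omega>(1) balls \<sigma> _ curves \<open>real DIM(real^'n) - 2 + \<delta> < s\<close>])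
        (simp_all add: frontier_def)
  next
    assume "\<delta> > 2 - (real CARD('n) - hausdorff_dim ?\<Gamma>)"
    then have "s < real DIM(real^'n) - 2 + \<delta>" by (simp add: s)
    have "0 < dist a b / 2" using ab(3) by simp
    note thin_hardy[OF reg cl assms(2) \<Omega>(1) _ \<sigma> this _ \<open>s < real DIM(real^'n) - 2 + \<delta>\<close>, OF balls far]
    then obtain r0 A where "r0 > 0" "A \<ge> 0" and h:
      "\<forall>r f F. 0 < r \<and> r < r0 \<and> sq_upper_gradient f F \<and> (\<forall>p. r \<le> infdist p ?\<Gamma> \<longrightarrow> f p = 0) \<longrightarrow>
     (\<integral>\<^sup>+x\<in>\<Omega>. ennreal (infdist x ?\<Gamma> powr (\<delta> - 2)) * ennreal ((f x)\<^sup>2) \<partial>lborel)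
       \<le> ennreal A * (\<integral>\<^sup>+y. F y * ennreal (infdist y ?\<Gamma> powr \<delta>) \<partial>lborel)"
      by blast
    then show ?thesis by - (rule exI[of _ r0], rule conjI, simp, rule exI[of _ A], rule conjI, simp, blast)
  qed
  then obtain r0 A where r0: "r0 > 0" and A: "A \<ge> 0" and hardy:
    "\<forall>r f F. 0 < r \<and> r < r0 \<and> sq_upper_gradient f F \<and> (\<forall>p. r \<le> infdist p ?\<Gamma> \<longrightarrow> f p = 0) \<and>
     (\<exists>\<eta>>0. \<forall>p. infdist p ?\<Gamma> \<le> \<eta> \<longrightarrow> f p = 0) \<longrightarrow>
     (\<integral>\<^sup>+x\<in>\<Omega>. ennreal (infdist x ?\<Gamma> powr (\<delta> - 2)) * ennreal ((f x)\<^sup>2) \<partial>lborel)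
       \<le> ennreal A * (\<integral>\<^sup>+y. F y * ennreal (infdist y ?\<Gamma> powr \<delta>) \<partial>lborel)"
    by (elim exE conjE) (rule that)
  \<comment> \<open>The constant \<open>A\<close> may be 0 whereas \<open>a\<close> has to be
    positive, hence \<open>A + 1\<close>. It is the same for all \<open>r\<close> below
    \<open>r0\<close>.\<close>
  have main: "L2_norm_on \<Omega> (\<lambda>x. infdist x ?\<Gamma> powr (\<delta>/2 - 1) *\<^sub>R \<psi> x)
           \<le> sqrt (A + 1) * L2_norm_on \<Omega> (\<lambda>x. infdist x ?\<Gamma> powr (\<delta>/2) *\<^sub>R gradient \<psi> x)"
    if r: "r \<in> {0<..<r0}" and \<psi>: "\<psi> \<in> C1_compact_support (boundary_layer \<Omega> r)" for r \<psi>
  proof (rule C1_compact_support_hardy[OF \<Omega>(1) assms(2) assms(4) _ \<psi>])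
    note v = C1_compact_support_vanishes[OF \<psi> conjunct1[OF balls]]
    have ug: "sq_upper_gradient (\<lambda>x. norm (\<psi> x)) (\<lambda>x. ennreal ((norm (gradient \<psi> x))\<^sup>2))"
      using \<psi> by (intro sq_upper_gradient_norm_gradient) (auto simp: C1_compact_support_def)
    have "(\<integral>\<^sup>+x\<in>\<Omega>. ennreal (infdist x ?\<Gamma> powr (\<delta> - 2)) * ennreal ((norm (\<psi> x))\<^sup>2) \<partial>lborel)
       \<le> ennreal A * (\<integral>\<^sup>+x. ennreal ((norm (gradient \<psi> x))\<^sup>2) * ennreal (infdist x ?\<Gamma> powr \<delta>) \<partial>lborel)"
    proof (rule hardy[THEN spec, THEN spec, THEN spec, THEN mp], intro conjI ug)
      show "\<forall>p. r \<le> infdist p ?\<Gamma> \<longrightarrow> norm (\<psi> p) = 0" using v(1) by simp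
      show "\<exists>\<eta>>0. \<forall>p. infdist p ?\<Gamma> \<le> \<eta> \<longrightarrow> norm (\<psi> p) = 0" using v(2) by simp
    qed (use r in auto)
    also have "\<dots> \<le> ennreal (A + 1) * (\<integral>\<^sup>+x. ennreal ((norm (gradient \<psi> x))\<^sup>2) * ennreal (infdist x ?\<Gamma> powr \<delta>) \<partial>lborel)"
      by (intro mult_right_mono ennreal_leI) auto
    finally show "(\<integral>\<^sup>+x\<in>\<Omega>. ennreal (infdist x ?\<Gamma> powr (\<delta> - 2)) * ennreal ((norm (\<psi> x))\<^sup>2) \<partial>lborel) \<le> \<dots>" .
  qed (use A in simp)
  have "0 < sqrt (A + 1)" using A by simp
  with r0 main show ?thesis by blast
qed

end
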